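(* Let $n>1$, let $D\subset\mathbb{C}^n$ be a bounded regular domain and let $\Lambda$ be its Robin function. Let $\Gamma\subset\partial D$ be a $C^2$-smooth open piece of $\partial D$, fix $z_0\in\Gamma$, and let $\psi$ be a $C^2$-smooth local defining function for $\Gamma$ near $z_0$ (negative on the side of $D$). Define the half space $$\mathcal H=\Big\{z\in\mathbb{C}^n: 2\,\mathrm{Re}\Big(\sum_{\alpha=1}^n\frac{\partial\psi}{\partial z_\alpha}(z_0)\,z_\alpha\Big)-1<0\Big\}$$ and let $\Lambda_{\mathcal H}$ be the Robin function of $\mathcal H$. Then for all multi-indices $A,B\in\mathbb{N}^n$ and $z\in D$, $$(-1)^{|A|+|B|}\,\big(D^{A\overline B}\Lambda(z)\big)\,\big(\psi(z)\big)^{2n-2+|A|+|B|}\longrightarrow D^{A\overline B}\Lambda_{\mathcal H}(0)\quad\text{as } z\to z_0 .$$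
   Context: A domain is regular if there is a subharmonic barrier at each of its boundary points (so the Dirichlet problem with continuous boundary data is solvable). For a domain $\Omega\subset\mathbb{C}^n$ and $p\in\Omega$, the Green function $G_\Omega(z,p)$ with pole $p$, associated with $\Delta=4\sum_j \partial^2/\partial z_j\partial\bar z_j$, is the function that is harmonic in $z\in\Omega\setminus\{p\}$, tends to $0$ as $z\to\partial\Omega$ (and also as $|z|\to\infty$ if $\Omega$ is unbounded), and is such that $G_\Omega(z,p)-|z-p|^{-2n+2}$ is harmonic near $p$. The Robin function of $\Omega$ is $\Lambda_\Omega(p)=\lim_{z\to p}\big(G_\Omega(z,p)-|z-p|^{-2n+2}\big)$; it is a real analytic function on $\Omega$. That $\psi$ is a $C^2$-smooth local defining function for $\Gamma$ near $z_0$ means that there is a neighbourhood $U$ of $z_0$ on which $\psi$ is real valued and $C^2$ with non-vanishing gradient, $U\cap D=\{z\in U:\psi(z)<0\}$ and $U\cap\partial D=U\cap\Gamma=\{z\in U:\psi(z)=0\}$. For $A=(\alpha_1,\dots,\alpha_n)$, $B=(\beta_1,\dots,\beta_n)\in\mathbb{N}^n$, $|A|=\sum\alpha_i$, $D^A=\partial^{|A|}/\partial z_1^{\alpha_1}\cdots\partial z_n^{\alpha_n}$, $D^{\overline B}=\partial^{|B|}/\partial\bar z_1^{\beta_1}\cdots\partial\bar z_n^{\beta_n}$ and $D^{A\overline B}=D^AD^{\overline B}$. *)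

theory Defs
  imports "HOL-Analysis.Analysis"
begin

text \<open>
  Complex Euclidean space of dimension \<open>n\<close> is \<^typ>\<open>complex ^ 'n\<close>, with \<open>n = CARD('n)\<close>. The
  coordinates are indexed by a linearly ordered type, like the indices \<open>1, \<dots>, n\<close>: the order only
  fixes the order in which mixed partial derivatives are taken.
\<close>

section \<open>Partial derivatives\<close>

definition dir_deriv ::
    "'a::real_normed_vector \<Rightarrow> ('a \<Rightarrow> 'b::real_normed_vector) \<Rightarrow> 'a \<Rightarrow> 'b"
  where "dir_deriv v f z = vector_derivative (\<lambda>t. f (z + t *\<^sub>R v)) (at 0)"

text \<open>With \<open>z\<^sub>j = x + \<i> y\<close>, the real coordinate directions of \<open>x\<close> and \<open>y\<close> are \<open>axis j 1\<close> and
  \<open>axis j \<i>\<close>.\<close>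

definition dz :: "'n::finite \<Rightarrow> (complex ^ 'n \<Rightarrow> complex) \<Rightarrow> complex ^ 'n \<Rightarrow> complex"
  where "dz j f z = (dir_deriv (axis j 1) f z - \<i> * dir_deriv (axis j \<i>) f z) / 2"

definition dzbar :: "'n::finite \<Rightarrow> (complex ^ 'n \<Rightarrow> complex) \<Rightarrow> complex ^ 'n \<Rightarrow> complex"
  where "dzbar j f z = (dir_deriv (axis j 1) f z + \<i> * dir_deriv (axis j \<i>) f z) / 2"

definition mi_abs :: "('n::finite \<Rightarrow> nat) \<Rightarrow> nat"
  where "mi_abs A = (\<Sum>j\<in>UNIV. A j)"

definition D_holo ::
    "('n \<Rightarrow> nat) \<Rightarrow> (complex ^ 'n::{finite,linorder} \<Rightarrow> complex) \<Rightarrow> complex ^ 'n::{finite,linorder} \<Rightarrow> complex"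
  where "D_holo A f = foldr (\<lambda>j g. (dz j ^^ A j) g) (sorted_list_of_set UNIV) f"

definition D_anti ::
    "('n \<Rightarrow> nat) \<Rightarrow> (complex ^ 'n::{finite,linorder} \<Rightarrow> complex) \<Rightarrow> complex ^ 'n::{finite,linorder} \<Rightarrow> complex"
  where "D_anti B f = foldr (\<lambda>j g. (dzbar j ^^ B j) g) (sorted_list_of_set UNIV) f"

definition D_mixed ::
    "('n \<Rightarrow> nat) \<Rightarrow> ('n \<Rightarrow> nat) \<Rightarrow> (complex ^ 'n::{finite,linorder} \<Rightarrow> complex)
      \<Rightarrow> complex ^ 'n::{finite,linorder} \<Rightarrow> complex"
  where "D_mixed A B f = D_holo A (D_anti B f)"

section \<open>Harmonic and subharmonic functions, regular domains\<close>

text \<open>Twice continuously Frechet differentiable; meant for open sets \<open>S\<close>.\<close>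

definition C2_on :: "'a::real_normed_vector set \<Rightarrow> ('a \<Rightarrow> 'b::real_normed_vector) \<Rightarrow> bool"
  where "C2_on S f \<longleftrightarrow>
    (\<exists>(f' :: 'a \<Rightarrow> 'a \<Rightarrow>\<^sub>L 'b) (f'' :: 'a \<Rightarrow> 'a \<Rightarrow>\<^sub>L ('a \<Rightarrow>\<^sub>L 'b)).
      (\<forall>x\<in>S. (f has_derivative blinfun_apply (f' x)) (at x)) \<and>
      (\<forall>x\<in>S. (f' has_derivative blinfun_apply (f'' x)) (at x)) \<and>
      continuous_on S f'')"

definition laplacian :: "(complex ^ 'n::finite \<Rightarrow> complex) \<Rightarrow> complex ^ 'n \<Rightarrow> complex"
  where "laplacian f z = 4 * (\<Sum>j\<in>UNIV. dz j (dzbar j f) z)"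

definition harmonic_on :: "(complex ^ 'n::finite) set \<Rightarrow> (complex ^ 'n \<Rightarrow> real) \<Rightarrow> bool"
  where "harmonic_on S u \<longleftrightarrow> C2_on S u \<and> (\<forall>z\<in>S. laplacian (\<lambda>w. complex_of_real (u w)) z = 0)"

text \<open>Real-valued subharmonic functions: upper semicontinuity and domination by harmonic majorants
  on closed balls.\<close>

definition subharmonic_on :: "(complex ^ 'n::finite) set \<Rightarrow> (complex ^ 'n \<Rightarrow> real) \<Rightarrow> bool"
  where "subharmonic_on S u \<longleftrightarrow>
    (\<forall>x\<in>S. \<forall>c>u x. eventually (\<lambda>y. u y < c) (at x within S)) \<and>
    (\<forall>a r h. r > 0 \<and> cball a r \<subseteq> S \<and> continuous_on (cball a r) h \<and> harmonic_on (ball a r) h \<and>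
       (\<forall>y\<in>sphere a r. u y \<le> h y) \<longrightarrow> (\<forall>y\<in>cball a r. u y \<le> h y))"

definition barrier_at ::
    "(complex ^ 'n::finite) set \<Rightarrow> complex ^ 'n \<Rightarrow> (complex ^ 'n \<Rightarrow> real) \<Rightarrow> bool"
  where "barrier_at \<Omega> \<zeta> b \<longleftrightarrow>
    continuous_on (closure \<Omega>) b \<and> subharmonic_on \<Omega> b \<and>
    b \<zeta> = 0 \<and> (\<forall>z\<in>closure \<Omega> - {\<zeta>}. b z < 0)"

definition regular_domain :: "(complex ^ 'n::finite) set \<Rightarrow> bool"
  where "regular_domain \<Omega> \<longleftrightarrow>
    open \<Omega> \<and> connected \<Omega> \<and> \<Omega> \<noteq> {} \<and> (\<forall>\<zeta>\<in>frontier \<Omega>. \<exists>b. barrier_at \<Omega> \<zeta> b)"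

section \<open>Green function and Robin function\<close>

definition pole_term :: "complex ^ 'n::finite \<Rightarrow> complex ^ 'n \<Rightarrow> real"
  where "pole_term p z = norm (z - p) powi (- 2 * int CARD('n) + 2)"

definition is_green ::
    "(complex ^ 'n::finite) set \<Rightarrow> complex ^ 'n \<Rightarrow> (complex ^ 'n \<Rightarrow> real) \<Rightarrow> bool"
  where "is_green \<Omega> p G \<longleftrightarrow>
    harmonic_on (\<Omega> - {p}) G \<and>
    (\<forall>\<zeta>\<in>frontier \<Omega>. (G \<longlongrightarrow> 0) (at \<zeta> within \<Omega>)) \<and>
    (\<not> bounded \<Omega> \<longrightarrow> (G \<longlongrightarrow> 0) (inf at_infinity (principal \<Omega>))) \<and>
    (\<exists>r>0. \<exists>h. harmonic_on (ball p r) h \<and> (\<forall>z\<in>ball p r - {p}. h z = G z - pole_term p z))"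

text \<open>By the maximum principle \<^const>\<open>is_green\<close> determines the function on \<open>\<Omega> - {p}\<close>, so the choice
  concerns only irrelevant values, at \<open>p\<close> and outside \<open>\<Omega>\<close>.\<close>

definition green :: "(complex ^ 'n::finite) set \<Rightarrow> complex ^ 'n \<Rightarrow> complex ^ 'n \<Rightarrow> real"
  where "green \<Omega> p = (SOME G. is_green \<Omega> p G)"

definition robin :: "(complex ^ 'n::finite) set \<Rightarrow> complex ^ 'n \<Rightarrow> real"
  where "robin \<Omega> p = Lim (at p) (\<lambda>z. green \<Omega> p z - pole_term p z)"

section \<open>Smooth boundary pieces\<close>

definition local_defining_function ::
    "(complex ^ 'n::finite) set \<Rightarrow> (complex ^ 'n) set \<Rightarrow> complex ^ 'n \<Rightarrow> (complex ^ 'n \<Rightarrow> real) \<Rightarrow> bool"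
  where "local_defining_function D \<Gamma> z0 \<psi> \<longleftrightarrow>
    (\<exists>U. open U \<and> z0 \<in> U \<and> C2_on U \<psi> \<and>
      (\<forall>z\<in>U. \<exists>g. GDERIV \<psi> z :> g \<and> g \<noteq> 0) \<and>
      U \<inter> D = {z\<in>U. \<psi> z < 0} \<and>
      U \<inter> frontier D = U \<inter> \<Gamma> \<and>
      U \<inter> \<Gamma> = {z\<in>U. \<psi> z = 0})"

definition C2_boundary_piece :: "(complex ^ 'n::finite) set \<Rightarrow> (complex ^ 'n) set \<Rightarrow> bool"
  where "C2_boundary_piece D \<Gamma> \<longleftrightarrow>
    openin (top_of_set (frontier D)) \<Gamma> \<and> (\<forall>\<zeta>\<in>\<Gamma>. \<exists>\<psi>. local_defining_function D \<Gamma> \<zeta> \<psi>)"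

definition half_space :: "(complex ^ 'n::finite \<Rightarrow> real) \<Rightarrow> complex ^ 'n \<Rightarrow> (complex ^ 'n) set"
  where "half_space \<psi> z0 =
    {z. 2 * Re (\<Sum>\<alpha>\<in>UNIV. dz \<alpha> (\<lambda>w. complex_of_real (\<psi> w)) z0 * z $ \<alpha>) - 1 < 0}"

end

theory Submission
  imports Defs
begin

text \<open>
  Write \<open>G_D(z, p) = |z - p|^(2 - 2n) - V(z, p)\<close>, so that the Robin function is \<open>- V(p, p)\<close>, where \<open>V(\<cdot>, p)\<close>
  solves the Dirichlet problem with data \<open>|w - p|^(2 - 2n)\<close>. The solution depends linearly and boundedly on
  the data, so \<open>V\<close> is harmonic in \<open>p\<close> as well, hence jointly harmonic on \<open>D \<times> D\<close>. Rescale by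
  \<open>w = p + (- \<psi> p) x\<close>: near the origin the boundary becomes the boundary of the half space, where the
  kernels with poles \<open>q\<close> and its mirror image \<open>q*\<close> agree, and far away both kernels are small. By the
  maximum principle the rescaled \<open>V(z, q)\<close> is uniformly close to \<open>|z - q*|^(2 - 2n)\<close> near the origin of
  the product space. Derivative estimates for harmonic functions there, restricted to the diagonal,
  give the convergence of all derivatives.

  The potential theory is integral free. Harmonic extensions from spheres come from harmonic
  polynomials and the Stone--Weierstrass theorem, derivative estimates from a reflection and the
  maximum principle, and the general Dirichlet problem from Perron's method.
\<close>

section \<open>The difference Laplacian and the maximum principle\<close>

text \<open>The obstacle is that the Robin function is only real analytic: uniform closeness of
  rescaled Robin functions says nothing about their derivatives. As the restriction to the diagonal
  of a jointly harmonic kernel it inherits interior estimates, on a ball of fixed radius 1/(2|N|),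
  where N is the real gradient of \<open>\<psi>\<close> at \<open>z0\<close>.

  No convergence of the rescaled domains enters. For a pole p + t q with t = - \<open>\<psi>\<close>
  p, the image pole p + t q* lies outside the closure of D, so V and the image kernel both solve
  Dirichlet problems in D itself, and only their boundary data are compared. After scaling these
  differ by at most e, uniformly in q, because \<open>\<psi>\<close> is strictly differentiable at
  \<open>z0\<close>; this is also why p may approach \<open>z0\<close> in an arbitrary way inside D.

  Each derivative taken through x |-> p + t x contributes a factor t, and the kernel is homogeneous
  of degree 2 - 2n. This explains the power of - \<open>\<psi>\<close> p, and rewriting it as a
  power of \<open>\<psi>\<close> p leaves the sign (-1)^(|A|+|B|).\<close>

text \<open>No differentiability is required, so that a continuous function that is harmonic in each of
  two groups of variables is harmonic by definition, and a harmonic dependence on a parameter only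
  needs to be checked on difference quotients.\<close>

definition diff_laplacian :: "('a::euclidean_space \<Rightarrow> real) \<Rightarrow> 'a \<Rightarrow> real \<Rightarrow> real"
  where "diff_laplacian u x t = (\<Sum>b\<in>Basis. u (x + t *\<^sub>R b) + u (x - t *\<^sub>R b) - 2 * u x) / t\<^sup>2"

definition dharmonic_on :: "'a::euclidean_space set \<Rightarrow> ('a \<Rightarrow> real) \<Rightarrow> bool"
  where "dharmonic_on S u \<longleftrightarrow> continuous_on S u \<and> (\<forall>x\<in>S. (diff_laplacian u x \<longlongrightarrow> 0) (at 0))"

lemma dharmonic_on_continuous: "dharmonic_on S u \<Longrightarrow> continuous_on S u"
  by (simp add: dharmonic_on_def)

lemma dharmonic_on_subset: "dharmonic_on S u \<Longrightarrow> T \<subseteq> S \<Longrightarrow> dharmonic_on T u"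
  unfolding dharmonic_on_def using continuous_on_subset by blast

lemma diff_laplacian_add:
  "diff_laplacian (\<lambda>x. u x + v x) x t = diff_laplacian u x t + diff_laplacian v x t"
  unfolding diff_laplacian_def add_divide_distrib [symmetric] sum.distrib [symmetric]
  by (rule arg_cong2[where f="(/)"]; simp add: algebra_simps)

lemma diff_laplacian_cmult: "diff_laplacian (\<lambda>x. c * u x) x t = c * diff_laplacian u x t"
  unfolding diff_laplacian_def times_divide_eq_right sum_distrib_left
  by (rule arg_cong2[where f="(/)"]; simp add: algebra_simps)

lemma dharmonic_on_add:
  assumes "dharmonic_on S u" "dharmonic_on S v"
  shows "dharmonic_on S (\<lambda>x. u x + v x)"
  using assms unfolding dharmonic_on_def diff_laplacian_add[abs_def]
  by (auto intro!: continuous_intros tendsto_add_zero)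

lemma dharmonic_on_cmult: "dharmonic_on S u \<Longrightarrow> dharmonic_on S (\<lambda>x. c * u x)"
  unfolding dharmonic_on_def diff_laplacian_cmult[abs_def]
  by (auto intro!: continuous_intros tendsto_mult_right_zero)

lemma dharmonic_on_diff:
  assumes "dharmonic_on S u" "dharmonic_on S v"
  shows "dharmonic_on S (\<lambda>x. u x - v x)"
  using dharmonic_on_add[OF assms(1) dharmonic_on_cmult[OF assms(2), of "-1"]] by simp

lemma dharmonic_on_affine: "dharmonic_on S (\<lambda>x. a \<bullet> x + c)"
proof -
  have "diff_laplacian (\<lambda>x. a \<bullet> x + c) x = (\<lambda>t. 0)" for x
    by (simp add: fun_eq_iff diff_laplacian_def inner_add_right inner_diff_right)
  then show ?thesis
    by (auto simp: dharmonic_on_def intro!: continuous_intros)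
qed

lemma dharmonic_on_const: "dharmonic_on S (\<lambda>x. c)"
  using dharmonic_on_affine[of S 0 c] by simp

lemma diff_laplacian_cong:
  assumes "\<And>y. y \<in> ball x r \<Longrightarrow> u y = v y" "r > 0"
  shows "eventually (\<lambda>t. diff_laplacian u x t = diff_laplacian v x t) (at 0)"
proof -
  have "eventually (\<lambda>t::real. t \<in> ball 0 r) (at 0)"
    using assms(2) by (intro eventually_at_in_open') auto
  then show ?thesis
  proof eventually_elim
    case (elim t)
    then have "u (x + t *\<^sub>R b) = v (x + t *\<^sub>R b)" "u (x - t *\<^sub>R b) = v (x - t *\<^sub>R b)"
      if "b \<in> Basis" for b
      using that by (auto intro!: assms(1) simp: dist_norm)
    then show ?case
      using assms by (simp add: diff_laplacian_def)
  qed
qed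

lemma dharmonic_on_cong:
  assumes "open S" "\<And>x. x \<in> S \<Longrightarrow> u x = v x" "dharmonic_on S u"
  shows "dharmonic_on S v"
  unfolding dharmonic_on_def
proof safe
  show "continuous_on S v"
    using assms by (metis continuous_on_cong dharmonic_on_continuous)
  fix x assume "x \<in> S"
  then obtain r where "r > 0" "ball x r \<subseteq> S"
    using assms(1) openE by blast
  then have "eventually (\<lambda>t. diff_laplacian u x t = diff_laplacian v x t) (at 0)"
    by (intro diff_laplacian_cong) (use assms(2) in auto)
  then show "(diff_laplacian v x \<longlongrightarrow> 0) (at 0)"
    using \<open>x \<in> S\<close> assms(3) tendsto_cong unfolding dharmonic_on_def by blast
qed

lemma dharmonic_on_local:
  assumes "\<And>x. x \<in> S \<Longrightarrow> \<exists>r>0. dharmonic_on (ball x r) u"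
  shows "dharmonic_on S u"
  unfolding dharmonic_on_def
proof safe
  have "isCont u x" if "x \<in> S" for x
    using assms[OF that] by (metis centre_in_ball continuous_on_interior dharmonic_on_continuous
        interior_open open_ball)
  then show "continuous_on S u"
    by (simp add: continuous_at_imp_continuous_on)
qed (use assms centre_in_ball in \<open>unfold dharmonic_on_def, blast\<close>)

lemma dharmonic_on_compose_scale:
  assumes "dharmonic_on S u" "r \<noteq> 0"
  shows "dharmonic_on {x. a + r *\<^sub>R x \<in> S} (\<lambda>x. u (a + r *\<^sub>R x))"
proof -
  have lap: "diff_laplacian (\<lambda>x. u (a + r *\<^sub>R x)) x t
      = r\<^sup>2 * diff_laplacian u (a + r *\<^sub>R x) (r * t)" for x t
    using \<open>r \<noteq> 0\<close> unfolding diff_laplacian_def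
    by (simp add: algebra_simps power_mult_distrib)
  have "((\<lambda>t. r\<^sup>2 * diff_laplacian u (a + r *\<^sub>R x) (r * t)) \<longlongrightarrow> 0) (at 0)"
    if "a + r *\<^sub>R x \<in> S" for x
  proof -
    have "(diff_laplacian u (a + r *\<^sub>R x) \<longlongrightarrow> 0) (at 0)"
      using assms that by (simp add: dharmonic_on_def)
    moreover have "filterlim (\<lambda>t. r * t) (at 0) (at 0)"
      using \<open>r \<noteq> 0\<close> by (auto simp: filterlim_at eventually_at_filter intro!: tendsto_eq_intros)
    ultimately show ?thesis
      by (intro tendsto_mult_right_zero) (rule filterlim_compose)
  qed
  then show ?thesis
    using assms unfolding dharmonic_on_def lap[abs_def]
    by (auto intro!: continuous_intros elim!: continuous_on_compose2)
qed

lemma dharmonic_on_translate: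
  assumes "dharmonic_on S u"
  shows "dharmonic_on {x. x + a \<in> S} (\<lambda>x. u (x + a))"
  using dharmonic_on_compose_scale[OF assms, of 1 a] by (simp add: add.commute)

text \<open>The reflection permutes the sample points: it swaps the two on the axis \<open>c\<close>
  and carries the others along with \<open>x\<close>. The difference quotients therefore agree
  exactly, not only in the limit.\<close>

lemma dharmonic_on_reflect:
  assumes "dharmonic_on S u" "c \<in> Basis"
  shows "dharmonic_on {x. x - (2 * (x \<bullet> c)) *\<^sub>R c \<in> S} (\<lambda>x. u (x - (2 * (x \<bullet> c)) *\<^sub>R c))"
proof -
  let ?\<sigma> = "\<lambda>x. x - (2 * (x \<bullet> c)) *\<^sub>R c"
  have lap: "diff_laplacian (\<lambda>x. u (?\<sigma> x)) x t = diff_laplacian u (?\<sigma> x) t" for x t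
  proof -
    have "u (?\<sigma> (x + t *\<^sub>R b)) + u (?\<sigma> (x - t *\<^sub>R b)) = u (?\<sigma> x + t *\<^sub>R b) + u (?\<sigma> x - t *\<^sub>R b)"
      if b: "b \<in> Basis" for b
    proof (cases "b = c")
      case True
      then have "?\<sigma> (x + t *\<^sub>R b) = ?\<sigma> x - t *\<^sub>R b" "?\<sigma> (x - t *\<^sub>R b) = ?\<sigma> x + t *\<^sub>R b"
        using b by (simp_all add: inner_add_left inner_diff_left algebra_simps scaleR_2
            flip: scaleR_add_left)
      then show ?thesis by (metis add.commute)
    next
      case False
      then have "?\<sigma> (x + t *\<^sub>R b) = ?\<sigma> x + t *\<^sub>R b" "?\<sigma> (x - t *\<^sub>R b) = ?\<sigma> x - t *\<^sub>R b"
        using b assms(2) by (simp_all add: inner_add_left inner_diff_left inner_not_same_Basis)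
      then show ?thesis by metis
    qed
    then show ?thesis by (simp add: diff_laplacian_def)
  qed
  show ?thesis
    using assms unfolding dharmonic_on_def lap[abs_def]
    by (auto intro!: continuous_intros elim!: continuous_on_compose2)
qed

text \<open>The property is shared by harmonic functions and by functions that lie below their harmonic
  majorants; the quadratic term makes the strong maximum principle unnecessary.\<close>

definition no_local_max :: "'a::euclidean_space set \<Rightarrow> ('a \<Rightarrow> real) \<Rightarrow> bool"
  where "no_local_max S u \<longleftrightarrow> (\<forall>y\<in>S. \<forall>e>0. \<forall>c. \<forall>r>0. ball y r \<subseteq> S \<longrightarrow>
    \<not> (\<forall>z\<in>ball y r. u z + e * (norm (z - c))\<^sup>2 \<le> u y + e * (norm (y - c))\<^sup>2))"

lemma parallelogram:
  fixes x y :: "'a::real_inner"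
  shows "(norm (x + y))\<^sup>2 + (norm (x - y))\<^sup>2 = 2 * (norm x)\<^sup>2 + 2 * (norm y)\<^sup>2"
  by (simp add: power2_norm_eq_inner inner_add_left inner_add_right inner_diff_left
      inner_diff_right inner_commute)

text \<open>At a local maximum of u + e |. - c|^2 the parallelogram law bounds each second
  difference of \<open>u\<close> by - 2 e t^2, so the difference Laplacian stays below a negative
  constant and cannot tend to 0.\<close>

lemma dharmonic_no_local_max:
  fixes u :: "'a::euclidean_space \<Rightarrow> real"
  assumes "dharmonic_on S u"
  shows "no_local_max S u"
  unfolding no_local_max_def
proof (intro ballI allI impI notI)
  fix y c :: 'a and e r :: real
  assume y: "y \<in> S" "e > 0" "r > 0" "ball y r \<subseteq> S"
    and max: "\<forall>z\<in>ball y r. u z + e * (norm (z - c))\<^sup>2 \<le> u y + e * (norm (y - c))\<^sup>2"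
  have "eventually (\<lambda>t::real. t \<in> ball 0 r) (at 0)"
    using y by (intro eventually_at_in_open') auto
  then have "eventually (\<lambda>t. diff_laplacian u y t \<le> - 2 * e * DIM('a)) (at 0)"
    using eventually_neq_at_within[of 0 0 UNIV]
  proof eventually_elim
    case (elim t)
    have "u (y + t *\<^sub>R b) + u (y - t *\<^sub>R b) - 2 * u y \<le> - 2 * e * t\<^sup>2" if b: "b \<in> Basis" for b
    proof -
      have "u (y + t *\<^sub>R b) + e * (norm (y + t *\<^sub>R b - c))\<^sup>2 \<le> u y + e * (norm (y - c))\<^sup>2"
        "u (y - t *\<^sub>R b) + e * (norm (y - t *\<^sub>R b - c))\<^sup>2 \<le> u y + e * (norm (y - c))\<^sup>2"
        using max elim b by (auto simp: dist_norm)
      moreover have "(norm (y + t *\<^sub>R b - c))\<^sup>2 + (norm (y - t *\<^sub>R b - c))\<^sup>2 = 2 * (norm (y - c))\<^sup>2 + 2 * t\<^sup>2"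
      proof -
        have "y + t *\<^sub>R b - c = (y - c) + t *\<^sub>R b" "y - t *\<^sub>R b - c = (y - c) - t *\<^sub>R b"
          by simp_all
        then show ?thesis
          using b by (simp only: parallelogram) (simp add: power_mult_distrib)
      qed
      then have "e * (norm (y + t *\<^sub>R b - c))\<^sup>2 + e * (norm (y - t *\<^sub>R b - c))\<^sup>2
          = 2 * (e * (norm (y - c))\<^sup>2) + 2 * e * t\<^sup>2"
        unfolding distrib_left[symmetric] by (simp add: distrib_left)
      ultimately show ?thesis by simp
    qed
    then have "(\<Sum>b\<in>Basis. u (y + t *\<^sub>R b) + u (y - t *\<^sub>R b) - 2 * u y) \<le> (\<Sum>b\<in>(Basis::'a set). - 2 * e * t\<^sup>2)"
      by (rule sum_mono)
    then show ?case
      using elim by (simp add: diff_laplacian_def divide_simps mult_ac)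
  qed
  moreover have "(diff_laplacian u y \<longlongrightarrow> 0) (at 0)"
    using assms y by (simp add: dharmonic_on_def)
  ultimately have "0 \<le> - 2 * e * DIM('a)"
    by (intro tendsto_upperbound[of "diff_laplacian u y" 0 "at 0"]) simp_all
  moreover have "2 * e * DIM('a) > 0"
    using y by simp
  ultimately show False by linarith
qed

lemma no_local_max_add_const: "no_local_max S u \<Longrightarrow> no_local_max S (\<lambda>x. u x + k)"
proof -
  have eq: "(a + k + b \<le> c + k + d) = (a + b \<le> c + d)" for a b c d :: real by linarith
  show "no_local_max S u \<Longrightarrow> no_local_max S (\<lambda>x. u x + k)"
    unfolding no_local_max_def eq .
qed

text \<open>Compactness of the superlevel sets expresses the boundary condition without reference to
  boundary values or boundedness. The same lemma thus serves bounded sets and Green functions of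
  unbounded domains, where decay at infinity supplies compactness.\<close>

lemma maximum_principle_superlevel:
  fixes u :: "'a::euclidean_space \<Rightarrow> real"
  assumes "open S" "continuous_on S u" "no_local_max S u"
    and comp: "\<And>c. c > 0 \<Longrightarrow> compact {z\<in>S. u z \<ge> c}"
    and "x \<in> S"
  shows "u x \<le> 0"
proof (rule ccontr)
  assume "\<not> u x \<le> 0"
  then have ux: "u x > 0" by simp
  define K where "K = {z\<in>S. u z \<ge> u x / 2}"
  have K: "compact K"
    unfolding K_def using ux by (intro comp) simp
  then obtain B where B: "B > 0" "\<And>z. z \<in> K \<Longrightarrow> norm (z - x) \<le> B"
    using bounded_pos[of "(\<lambda>z. z - x) ` K"] compact_imp_bounded[OF K]
    by (metis bounded_translation_minus image_eqI)
  \<comment> \<open>On \<open>K\<close> the quadratic term is then at most a quarter of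
    \<open>u x\<close>, so the maximum point of \<open>w\<close> on \<open>K\<close> still has
    \<open>u y > u x / 2\<close> and is interior to \<open>K\<close>.\<close>
  define e where "e = u x / (4 * B\<^sup>2)"
  have e: "e > 0" and eB: "e * B\<^sup>2 < u x / 2"
    using ux B by (auto simp: e_def)
  define w where "w z = u z + e * (norm (z - x))\<^sup>2" for z
  have "x \<in> K"
    using ux \<open>x \<in> S\<close> by (simp add: K_def)
  moreover have "continuous_on K w"
    unfolding w_def using assms(2) by (auto simp: K_def intro!: continuous_intros elim: continuous_on_subset)
  ultimately obtain y where y: "y \<in> K" "\<And>z. z \<in> K \<Longrightarrow> w z \<le> w y"
    using continuous_attains_sup[OF K] by blast
  have "w x \<le> w y"
    using y \<open>x \<in> K\<close> by blast
  then have "u x \<le> u y + e * (norm (y - x))\<^sup>2"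
    by (simp add: w_def)
  moreover have "e * (norm (y - x))\<^sup>2 \<le> e * B\<^sup>2"
    using B y e by (intro mult_left_mono power_mono) auto
  ultimately have uy: "u y > u x / 2"
    using eB by simp
  have "isCont u y"
    using y assms(1,2) by (auto simp: K_def continuous_on_eq_continuous_at)
  then have "eventually (\<lambda>z. u z > u x / 2) (nhds y)"
    using uy by (metis isCont_def order_tendstoD(1) eventually_nhds_conv_at)
  moreover have "eventually (\<lambda>z. z \<in> S) (nhds y)"
    using y assms(1) by (auto simp: K_def intro: eventually_nhds_in_open)
  ultimately have "eventually (\<lambda>z. z \<in> K) (nhds y)"
    by eventually_elim (auto simp: K_def)
  then obtain r where r: "r > 0" "ball y r \<subseteq> K"
    by (metis eventually_nhds_metric mem_ball dist_commute subsetI)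
  then have "\<forall>z\<in>ball y r. u z + e * (norm (z - x))\<^sup>2 \<le> u y + e * (norm (y - x))\<^sup>2"
    using y by (auto simp: w_def)
  moreover have "ball y r \<subseteq> S" "y \<in> S"
    using r y by (auto simp: K_def)
  ultimately show False
    using assms(3) e r unfolding no_local_max_def by blast
qed

lemma maximum_principle:
  fixes u :: "'a::euclidean_space \<Rightarrow> real"
  assumes "open S" "bounded S" "continuous_on (closure S) u" "no_local_max S u"
    and fr: "\<And>z. z \<in> frontier S \<Longrightarrow> u z \<le> k" and "x \<in> closure S"
  shows "u x \<le> k"
proof (cases "x \<in> S")
  case True
  have "compact {z\<in>S. u z + (-k) \<ge> c}" if "c > 0" for c
  proof -
    \<comment> \<open>The boundary bound keeps the superlevel set away from the frontier, so it is
      closed.\<close>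
    have "{z\<in>S. u z + (-k) \<ge> c} = {z\<in>closure S. u z + (-k) \<ge> c}"
      using fr that closure_subset[of S] assms(1) by (fastforce simp: frontier_def interior_open)
    also have "\<dots> = closure S \<inter> (\<lambda>z. u z + (-k)) -` {c..}"
      by auto
    also have "closed \<dots>"
      by (intro continuous_closed_preimage continuous_intros assms closed_closure)
    finally have "closed {z\<in>S. u z + (-k) \<ge> c}" .
    moreover have "bounded {z\<in>S. u z + (-k) \<ge> c}"
      by (rule bounded_subset[OF assms(2)]) auto
    ultimately show ?thesis
      unfolding compact_eq_bounded_closed by blast
  qed
  note comp = this
  have "continuous_on S (\<lambda>z. u z + (-k))"
    using continuous_on_subset[OF assms(3) closure_subset] by (rule continuous_on_add) (rule continuous_on_const)
  then have "u x + (-k) \<le> 0"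
    by (rule maximum_principle_superlevel[OF assms(1) _ no_local_max_add_const[OF assms(4)] comp True])
  then show ?thesis by simp
next
  case False
  then show ?thesis
    using assms(1,6) fr by (simp add: frontier_def interior_open)
qed

lemma dharmonic_le:
  fixes u v :: "'a::euclidean_space \<Rightarrow> real"
  assumes "open S" "bounded S" "continuous_on (closure S) u" "dharmonic_on S u"
    "continuous_on (closure S) v" "dharmonic_on S v"
    "\<And>z. z \<in> frontier S \<Longrightarrow> u z \<le> v z + k" "x \<in> closure S"
  shows "u x \<le> v x + k"
  using maximum_principle[OF assms(1,2), of "\<lambda>x. u x - v x" k x] assms
  by (force intro!: continuous_intros dharmonic_no_local_max dharmonic_on_diff)

lemma dharmonic_abs_diff_le:
  fixes u v :: "'a::euclidean_space \<Rightarrow> real"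
  assumes "open S" "bounded S" "continuous_on (closure S) u" "dharmonic_on S u"
    "continuous_on (closure S) v" "dharmonic_on S v"
    "\<And>z. z \<in> frontier S \<Longrightarrow> \<bar>u z - v z\<bar> \<le> k" "x \<in> closure S"
  shows "\<bar>u x - v x\<bar> \<le> k"
proof -
  have "u x \<le> v x + k"
    using assms by (intro dharmonic_le[OF assms(1-6) _ assms(8)]) fastforce
  moreover have "v x \<le> u x + k"
    using assms by (intro dharmonic_le[OF assms(1,2,5,6,3,4) _ assms(8)]) fastforce
  ultimately show ?thesis by linarith
qed

section \<open>Harmonic polynomials\<close>

definition pd :: "'a \<Rightarrow> ('a::euclidean_space \<Rightarrow> real) \<Rightarrow> 'a \<Rightarrow> real"
  where "pd v f x = frechet_derivative f (at x) v"

lemma pd_eq: "(f has_derivative f') (at x) \<Longrightarrow> pd v f x = f' v"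
  unfolding pd_def by (metis frechet_derivative_at)

lemma has_derivative_pd:
  "f differentiable (at x) \<Longrightarrow> (f has_derivative (\<lambda>v. pd v f x)) (at x)"
  unfolding pd_def by (simp add: frechet_derivative_works[symmetric])

lemma linear_pd: "f differentiable (at x) \<Longrightarrow> linear (\<lambda>v. pd v f x)"
  using has_derivative_pd has_derivative_linear by blast

lemma pd_Basis_sum:
  assumes "f differentiable (at x)"
  shows "pd v f x = (\<Sum>b\<in>Basis. (v \<bullet> b) * pd b f x)"
proof -
  interpret linear "\<lambda>v. pd v f x" by (rule linear_pd[OF assms])
  have "pd v f x = pd (\<Sum>b\<in>Basis. (v \<bullet> b) *\<^sub>R b) f x"
    by (simp add: euclidean_representation)
  also have "\<dots> = (\<Sum>b\<in>Basis. (v \<bullet> b) * pd b f x)"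
    by (simp add: sum scale)
  finally show ?thesis .
qed

lemma DERIV_along_line:
  assumes "f differentiable (at (x + t *\<^sub>R v))"
  shows "((\<lambda>s. f (x + s *\<^sub>R v)) has_real_derivative pd v f (x + t *\<^sub>R v)) (at t)"
proof -
  interpret linear "\<lambda>w. pd w f (x + t *\<^sub>R v)" by (rule linear_pd[OF assms])
  have "((\<lambda>s. x + s *\<^sub>R v) has_derivative (\<lambda>h. h *\<^sub>R v)) (at t)"
    by (auto intro!: derivative_eq_intros)
  from has_derivative_compose[OF this has_derivative_pd[OF assms]]
  have "((\<lambda>s. f (x + s *\<^sub>R v)) has_derivative (\<lambda>h. pd (h *\<^sub>R v) f (x + t *\<^sub>R v))) (at t)" .
  then show ?thesis
    unfolding has_field_derivative_def scale real_scaleR_def mult_commute_abs .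
qed

abbreviation (input) rpf :: "('a::euclidean_space \<Rightarrow> real) \<Rightarrow> bool"
  where "rpf \<equiv> real_polynomial_function"

lemmas rpf_linear = real_polynomial_function.intros(1)
lemmas rpf_const = real_polynomial_function.intros(2)
lemmas rpf_add = real_polynomial_function.intros(3)
lemmas rpf_mult = real_polynomial_function.intros(4)
lemmas rpf_intros = rpf_const rpf_add rpf_mult
lemmas rpf_sum = real_polynomial_function_sum

lemma rpf_differentiable: "rpf f \<Longrightarrow> f differentiable (at x)"
  by (rule differentiable_at_real_polynomial_function)

lemma rpf_inner: "rpf (\<lambda>x. x \<bullet> a)"
  by (rule rpf_linear) (rule bounded_linear_inner_left)

lemma pd_const: "pd v (\<lambda>x. c) = (\<lambda>x. 0)"
  by (rule ext, rule pd_eq) simp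

lemma pd_linear: "bounded_linear f \<Longrightarrow> pd v f = (\<lambda>x. f v)"
  by (rule ext, rule pd_eq) (rule bounded_linear_imp_has_derivative)

lemma pd_add_at:
  "f differentiable (at x) \<Longrightarrow> g differentiable (at x) \<Longrightarrow> pd v (\<lambda>x. f x + g x) x = pd v f x + pd v g x"
  by (rule pd_eq) (intro has_derivative_add has_derivative_pd)

lemma pd_mult_at:
  "f differentiable (at x) \<Longrightarrow> g differentiable (at x) \<Longrightarrow>
    pd v (\<lambda>x. f x * g x) x = f x * pd v g x + pd v f x * g x"
  by (rule pd_eq) (intro has_derivative_mult has_derivative_pd)

lemma pd_add: "rpf f \<Longrightarrow> rpf g \<Longrightarrow> pd v (\<lambda>x. f x + g x) = (\<lambda>x. pd v f x + pd v g x)"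
  by (simp add: fun_eq_iff pd_add_at rpf_differentiable)

lemma pd_mult: "rpf f \<Longrightarrow> rpf g \<Longrightarrow> pd v (\<lambda>x. f x * g x) = (\<lambda>x. f x * pd v g x + pd v f x * g x)"
  by (simp add: fun_eq_iff pd_mult_at rpf_differentiable)

lemma pd_cmult: "rpf f \<Longrightarrow> pd v (\<lambda>x. c * f x) = (\<lambda>x. c * pd v f x)"
  using pd_mult[of "\<lambda>x. c" f v] by (simp add: rpf_const pd_const)

lemma rpf_pd: "rpf f \<Longrightarrow> rpf (pd v f)"
  by (induction f rule: real_polynomial_function.induct)
    (simp_all add: pd_const pd_linear pd_add pd_mult rpf_intros)

lemma pd_commute: "rpf f \<Longrightarrow> pd v (pd w f) = pd w (pd v f)"
proof (induction f rule: real_polynomial_function.induct)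
  case (mult f g)
  then show ?case
    by (simp add: pd_mult pd_add rpf_pd rpf_intros algebra_simps)
qed (simp_all add: pd_const pd_linear pd_add rpf_pd)

lemma pd_sum:
  "finite I \<Longrightarrow> (\<And>i. i \<in> I \<Longrightarrow> rpf (f i)) \<Longrightarrow> pd v (\<lambda>x. \<Sum>i\<in>I. f i x) = (\<lambda>x. \<Sum>i\<in>I. pd v (f i) x)"
  by (induction I rule: finite_induct) (auto simp: pd_const pd_add rpf_sum)

definition lap :: "('a::euclidean_space \<Rightarrow> real) \<Rightarrow> 'a \<Rightarrow> real"
  where "lap f x = (\<Sum>b\<in>Basis. pd b (pd b f) x)"

lemma lap_add: "rpf f \<Longrightarrow> rpf g \<Longrightarrow> lap (\<lambda>x. f x + g x) x = lap f x + lap g x"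
  by (simp add: lap_def pd_add rpf_pd sum.distrib)

lemma lap_cmult: "rpf f \<Longrightarrow> lap (\<lambda>x. c * f x) x = c * lap f x"
  by (simp add: lap_def pd_cmult rpf_pd sum_distrib_left)

lemma lap_mult:
  assumes "rpf f" "rpf g"
  shows "lap (\<lambda>x. f x * g x) x = f x * lap g x + 2 * (\<Sum>b\<in>Basis. pd b f x * pd b g x) + lap f x * g x"
proof -
  have "pd b (pd b (\<lambda>x. f x * g x)) x
      = f x * pd b (pd b g) x + 2 * (pd b f x * pd b g x) + pd b (pd b f) x * g x" for b
    using assms by (simp add: pd_mult pd_add rpf_pd rpf_mult)
  then show ?thesis
    by (simp add: lap_def sum.distrib sum_distrib_left sum_distrib_right)
qed

lemma pd_lap:
  assumes "rpf f"
  shows "pd c (lap f) = lap (pd c f)"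
proof -
  note f = assms
  have "pd c (lap f) = (\<lambda>x. \<Sum>b\<in>Basis. pd c (pd b (pd b f)) x)"
    unfolding lap_def[abs_def] using f by (intro pd_sum rpf_pd) auto
  also have "\<dots> = (\<lambda>x. \<Sum>b\<in>Basis. pd b (pd b (pd c f)) x)"
  proof -
    have "pd c (pd b (pd b f)) = pd b (pd b (pd c f))" for b
      using pd_commute[OF f, where v=c and w=b] pd_commute[where f="pd b f" and v=c and w=b] rpf_pd[OF f]
      by metis
    then show ?thesis by presburger
  qed
  finally show ?thesis
    unfolding lap_def[abs_def] .
qed

lemma rpf_norm2: "rpf (\<lambda>x. x \<bullet> x)"
proof -
  have "(\<lambda>x::'a. x \<bullet> x) = (\<lambda>x. \<Sum>b\<in>Basis. (x \<bullet> b) * (x \<bullet> b))"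
    by (rule ext) (rule euclidean_inner)
  then show ?thesis
    by (rule ssubst) (intro rpf_sum rpf_mult rpf_inner finite_Basis)
qed

lemma pd_inner: "pd v (\<lambda>x. x \<bullet> a) = (\<lambda>x. v \<bullet> a)"
  by (rule pd_linear) (rule bounded_linear_inner_left)

lemma pd_norm2: "pd v (\<lambda>x. x \<bullet> x) = (\<lambda>x. 2 * (x \<bullet> v))"
  by (rule ext, rule pd_eq) (auto intro!: derivative_eq_intros simp: inner_commute)

lemma lap_inner: "lap (\<lambda>x. x \<bullet> a) x = 0"
  by (simp add: lap_def pd_inner pd_const)

lemma lap_norm2: "lap (\<lambda>x::'a::euclidean_space. x \<bullet> x) x = 2 * DIM('a)"
  by (simp add: lap_def pd_norm2 pd_cmult rpf_inner pd_inner)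

text \<open>The last condition is Euler's identity for homogeneous functions of degree \<open>k\<close>.\<close>

definition harmonic_homogeneous :: "nat \<Rightarrow> ('a::euclidean_space \<Rightarrow> real) \<Rightarrow> bool"
  where "harmonic_homogeneous k p \<longleftrightarrow> rpf p \<and> (\<forall>x. lap p x = 0) \<and> (\<forall>x. pd x p x = real k * p x)"

text \<open>Euler's identity of degree 0 kills the derivative along each ray away from the origin;
  continuity at the origin extends constancy to the whole segment.\<close>

lemma harmonic_homogeneous_0:
  assumes "harmonic_homogeneous 0 p"
  shows "p x = p 0"
proof -
  have p: "rpf p" "\<And>x. pd x p x = 0"
    using assms by (auto simp: harmonic_homogeneous_def)
  have "((\<lambda>s. p (0 + s *\<^sub>R x)) has_real_derivative 0) (at t)" if "0 < t" for t
  proof -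
    have "pd x p (t *\<^sub>R x) = pd (t *\<^sub>R x) p (t *\<^sub>R x) / t"
      using that by (simp add: linear_scale[OF linear_pd[OF rpf_differentiable[OF p(1)]]])
    then show ?thesis
      using DERIV_along_line[OF rpf_differentiable[OF p(1)], of 0 x t] p(2) by simp
  qed
  moreover have "continuous_on {0..1} (\<lambda>s. p (0 + s *\<^sub>R x))"
    using p(1) by (intro continuous_on_compose2[OF continuous_on_polymonial_function[of p UNIV]])
      (auto simp: real_polynomial_function_eq intro!: continuous_intros)
  ultimately have "p (0 + 1 *\<^sub>R x) = p (0 + 0 *\<^sub>R x)"
    by (intro DERIV_isconst_end[of 0 1 "\<lambda>s. p (0 + s *\<^sub>R x)"]) auto
  then show ?thesis by simp
qed

text \<open>Differentiating Euler's identity in direction \<open>c\<close> produces the extra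
  summand \<open>pd c p\<close>, which lowers the degree by one; harmonicity survives since
  \<open>lap\<close> commutes with \<open>pd c\<close>.\<close>

lemma harmonic_homogeneous_pd:
  assumes "harmonic_homogeneous (Suc k) p"
  shows "harmonic_homogeneous k (pd c p)"
proof -
  have p: "rpf p" "lap p = (\<lambda>x. 0)" and eu: "\<And>x. pd x p x = real (Suc k) * p x"
    using assms by (auto simp: harmonic_homogeneous_def fun_eq_iff)
  have "lap (pd c p) x = 0" for x
    using pd_lap[OF p(1), of c] p(2) by (simp add: pd_const fun_eq_iff)
  moreover have "pd x (pd c p) x = real k * pd c p x" for x
  proof -
    have "(\<lambda>x. \<Sum>b\<in>Basis. (x \<bullet> b) * pd b p x) = (\<lambda>x. real (Suc k) * p x)"
      using eu by (simp add: fun_eq_iff pd_Basis_sum[OF rpf_differentiable[OF p(1)], symmetric])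
    then have "pd c (\<lambda>x. \<Sum>b\<in>Basis. (x \<bullet> b) * pd b p x) x = pd c (\<lambda>x. real (Suc k) * p x) x"
      by simp
    moreover have "pd c (\<lambda>x. \<Sum>b\<in>Basis. (x \<bullet> b) * pd b p x) x
        = (\<Sum>b\<in>Basis. (x \<bullet> b) * pd b (pd c p) x) + (\<Sum>b\<in>Basis. (c \<bullet> b) * pd b p x)"
      using p(1) by (simp add: pd_sum pd_mult rpf_inner rpf_pd rpf_mult pd_inner
          pd_commute[of p c] sum.distrib)
    ultimately show ?thesis
      using p(1) by (simp add: pd_cmult pd_Basis_sum[OF rpf_differentiable, symmetric] rpf_pd
          distrib_right del: of_nat_Suc) (simp add: distrib_right)
  qed
  ultimately show ?thesis
    using p(1) by (simp add: harmonic_homogeneous_def rpf_pd)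
qed

text \<open>For \<open>p\<close> of degree \<open>k\<close> in dimension \<open>m\<close>, \<open>x\<^sub>c p - |x|\<^sup>2 \<partial>\<^sub>c p / (m + 2 k - 2)\<close> is harmonic.\<close>

lemma harmonic_homogeneous_mult_coordinate:
  fixes p :: "'a::euclidean_space \<Rightarrow> real"
  assumes "harmonic_homogeneous k p" "c \<in> Basis"
  obtains q r l where "harmonic_homogeneous (Suc k) q" "harmonic_homogeneous l r"
    "\<And>x. norm x = 1 \<Longrightarrow> (x \<bullet> c) * p x = q x + r x"
proof (cases k)
  \<comment> \<open>A constant has no correction term, and the denominator m + 2 k - 2 would vanish
    in dimension two.\<close>
  case 0
  then have const: "p = (\<lambda>x. p 0)"
    using assms harmonic_homogeneous_0 by (auto simp: fun_eq_iff)
  have "harmonic_homogeneous (Suc k) (\<lambda>x. p 0 * (x \<bullet> c))"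
    using 0 by (auto simp: harmonic_homogeneous_def rpf_inner lap_cmult lap_inner pd_cmult pd_inner
        intro!: rpf_mult rpf_const)
  moreover have "harmonic_homogeneous 0 (\<lambda>x::'a. 0)"
    by (auto simp: harmonic_homogeneous_def lap_def pd_const intro!: rpf_const)
  ultimately show ?thesis
    by (rule that) (subst const, simp add: mult.commute)
next
  case (Suc j)
  define d where "d = 1 / (real DIM('a) + 2 * real k - 2)"
  have d: "d * (real DIM('a) + 2 * real k - 2) = 1"
  proof -
    \<comment> \<open>Since k is at least 1 here, the denominator is positive even in dimension
      one.\<close>
    have "real DIM('a) + 2 * real k - 2 > 0"
      using Suc DIM_positive[where 'a='a] by (simp add: add_pos_nonneg)
    then show ?thesis by (simp add: d_def)
  qed
  define r where "r = pd c p"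
  define q where "q = (\<lambda>x. (x \<bullet> c) * p x + (- d) * ((x \<bullet> x) * r x))"
  have p: "rpf p" "\<And>x. lap p x = 0" "\<And>x. pd x p x = real k * p x"
    using assms by (auto simp: harmonic_homogeneous_def)
  have hr: "harmonic_homogeneous j r"
    using assms Suc unfolding r_def by (auto intro: harmonic_homogeneous_pd)
  then have r: "rpf r" "\<And>x. lap r x = 0" "\<And>x. pd x r x = real j * r x"
    by (auto simp: harmonic_homogeneous_def)
  note rpfs = rpf_mult[OF rpf_inner p(1), of c] rpf_mult[OF rpf_norm2 r(1)]
  have "lap q x = 0" for x
  proof -
    have "lap (\<lambda>x. (x \<bullet> c) * p x) x = 2 * r x"
    proof -
      have "(\<Sum>b\<in>Basis. pd b (\<lambda>x. x \<bullet> c) x * pd b p x) = (\<Sum>b\<in>Basis. if b = c then pd c p x else 0)"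
        using assms(2) by (intro sum.cong) (auto simp: pd_inner inner_Basis)
      then show ?thesis
        using assms(2) p(1,2) by (simp add: lap_mult rpf_inner lap_inner r_def)
    qed
    moreover have "lap (\<lambda>x. (x \<bullet> x) * r x) x = (2 * DIM('a) + 4 * real j) * r x"
    proof -
      have "(\<Sum>b\<in>Basis. pd b (\<lambda>x. x \<bullet> x) x * pd b r x) = 2 * pd x r x"
        by (simp add: pd_norm2 pd_Basis_sum[OF rpf_differentiable[OF r(1)], of x x] sum_distrib_left mult.assoc)
      then show ?thesis
        by (simp add: lap_mult[OF rpf_norm2 r(1)] lap_norm2 r distrib_right)
    qed
    ultimately have "lap q x = 2 * r x - d * (2 * DIM('a) + 4 * real j) * r x"
      unfolding q_def by (simp only: lap_add lap_cmult rpf_mult rpf_const rpfs)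
    also have "\<dots> = 2 * r x - 2 * (d * (real DIM('a) + 2 * real k - 2)) * r x"
      using Suc by (simp add: algebra_simps)
    finally show ?thesis using d by simp
  qed
  moreover have "pd x q x = real (Suc k) * q x" for x
  proof -
    have "pd x q x = (x \<bullet> c) * pd x p x + (x \<bullet> c) * p x
        + (- d) * ((x \<bullet> x) * pd x r x + 2 * (x \<bullet> x) * r x)"
      unfolding q_def
      by (simp only: pd_add pd_cmult rpfs rpf_mult rpf_const)
        (simp add: pd_mult p(1) r(1) rpf_inner rpf_norm2 pd_inner pd_norm2 algebra_simps)
    then show ?thesis
      unfolding p(3) r(3) q_def Suc by (simp add: algebra_simps)
  qed
  moreover have "rpf q"
    unfolding q_def by (intro rpf_add rpf_mult[OF rpf_const] rpfs)
  ultimately have "harmonic_homogeneous (Suc k) q"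
    by (simp add: harmonic_homogeneous_def)
  moreover have "harmonic_homogeneous j (\<lambda>x. d * r x)"
    using r by (auto simp: harmonic_homogeneous_def lap_cmult pd_cmult)
  moreover have "(x \<bullet> c) * p x = q x + d * r x" if "norm x = 1" for x
    using that by (simp add: q_def norm_eq_1)
  ultimately show ?thesis
    by (rule that)
qed

section \<open>Polynomials restricted to the unit sphere\<close>

definition harmonic_poly :: "('a::euclidean_space \<Rightarrow> real) \<Rightarrow> bool"
  where "harmonic_poly p \<longleftrightarrow> rpf p \<and> (\<forall>x. lap p x = 0)"

text \<open>Multiplication by a coordinate turns one homogeneous piece into pieces of different
  degrees, so sums of mixed degree are required. The induction reduces each claim to a single
  homogeneous piece, where Euler's identity is available.\<close>

inductive harmonic_span :: "('a::euclidean_space \<Rightarrow> real) \<Rightarrow> bool" where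
  homogeneous: "harmonic_homogeneous k p \<Longrightarrow> harmonic_span p"
| add: "harmonic_span p \<Longrightarrow> harmonic_span q \<Longrightarrow> harmonic_span (\<lambda>x. p x + q x)"

lemma harmonic_span_imp_poly: "harmonic_span p \<Longrightarrow> harmonic_poly p"
  by (induction rule: harmonic_span.induct)
    (auto simp: harmonic_poly_def harmonic_homogeneous_def lap_add)

lemma harmonic_span_cmult: "harmonic_span p \<Longrightarrow> harmonic_span (\<lambda>x. c * p x)"
proof (induction rule: harmonic_span.induct)
  case (homogeneous k p)
  then have "harmonic_homogeneous k (\<lambda>x. c * p x)"
    by (auto simp: harmonic_homogeneous_def lap_cmult pd_cmult)
  then show ?case by (rule harmonic_span.homogeneous)
next
  case (add p q)
  then show ?case
    using harmonic_span.add[of "\<lambda>x. c * p x" "\<lambda>x. c * q x"] by (simp add: distrib_left)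
qed

definition sphere_harmonic :: "('a::euclidean_space \<Rightarrow> real) \<Rightarrow> bool"
  where "sphere_harmonic f \<longleftrightarrow> (\<exists>p. harmonic_span p \<and> (\<forall>x. norm x = 1 \<longrightarrow> f x = p x))"

lemma sphere_harmonic_add:
  "sphere_harmonic f \<Longrightarrow> sphere_harmonic g \<Longrightarrow> sphere_harmonic (\<lambda>x. f x + g x)"
  unfolding sphere_harmonic_def
  by (elim exE conjE) (intro exI conjI, erule (1) harmonic_span.add, simp)

lemma sphere_harmonic_cmult: "sphere_harmonic f \<Longrightarrow> sphere_harmonic (\<lambda>x. c * f x)"
  unfolding sphere_harmonic_def
  by (elim exE conjE) (intro exI conjI, erule harmonic_span_cmult[of _ c], simp)

lemma sphere_harmonic_const: "sphere_harmonic (\<lambda>x::'a::euclidean_space. c)"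
proof -
  have "harmonic_homogeneous 0 (\<lambda>x::'a. c)"
    by (auto simp: harmonic_homogeneous_def lap_def pd_const intro!: rpf_const)
  then show ?thesis
    unfolding sphere_harmonic_def by (blast intro: harmonic_span.homogeneous)
qed

lemma sphere_harmonic_sum:
  "finite I \<Longrightarrow> (\<And>i. i \<in> I \<Longrightarrow> sphere_harmonic (f i)) \<Longrightarrow> sphere_harmonic (\<lambda>x. \<Sum>i\<in>I. f i x)"
  by (induction I rule: finite_induct) (auto intro: sphere_harmonic_const sphere_harmonic_add)

lemma sphere_harmonic_mult_coordinate:
  assumes "sphere_harmonic f" "c \<in> Basis"
  shows "sphere_harmonic (\<lambda>x. (x \<bullet> c) * f x)"
proof -
  have "sphere_harmonic (\<lambda>x. (x \<bullet> c) * p x)" if "harmonic_span p" for p :: "'a \<Rightarrow> real"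
    using that
  proof (induction rule: harmonic_span.induct)
    case (homogeneous k p)
    obtain q r :: "'a \<Rightarrow> real" and l where
      qr: "harmonic_homogeneous (Suc k) q" "harmonic_homogeneous l r"
      "\<And>x. norm x = 1 \<Longrightarrow> (x \<bullet> c) * p x = q x + r x"
      by (rule harmonic_homogeneous_mult_coordinate[OF homogeneous assms(2)]) (rule that)
    have "harmonic_span (\<lambda>x. q x + r x)"
      using qr by (intro harmonic_span.add) (auto intro: harmonic_span.homogeneous)
    then show ?case
      using qr(3) unfolding sphere_harmonic_def by blast
  next
    case (add p q)
    then show ?case
      using sphere_harmonic_add[of "\<lambda>x. (x \<bullet> c) * p x" "\<lambda>x. (x \<bullet> c) * q x"]
      by (simp add: distrib_left)
  qed
  then show ?thesis
    using assms unfolding sphere_harmonic_def by metis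
qed

text \<open>The case f = 1 replaces a polynomial by a harmonic one with the same values on the
  sphere. The general factor \<open>f\<close> is what lets the induction pass products: (g h) f is
  read as g (h f).\<close>

lemma sphere_harmonic_mult_poly:
  assumes "rpf g" "sphere_harmonic f"
  shows "sphere_harmonic (\<lambda>x. g x * f x)"
  using assms
proof (induction g arbitrary: f rule: real_polynomial_function.induct)
  case (linear g)
  interpret bounded_linear g by (rule linear(1))
  have "g x * f x = (\<Sum>b\<in>Basis. g b * ((x \<bullet> b) * f x))" for x
  proof -
    have "g x = g (\<Sum>b\<in>Basis. (x \<bullet> b) *\<^sub>R b)"
      by (simp add: euclidean_representation)
    also have "\<dots> = (\<Sum>b\<in>Basis. g b * (x \<bullet> b))"
      by (simp add: sum scaleR mult.commute)
    finally show ?thesis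
      by (simp add: sum_distrib_right mult.assoc)
  qed
  then show ?case
    using linear.prems by (simp only:)
      (intro sphere_harmonic_sum sphere_harmonic_cmult sphere_harmonic_mult_coordinate finite_Basis)
next
  case (const c)
  then show ?case by (rule sphere_harmonic_cmult)
next
  case (add g h)
  then show ?case
    using sphere_harmonic_add[of "\<lambda>x. g x * f x" "\<lambda>x. h x * f x"] by (simp add: distrib_right)
next
  case (mult g h)
  then show ?case by (simp add: mult.assoc)
qed

lemma poly_eq_harmonic_on_sphere:
  assumes "rpf g"
  obtains p where "harmonic_poly p" "\<And>x. norm x = 1 \<Longrightarrow> g x = p x"
  using sphere_harmonic_mult_poly[OF assms sphere_harmonic_const[of 1]]
  unfolding sphere_harmonic_def by (auto intro: harmonic_span_imp_poly)

section \<open>Derivative estimates and the Dirichlet problem in a ball\<close>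

text \<open>Taylor's formula with Lagrange remainder is applied to s |-> g s and s |-> g (- s); the
  first-order terms cancel in the sum.\<close>

lemma second_difference_mean_value:
  fixes g g1 g2 :: "real \<Rightarrow> real"
  assumes "t > 0"
    and g: "\<And>s. \<bar>s\<bar> \<le> t \<Longrightarrow> (g has_real_derivative g1 s) (at s)"
    and g1: "\<And>s. \<bar>s\<bar> \<le> t \<Longrightarrow> (g1 has_real_derivative g2 s) (at s)"
  obtains a b where "\<bar>a\<bar> \<le> t" "\<bar>b\<bar> \<le> t" "g t + g (- t) - 2 * g 0 = t\<^sup>2 * ((g2 a + g2 b) / 2)"
proof -
  have pos: "\<exists>a. 0 < a \<and> a < t \<and> h t = h 0 + h1 0 * t + h2 a / 2 * t\<^sup>2"
    if h: "\<And>s. \<bar>s\<bar> \<le> t \<Longrightarrow> (h has_real_derivative h1 s) (at s)"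
      "\<And>s. \<bar>s\<bar> \<le> t \<Longrightarrow> (h1 has_real_derivative h2 s) (at s)" for h h1 h2 :: "real \<Rightarrow> real"
  proof -
    define d where "d m = (if m = 0 then h else if m = 1 then h1 else h2)" for m :: nat
    have "\<exists>a. 0 < a \<and> a < t \<and> h t = (\<Sum>m<2. d m 0 / fact m * t ^ m) + d 2 a / fact 2 * t ^ 2"
      by (rule Maclaurin) (use \<open>t > 0\<close> h in \<open>auto simp: d_def less_2_cases_iff\<close>)
    then show ?thesis
      by (auto simp: d_def numeral_2_eq_2)
  qed
  obtain a where a: "0 < a" "a < t" "g t = g 0 + g1 0 * t + g2 a / 2 * t\<^sup>2"
    using pos[of g g1 g2, OF g g1] by auto
  have neg1: "((\<lambda>s. g (- s)) has_real_derivative - g1 (- s)) (at s)" if "\<bar>s\<bar> \<le> t" for s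
    using DERIV_chain2[where f=g and g=uminus and x=s, OF g[of "- s"] DERIV_minus[OF DERIV_ident]] that by simp
  have neg2: "((\<lambda>s. - g1 (- s)) has_real_derivative g2 (- s)) (at s)" if "\<bar>s\<bar> \<le> t" for s
    using DERIV_minus[OF DERIV_chain2[where f=g1 and g=uminus and x=s, OF g1[of "- s"] DERIV_minus[OF DERIV_ident]]]
      that by simp
  obtain b where b: "0 < b" "b < t" "g (- t) = g 0 - g1 0 * t + g2 (- b) / 2 * t\<^sup>2"
    using pos[of "\<lambda>s. g (- s)" "\<lambda>s. - g1 (- s)" "\<lambda>s. g2 (- s)", OF neg1 neg2] by auto
  show ?thesis
    by (rule that[of a "- b"]) (use a b in \<open>auto simp: algebra_simps\<close>)
qed

lemma diff_laplacian_minus: "diff_laplacian f x (- t) = diff_laplacian f x t"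
  by (simp add: diff_laplacian_def add.commute)

text \<open>The oscillation \<open>e\<close> of the pure second derivatives is a parameter:
  continuity supplies it in \<open>dharmonic_if_laplacian_zero\<close>, a Lipschitz estimate in
  \<open>diff_laplacian_bound\<close>.\<close>

lemma diff_laplacian_approx:
  fixes f :: "'a::euclidean_space \<Rightarrow> real"
  assumes "t \<noteq> 0"
    and d1: "\<And>y. dist x y \<le> \<bar>t\<bar> \<Longrightarrow> f differentiable (at y)"
    and d2: "\<And>b y. b \<in> Basis \<Longrightarrow> dist x y \<le> \<bar>t\<bar> \<Longrightarrow> pd b f differentiable (at y)"
    and e: "\<And>b y. b \<in> Basis \<Longrightarrow> dist x y \<le> \<bar>t\<bar> \<Longrightarrow> \<bar>pd b (pd b f) y - pd b (pd b f) x\<bar> \<le> e"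
  shows "\<bar>diff_laplacian f x t - lap f x\<bar> \<le> real DIM('a) * e"
proof -
  have mid: "\<bar>(P + Q) / 2 - X\<bar> \<le> e" if "\<bar>P - X\<bar> \<le> e" "\<bar>Q - X\<bar> \<le> e" for P Q X
    using that by (simp add: abs_le_iff field_simps)
  have pos: "\<bar>diff_laplacian f x s - lap f x\<bar> \<le> real DIM('a) * e" if s: "s > 0" "s = \<bar>t\<bar>" for s
  proof -
    have each: "\<bar>(f (x + s *\<^sub>R b) + f (x - s *\<^sub>R b) - 2 * f x) / s\<^sup>2 - pd b (pd b f) x\<bar> \<le> e"
      if b: "b \<in> Basis" for b
    proof -
      have D: "dist x (x + a *\<^sub>R b) \<le> \<bar>t\<bar>" if "\<bar>a\<bar> \<le> s" for a
        using that s b by (simp add: dist_norm)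
      obtain p q where pq: "\<bar>p\<bar> \<le> s" "\<bar>q\<bar> \<le> s"
        "f (x + s *\<^sub>R b) + f (x + (- s) *\<^sub>R b) - 2 * f (x + 0 *\<^sub>R b)
          = s\<^sup>2 * ((pd b (pd b f) (x + p *\<^sub>R b) + pd b (pd b f) (x + q *\<^sub>R b)) / 2)"
        by (rule second_difference_mean_value[OF s(1), of "\<lambda>s. f (x + s *\<^sub>R b)"
              "\<lambda>s. pd b f (x + s *\<^sub>R b)" "\<lambda>s. pd b (pd b f) (x + s *\<^sub>R b)"])
          (auto intro!: DERIV_along_line d1 d2 D b)
      then have eq: "(f (x + s *\<^sub>R b) + f (x - s *\<^sub>R b) - 2 * f x) / s\<^sup>2
          = (pd b (pd b f) (x + p *\<^sub>R b) + pd b (pd b f) (x + q *\<^sub>R b)) / 2"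
        using s(1) by simp
      show ?thesis
        unfolding eq using e[OF b D[OF pq(1)]] e[OF b D[OF pq(2)]] by (rule mid)
    qed
    have "diff_laplacian f x s - lap f x
        = (\<Sum>b\<in>Basis. (f (x + s *\<^sub>R b) + f (x - s *\<^sub>R b) - 2 * f x) / s\<^sup>2 - pd b (pd b f) x)"
      unfolding diff_laplacian_def lap_def sum_divide_distrib sum_subtractf[symmetric] ..
    then have "\<bar>diff_laplacian f x s - lap f x\<bar> \<le> (\<Sum>b\<in>(Basis::'a set). e)"
      using each by (simp only:) (rule order_trans[OF sum_abs], rule sum_mono, simp)
    then show ?thesis by simp
  qed
  have "diff_laplacian f x \<bar>t\<bar> = diff_laplacian f x t"
    by (simp add: abs_if diff_laplacian_minus)
  then show ?thesis
    using pos[of "\<bar>t\<bar>"] assms(1) by simp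
qed

lemma dharmonic_if_laplacian_zero:
  fixes f :: "'a::euclidean_space \<Rightarrow> real"
  assumes "open S"
    and d1: "\<And>x. x \<in> S \<Longrightarrow> f differentiable (at x)"
    and d2: "\<And>b x. b \<in> Basis \<Longrightarrow> x \<in> S \<Longrightarrow> pd b f differentiable (at x)"
    and c: "\<And>b. b \<in> Basis \<Longrightarrow> continuous_on S (pd b (pd b f))"
    and l: "\<And>x. x \<in> S \<Longrightarrow> lap f x = 0"
  shows "dharmonic_on S f"
  unfolding dharmonic_on_def
proof safe
  show "continuous_on S f"
    using d1 by (simp add: continuous_at_imp_continuous_on differentiable_imp_continuous_within)
  fix x assume x: "x \<in> S"
  show "(diff_laplacian f x \<longlongrightarrow> 0) (at 0)"
  proof (rule tendstoI)
    fix e :: real assume "e > 0"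
    define d where "d = e / (2 * DIM('a))"
    have d: "d > 0" "real DIM('a) * d < e"
      using \<open>e > 0\<close> by (auto simp: d_def)
    have "eventually (\<lambda>y. \<forall>b\<in>Basis. \<bar>pd b (pd b f) y - pd b (pd b f) x\<bar> \<le> d) (nhds x)"
    proof (rule eventually_ball_finite[OF finite_Basis], rule)
      fix b :: 'a assume "b \<in> Basis"
      then have "isCont (pd b (pd b f)) x"
        using c x \<open>open S\<close> by (simp add: continuous_on_eq_continuous_at)
      then have "((pd b (pd b f)) \<longlongrightarrow> pd b (pd b f) x) (nhds x)"
        by (simp add: isCont_def tendsto_nhds_iff)
      from tendstoD[OF this d(1)]
      show "eventually (\<lambda>y. \<bar>pd b (pd b f) y - pd b (pd b f) x\<bar> \<le> d) (nhds x)"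
        by eventually_elim (simp add: dist_real_def)
    qed
    moreover have "eventually (\<lambda>y. y \<in> S) (nhds x)"
      using x \<open>open S\<close> by (rule eventually_nhds_in_open[rotated])
    ultimately have "eventually (\<lambda>y. y \<in> S \<and> (\<forall>b\<in>Basis. \<bar>pd b (pd b f) y - pd b (pd b f) x\<bar> \<le> d)) (nhds x)"
      by eventually_elim simp
    then obtain r where r: "r > 0"
      "\<And>y. dist x y < r \<Longrightarrow> y \<in> S \<and> (\<forall>b\<in>Basis. \<bar>pd b (pd b f) y - pd b (pd b f) x\<bar> \<le> d)"
      unfolding eventually_nhds_metric by (auto simp: dist_commute)
    have "eventually (\<lambda>t::real. t \<in> ball 0 r) (at 0)"
      using r by (intro eventually_at_in_open') auto
    then show "eventually (\<lambda>t. dist (diff_laplacian f x t) 0 < e) (at 0)"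
      using eventually_neq_at_within[of 0 0 UNIV]
    proof eventually_elim
      case (elim t)
      have "\<bar>diff_laplacian f x t - lap f x\<bar> \<le> real DIM('a) * d"
        by (rule diff_laplacian_approx) (use elim r(2) d1 d2 in auto)
      then show ?case
        using d(2) l[OF x] by simp
    qed
  qed
qed

lemma rpf_continuous_on: "rpf p \<Longrightarrow> continuous_on S p"
  by (simp add: continuous_on_polymonial_function real_polynomial_function_eq)

lemma harmonic_poly_dharmonic: "harmonic_poly p \<Longrightarrow> dharmonic_on S p"
  by (rule dharmonic_on_subset[of UNIV])
    (auto intro!: dharmonic_if_laplacian_zero rpf_differentiable rpf_pd rpf_continuous_on simp: harmonic_poly_def)

lemma harmonic_poly_diff: "harmonic_poly p \<Longrightarrow> harmonic_poly q \<Longrightarrow> harmonic_poly (\<lambda>x. p x - q x)"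
  unfolding harmonic_poly_def using lap_add[of p "\<lambda>x. -1 * q x"] lap_cmult[of q "-1"]
    rpf_add[of p "\<lambda>x. -1 * q x"] rpf_mult[OF rpf_const[of "-1"], of q] by simp

lemma harmonic_poly_pd:
  assumes "harmonic_poly p"
  shows "harmonic_poly (pd v p)"
proof -
  have "rpf p" "lap p = (\<lambda>x. 0)"
    using assms by (auto simp: harmonic_poly_def fun_eq_iff)
  then show ?thesis
    using pd_lap[of p v] by (simp add: harmonic_poly_def rpf_pd pd_const) metis
qed

text \<open>The odd part \<open>u x - u (\<sigma> x)\<close> under the reflection \<open>\<sigma>\<close> in the hyperplane \<open>x \<bullet> b = 0\<close> vanishes
  on that hyperplane, and on the half ball it lies below the harmonic polynomial
  \<open>2 M (|x|\<^sup>2 + m (x \<bullet> b) (r - x \<bullet> b)) / r\<^sup>2\<close> of the dimension \<open>m\<close>, which grows linearly along \<open>b\<close>.\<close>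

lemma reflection_estimate_aux:
  fixes u :: "'a::euclidean_space \<Rightarrow> real"
  assumes u: "dharmonic_on (ball 0 R) u" and M: "\<And>y. y \<in> ball 0 R \<Longrightarrow> \<bar>u y\<bar> \<le> M"
    and b: "b \<in> Basis" and t: "0 < t" "t < r" "r < R"
  shows "u (t *\<^sub>R b) - u (- (t *\<^sub>R b)) \<le> 2 * M * (real DIM('a) + 1) * t / r"
proof -
  define S where "S = ball 0 r \<inter> {x::'a. b \<bullet> x > 0}"
  define \<sigma> where "\<sigma> x = x - (2 * (x \<bullet> b)) *\<^sub>R b" for x :: 'a
  define m where "m = real DIM('a)"
  define q where "q = (\<lambda>x::'a. (2 * M / r\<^sup>2) * (x \<bullet> x + m * ((x \<bullet> b) * (r + (-1) * (x \<bullet> b)))))"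
  have norm_b: "norm b = 1" "b \<bullet> b = 1"
    using b by auto
  have n\<sigma>: "norm (\<sigma> x) = norm x" for x
    using norm_b by (simp add: \<sigma>_def norm_eq_sqrt_inner inner_diff_left inner_diff_right
        inner_commute algebra_simps)
  have "r > 0" "M \<ge> 0"
    using t M[of 0] by auto
  have "open S" "bounded S"
    unfolding S_def by (auto intro!: open_Int open_halfspace_gt bounded_Int)
  have clS: "closure S \<subseteq> cball 0 r \<inter> {x. b \<bullet> x \<ge> 0}"
    by (rule closure_minimal) (auto simp: S_def closed_halfspace_ge intro!: closed_Int)
  have ball: "cball 0 r \<subseteq> ball (0::'a) R"
    using t by auto
  note rpfs = rpf_intros rpf_inner rpf_norm2
  have "harmonic_poly q"
  proof -
    \<comment> \<open>Multiplied by the dimension m, this -2 cancels the Laplacian 2 m of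
      |x|^2.\<close>
    have "lap (\<lambda>x. (x \<bullet> b) * (r + (-1) * (x \<bullet> b))) x = -2" for x :: 'a
    proof -
      have "(\<Sum>c\<in>Basis. pd c (\<lambda>x. x \<bullet> b) x * pd c (\<lambda>x. r + (-1) * (x \<bullet> b)) x)
          = (\<Sum>c\<in>Basis. if c = b then -1 else 0)"
        using b by (intro sum.cong)
          (auto simp only: pd_add[OF rpf_const rpf_mult[OF rpf_const rpf_inner]] pd_cmult[OF rpf_inner]
            pd_inner pd_const, auto simp: inner_Basis)
      then have "(\<Sum>c\<in>Basis. pd c (\<lambda>x. x \<bullet> b) x * pd c (\<lambda>x. r + (-1) * (x \<bullet> b)) x) = -1"
        using b by simp
      moreover have "lap (\<lambda>x. r + (-1) * (x \<bullet> b)) x = 0" for x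
      proof -
        have "lap (\<lambda>x::'a. r) x = 0"
          by (simp add: lap_def pd_const)
        then show ?thesis
          by (simp only: lap_add[OF rpf_const rpf_mult[OF rpf_const rpf_inner]] lap_cmult[OF rpf_inner] lap_inner)
      qed
      ultimately show ?thesis
        by (subst lap_mult) (auto intro!: rpfs simp: lap_inner simp del: mult_minus_left)
    qed
    moreover have r1: "rpf (\<lambda>x. (x \<bullet> b) * (r + (-1) * (x \<bullet> b)))"
      by (intro rpfs)
    ultimately have "lap q x = 0" for x
      unfolding q_def
      by (simp only: lap_cmult lap_add lap_norm2 rpf_add rpf_mult rpf_const rpf_norm2)
        (simp add: m_def)
    moreover have "rpf q"
      unfolding q_def by (intro rpfs)
    ultimately show ?thesis
      by (simp add: harmonic_poly_def)
  qed
  then have q: "dharmonic_on S q" "continuous_on (closure S) q"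
    by (auto intro: harmonic_poly_dharmonic rpf_continuous_on simp: harmonic_poly_def)
  have "dharmonic_on {x. \<sigma> x \<in> ball 0 R} (\<lambda>x. u (\<sigma> x))"
    unfolding \<sigma>_def by (rule dharmonic_on_reflect[OF u b])
  moreover have "{x. \<sigma> x \<in> ball 0 R} = ball 0 R"
    by (auto simp: n\<sigma>)
  ultimately have u\<sigma>: "dharmonic_on (ball 0 R) (\<lambda>x. u (\<sigma> x))"
    by simp
  have w: "dharmonic_on (ball 0 R) (\<lambda>x. u x - u (\<sigma> x))"
    by (rule dharmonic_on_diff[OF u u\<sigma>])
  have "(u (t *\<^sub>R b) - u (\<sigma> (t *\<^sub>R b))) \<le> q (t *\<^sub>R b) + 0"
  proof (rule dharmonic_le[OF \<open>open S\<close> \<open>bounded S\<close> _ _ q(2,1)])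
    show "continuous_on (closure S) (\<lambda>x. u x - u (\<sigma> x))"
      using w clS ball by (meson continuous_on_subset dharmonic_on_continuous le_inf_iff order_trans)
    show "dharmonic_on S (\<lambda>x. u x - u (\<sigma> x))"
      by (rule dharmonic_on_subset[OF w]) (use t in \<open>auto simp: S_def\<close>)
    show "t *\<^sub>R b \<in> closure S"
      using t norm_b by (intro closure_subset[THEN subsetD]) (auto simp: S_def)
    fix z assume z: "z \<in> frontier S"
    then have "z \<in> closure S" "z \<notin> S"
      using \<open>open S\<close> by (auto simp: frontier_def interior_open)
    then have z': "norm z \<le> r" "z \<bullet> b \<ge> 0" "norm z = r \<or> z \<bullet> b = 0"
      using clS by (auto simp: S_def inner_commute)
    have "z \<bullet> b \<le> r"
      using z'(1) norm_b Cauchy_Schwarz_ineq2[of z b] by simp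
    \<comment> \<open>From 0 <= z . b <= r the second summand of \<open>q\<close> is nonnegative, so
      |z|^2 alone decides: it gives 2 M on the spherical part and 0 suffices on the flat part, where
      the odd part of \<open>u\<close> vanishes.\<close>
    then have qz: "q z \<ge> (2 * M / r\<^sup>2) * (z \<bullet> z)"
      using z'(2) \<open>M \<ge> 0\<close> unfolding q_def m_def
      by (intro mult_left_mono) (auto intro!: mult_nonneg_nonneg)
    show "u z - u (\<sigma> z) \<le> q z + 0"
    proof (cases "norm z = r")
      case True
      then have "z \<bullet> z = r\<^sup>2"
        by (simp add: power2_norm_eq_inner[symmetric])
      then have "q z \<ge> 2 * M"
        using qz \<open>r > 0\<close> by simp
      moreover have "\<bar>u z\<bar> \<le> M" "\<bar>u (\<sigma> z)\<bar> \<le> M"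
        using z'(1) t n\<sigma>[of z] by (auto intro!: M)
      ultimately show ?thesis by linarith
    next
      case False
      then have "\<sigma> z = z"
        using z' by (simp add: \<sigma>_def)
      moreover have "(2 * M / r\<^sup>2) * (z \<bullet> z) \<ge> 0"
        using \<open>M \<ge> 0\<close> by simp
      ultimately show ?thesis using qz by simp
    qed
  qed
  moreover have "\<sigma> (t *\<^sub>R b) = - (t *\<^sub>R b)"
    using norm_b by (simp add: \<sigma>_def algebra_simps scaleR_2 flip: scaleR_add_left)
  moreover have "q (t *\<^sub>R b) \<le> 2 * M * (real DIM('a) + 1) * t / r"
  proof -
    have "t * t + m * (t * (r - t)) \<le> (m + 1) * t * r"
    proof -
      have "t * t \<le> t * r" "0 \<le> m * (t * t)"
        using t by (auto simp: m_def)
      then show ?thesis by (simp add: algebra_simps)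
    qed
    then have "(2 * M / r\<^sup>2) * (t * t + m * (t * (r - t))) \<le> (2 * M / r\<^sup>2) * ((m + 1) * t * r)"
      using \<open>M \<ge> 0\<close> by (intro mult_left_mono) auto
    moreover have "q (t *\<^sub>R b) = (2 * M / r\<^sup>2) * (t * t + m * (t * (r - t)))"
      using norm_b by (simp add: q_def)
    moreover have "(2 * M / r\<^sup>2) * ((m + 1) * t * r) = 2 * M * (m + 1) * t / r"
      using \<open>r > 0\<close> by (simp add: power2_eq_square)
    ultimately show ?thesis
      by (simp add: m_def)
  qed
  ultimately show ?thesis by simp
qed

lemma reflection_estimate:
  fixes u :: "'a::euclidean_space \<Rightarrow> real"
  assumes u: "dharmonic_on (ball c R) u" and M: "\<And>y. y \<in> ball c R \<Longrightarrow> \<bar>u y\<bar> \<le> M"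
    and b: "b \<in> Basis" and t: "0 < t" "t < r" "r < R"
  shows "\<bar>u (c + t *\<^sub>R b) - u (c - t *\<^sub>R b)\<bar> \<le> 2 * M * (real DIM('a) + 1) * t / r"
proof -
  have v: "dharmonic_on (ball 0 R) (\<lambda>x. u (x + c))"
    by (rule dharmonic_on_subset[OF dharmonic_on_translate[OF u]]) (auto simp: dist_norm)
  have M': "\<bar>u (y + c)\<bar> \<le> M" "\<bar>-1 * u (y + c)\<bar> \<le> M" if "y \<in> ball 0 R" for y
    using that M[of "y + c"] by (auto simp: dist_norm)
  show ?thesis
    using reflection_estimate_aux[OF v M'(1) b t]
      reflection_estimate_aux[OF dharmonic_on_cmult[OF v, of "-1"] M'(2) b t]
    by (simp add: add.commute)
qed

section \<open>Gradient estimate and limits of harmonic polynomials\<close>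

text \<open>The derivative is the limit of symmetric difference quotients, which the reflection
  estimate with radius r / 2 bounds for small steps. Differentiability is assumed because the first
  application is to polynomials, on the way to the regularity theorem;
  \<open>dharmonic_derivative_bound'\<close> then discharges it.\<close>

lemma dharmonic_derivative_bound:
  fixes u :: "'a::euclidean_space \<Rightarrow> real"
  assumes u: "dharmonic_on (ball x r) u" and M: "\<And>y. y \<in> ball x r \<Longrightarrow> \<bar>u y\<bar> \<le> M"
    and b: "b \<in> Basis" and "r > 0" and d: "u differentiable (at x)"
  shows "\<bar>pd b u x\<bar> \<le> 2 * (real DIM('a) + 1) * M / r"
proof -
  have D: "((\<lambda>s. u (x + s *\<^sub>R b)) has_real_derivative pd b u x) (at 0)"
    using DERIV_along_line[of u x 0 b] d by simp
  then have "((\<lambda>t. (u (x + t *\<^sub>R b) - u x) / t) \<longlongrightarrow> pd b u x) (at 0)"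
    by (simp add: DERIV_def)
  moreover have "((\<lambda>t. (u (x + (- t) *\<^sub>R b) - u x) / (- t)) \<longlongrightarrow> pd b u x) (at 0)"
  proof -
    have "filterlim uminus (at 0) (at (0::real))"
      by (auto simp: filterlim_at eventually_at_filter intro!: tendsto_eq_intros)
    from filterlim_compose[OF calculation this] show ?thesis .
  qed
  ultimately have "((\<lambda>t. \<bar>((u (x + t *\<^sub>R b) - u x) / t + (u (x + (- t) *\<^sub>R b) - u x) / (- t)) / 2\<bar>)
      \<longlongrightarrow> \<bar>(pd b u x + pd b u x) / 2\<bar>) (at 0)"
    by (intro tendsto_intros) auto
  then have lim: "((\<lambda>t. \<bar>((u (x + t *\<^sub>R b) - u x) / t + (u (x + (- t) *\<^sub>R b) - u x) / (- t)) / 2\<bar>)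
      \<longlongrightarrow> \<bar>pd b u x\<bar>) (at_right 0)"
    by (simp add: filterlim_at_split)
  have "eventually (\<lambda>t::real. t \<in> {0<..<r/2}) (at_right 0)"
    using \<open>r > 0\<close> by (intro eventually_at_right_real) auto
  then have "eventually (\<lambda>t. \<bar>((u (x + t *\<^sub>R b) - u x) / t + (u (x + (- t) *\<^sub>R b) - u x) / (- t)) / 2\<bar>
      \<le> 2 * (real DIM('a) + 1) * M / r) (at_right 0)"
  proof eventually_elim
    case (elim t)
    have "\<bar>u (x + t *\<^sub>R b) - u (x - t *\<^sub>R b)\<bar> \<le> 2 * M * (real DIM('a) + 1) * t / (r / 2)"
      by (rule reflection_estimate[OF u M b]) (use elim \<open>r > 0\<close> in auto)
    then have "\<bar>u (x + t *\<^sub>R b) - u (x - t *\<^sub>R b)\<bar> / (2 * t) \<le> 2 * M * (real DIM('a) + 1) * t / (r / 2) / (2 * t)"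
      using elim by (intro divide_right_mono) auto
    moreover have "((u (x + t *\<^sub>R b) - u x) / t + (u (x + (- t) *\<^sub>R b) - u x) / (- t)) / 2
        = (u (x + t *\<^sub>R b) - u (x - t *\<^sub>R b)) / (2 * t)"
      using elim by (simp add: field_simps)
    ultimately show ?case
      using elim by (simp add: abs_divide field_simps)
  qed
  then show ?thesis
    by (rule tendsto_upperbound[OF lim]) simp
qed

text \<open>The gradient estimate, applied to the difference of two members of the sequence on balls
  of radius r - s, turns uniform convergence into uniform convergence of the derivatives on the
  smaller ball.\<close>

lemma harmonic_limit_deriv:
  fixes u :: "'a::euclidean_space \<Rightarrow> real"
  assumes hp: "\<And>n. harmonic_poly (p n)" and lim: "uniform_limit (ball a r) p u sequentially"
    and s: "0 < s" "s < r"
  shows "\<And>x. x \<in> ball a s \<Longrightarrow> u differentiable (at x)"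
    and "\<And>v. uniform_limit (ball a s) (\<lambda>n. pd v (p n)) (pd v u) sequentially"
proof -
  define K where "K = 2 * (real DIM('a) + 1) / (r - s)"
  have K: "K > 0"
    using s by (simp add: K_def)
  have rp: "rpf (p n)" for n
    using hp by (simp add: harmonic_poly_def)
  note dp = rpf_differentiable[OF rp]
  have "uniformly_Cauchy_on (ball a s) (\<lambda>n. pd b (p n))" if b: "b \<in> Basis" for b
    unfolding uniformly_Cauchy_on_def
  proof (intro allI impI)
    fix e :: real assume "e > 0"
    \<comment> \<open>Two members that are \<open>d\<close>-close to the limit differ by at most 2
      d, and the gradient estimate with factor \<open>K\<close> leaves e / 2.\<close>
    define d where "d = e / (4 * K)"
    have d: "d > 0" "K * (2 * d) < e"
      using \<open>e > 0\<close> K by (auto simp: d_def)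
    obtain N where N: "\<And>n x. n \<ge> N \<Longrightarrow> x \<in> ball a r \<Longrightarrow> dist (p n x) (u x) < d"
      using lim d(1) unfolding uniform_limit_iff eventually_sequentially by meson
    have "dist (pd b (p m) x) (pd b (p n) x) < e" if mn: "m \<ge> N" "n \<ge> N" and x: "x \<in> ball a s" for m n x
    proof -
      have sub: "ball x (r - s) \<subseteq> ball a r"
        using x by (simp add: ball_subset_ball_iff dist_commute)
      have "\<bar>pd b (\<lambda>x. p m x - p n x) x\<bar> \<le> 2 * (real DIM('a) + 1) * (2 * d) / (r - s)"
      proof (rule dharmonic_derivative_bound[OF harmonic_poly_dharmonic[OF harmonic_poly_diff[OF hp hp]] _ b])
        fix y assume "y \<in> ball x (r - s)"
        then have "y \<in> ball a r" using sub by blast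
        then show "\<bar>p m y - p n y\<bar> \<le> 2 * d"
          using N[OF mn(1), of y] N[OF mn(2), of y] unfolding dist_real_def by linarith
      qed (use s in \<open>auto intro!: derivative_intros dp\<close>)
      moreover have "pd b (\<lambda>x. p m x - p n x) x = pd b (p m) x - pd b (p n) x"
        by (rule pd_eq) (intro has_derivative_diff has_derivative_pd dp)
      ultimately show ?thesis
        using d(2) by (simp add: dist_real_def K_def)
    qed
    then show "\<exists>M. \<forall>x\<in>ball a s. \<forall>m\<ge>M. \<forall>n\<ge>M. dist (pd b (p m) x) (pd b (p n) x) < e"
      by blast
  qed
  then have "\<forall>b\<in>Basis. \<exists>g. uniform_limit (ball a s) (\<lambda>n. pd b (p n)) g sequentially"
    using Cauchy_uniformly_convergent unfolding uniformly_convergent_on_def by blast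
  then obtain G where G: "\<And>b. b \<in> Basis \<Longrightarrow> uniform_limit (ball a s) (\<lambda>n. pd b (p n)) (G b) sequentially"
    by metis
  define g' where "g' x v = (\<Sum>b\<in>Basis. (v \<bullet> b) * G b x)" for x v
  have ev: "eventually (\<lambda>n. \<forall>x\<in>ball a s. \<forall>h. norm (pd h (p n) x - g' x h) \<le> e * norm h) sequentially"
    if "e > 0" for e
  proof -
    define d where "d = e / real DIM('a)"
    have "d > 0" using that by (simp add: d_def)
    then have "eventually (\<lambda>n. \<forall>b\<in>Basis. \<forall>x\<in>ball a s. dist (pd b (p n) x) (G b x) < d) sequentially"
      using G by (intro eventually_ball_finite) (auto simp: uniform_limit_iff)
    then show ?thesis
    proof eventually_elim
      case (elim n)
      show ?case
      proof (intro ballI allI)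
        fix x h assume x: "x \<in> ball a s"
        have "pd h (p n) x - g' x h = (\<Sum>b\<in>Basis. (h \<bullet> b) * (pd b (p n) x - G b x))"
          unfolding g'_def pd_Basis_sum[OF dp, of h] by (simp add: sum_subtractf right_diff_distrib)
        also have "norm \<dots> \<le> (\<Sum>b\<in>(Basis::'a set). norm h * d)"
        proof (rule order_trans[OF norm_sum], rule sum_mono)
          fix b :: 'a assume b: "b \<in> Basis"
          have "\<bar>h \<bullet> b\<bar> \<le> norm h" "\<bar>pd b (p n) x - G b x\<bar> \<le> d"
            using b x elim Basis_le_norm[OF b, of h] by (auto simp: dist_real_def less_imp_le)
          then show "norm ((h \<bullet> b) * (pd b (p n) x - G b x)) \<le> norm h * d"
            by (simp add: abs_mult mult_mono)
        qed
        finally show "norm (pd h (p n) x - g' x h) \<le> e * norm h"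
          by (simp add: d_def mult.commute)
      qed
    qed
  qed
  have conv: "(\<lambda>n. p n x) \<longlonglongrightarrow> u x" if "x \<in> ball a s" for x
    using tendsto_uniform_limitI[OF lim] that s by auto
  have "\<exists>g. \<forall>x\<in>ball a s. (\<lambda>n. p n x) \<longlonglongrightarrow> g x \<and> (g has_derivative g' x) (at x within ball a s)"
  proof (rule has_derivative_sequence[where f = p and f' = "\<lambda>n x v. pd v (p n) x"])
    show "a \<in> ball a s" "(\<lambda>n. p n a) \<longlonglongrightarrow> u a"
      using s conv by auto
    show "(p n has_derivative (\<lambda>v. pd v (p n) x)) (at x within ball a s)" for n x
      by (rule has_derivative_at_withinI) (rule has_derivative_pd[OF dp])
  qed (use ev in auto)
  then obtain g where g: "\<And>x. x \<in> ball a s \<Longrightarrow> (\<lambda>n. p n x) \<longlonglongrightarrow> g x"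
    "\<And>x. x \<in> ball a s \<Longrightarrow> (g has_derivative g' x) (at x within ball a s)"
    by blast
  have ug: "u x = g x" if "x \<in> ball a s" for x
    using conv[OF that] g(1)[OF that] LIMSEQ_unique by blast
  have ud: "(u has_derivative g' x) (at x)" if "x \<in> ball a s" for x
  proof -
    have "(g has_derivative g' x) (at x)"
      using g(2)[OF that] that by (simp add: at_within_open[of x "ball a s"])
    then show ?thesis
      by (rule has_derivative_transform_within_open[where s = "ball a s"]) (use that ug in auto)
  qed
  show "u differentiable (at x)" if "x \<in> ball a s" for x
    using ud[OF that] by (auto simp: differentiable_def)
  show "uniform_limit (ball a s) (\<lambda>n. pd v (p n)) (pd v u) sequentially" for v
    unfolding uniform_limit_iff
  proof (intro allI impI)
    fix e :: real assume "e > 0"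
    define d where "d = e / (2 * (norm v + 1))"
    have "norm v + 1 > 0"
      using norm_ge_zero[of v] by linarith
    then have d: "d > 0" "d * norm v < e"
      using \<open>e > 0\<close> by (auto simp: d_def field_simps) (smt (verit) mult_nonneg_nonneg norm_ge_zero)
    show "eventually (\<lambda>n. \<forall>x\<in>ball a s. dist (pd v (p n) x) (pd v u x) < e) sequentially"
      using ev[OF d(1)]
    proof eventually_elim
      case (elim n)
      show ?case
      proof
        fix x assume x: "x \<in> ball a s"
        show "dist (pd v (p n) x) (pd v u x) < e"
          using elim x d(2) pd_eq[OF ud[OF x], of v] unfolding dist_norm
          by (metis (no_types, lifting) le_less_trans)
      qed
    qed
  qed
qed

text \<open>Two applications of \<open>harmonic_limit_deriv\<close> on shrinking balls let the
  equation lap = 0 pass to the limit.\<close>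

lemma harmonic_limit_dharmonic:
  fixes u :: "'a::euclidean_space \<Rightarrow> real"
  assumes hp: "\<And>n. harmonic_poly (p n)" and lim: "uniform_limit (ball a r) p u sequentially"
  shows "dharmonic_on (ball a r) u"
proof (rule dharmonic_on_local)
  fix x assume "x \<in> ball a r"
  then obtain e where e: "e > 0" "ball x e \<subseteq> ball a r"
    using open_ball openE by blast
  have lim: "uniform_limit (ball x e) p u sequentially"
    using lim e(2) by (rule uniform_limit_on_subset)
  have e2: "0 < e / 2" "e / 2 < e" "0 < e / 4" "e / 4 < e / 2" "0 < e / 8" "e / 8 < e / 4"
    using e by auto
  note l1 = harmonic_limit_deriv[OF hp lim e2(1,2)]
  note l2 = harmonic_limit_deriv[OF harmonic_poly_pd[OF hp] l1(2) e2(3,4)]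
  have sub: "ball x (e / 4) \<subseteq> ball x (e / 2)"
    using e by auto
  have "dharmonic_on (ball x (e / 4)) u"
  proof (rule dharmonic_if_laplacian_zero)
    fix b :: 'a assume "b \<in> Basis"
    show "continuous_on (ball x (e / 4)) (pd b (pd b u))"
    proof (rule uniform_limit_theorem[OF _ l2(2)])
      have "rpf (pd b (pd b (p n)))" for n
        using hp by (auto simp: harmonic_poly_def intro!: rpf_pd)
      then show "eventually (\<lambda>n. continuous_on (ball x (e / 4)) (pd b (pd b (p n)))) sequentially"
        by (simp add: rpf_continuous_on)
    qed simp
  next
    fix y assume y: "y \<in> ball x (e / 4)"
    have "(\<lambda>n. lap (p n) y) \<longlonglongrightarrow> lap u y"
      unfolding lap_def by (intro tendsto_intros tendsto_uniform_limitI[OF l2(2)] y)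
    then show "lap u y = 0"
      using hp by (simp add: harmonic_poly_def LIMSEQ_const_iff)
  qed (use l1(1) l2(1) sub in auto)
  then show "\<exists>r>0. dharmonic_on (ball x r) u"
    using e2 by blast
qed

section \<open>The Dirichlet problem in a ball\<close>

lemma harmonic_poly_affine:
  assumes "harmonic_poly p"
  shows "harmonic_poly (\<lambda>x. p (c *\<^sub>R x + a))"
proof -
  have pdr: "pd v (\<lambda>x. q (c *\<^sub>R x + a)) = (\<lambda>x. c * pd v q (c *\<^sub>R x + a))" if q: "rpf q" for v and q :: "'a \<Rightarrow> real"
  proof (rule ext, rule pd_eq)
    fix x
    have "((\<lambda>x. c *\<^sub>R x + a) has_derivative (\<lambda>h. c *\<^sub>R h)) (at x)"
      by (auto intro!: derivative_eq_intros)
    from has_derivative_compose[OF this has_derivative_pd[OF rpf_differentiable[OF q]]]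
    have "((\<lambda>x. q (c *\<^sub>R x + a)) has_derivative (\<lambda>h. pd (c *\<^sub>R h) q (c *\<^sub>R x + a))) (at x)" .
    then show "((\<lambda>x. q (c *\<^sub>R x + a)) has_derivative (\<lambda>h. c * pd h q (c *\<^sub>R x + a))) (at x)"
      by (simp add: linear_scale[OF linear_pd[OF rpf_differentiable[OF q]]])
  qed
  have p: "rpf p" "\<And>x. lap p x = 0"
    using assms by (auto simp: harmonic_poly_def)
  have comp: "rpf (\<lambda>x. q (c *\<^sub>R x + a))" if "rpf q" for q :: "'a \<Rightarrow> real"
  proof -
    have "polynomial_function (\<lambda>x::'a. c *\<^sub>R x + a)"
      by (intro polynomial_function_add polynomial_function_const polynomial_function_cmul)
        (simp add: polynomial_function_id[unfolded id_def] polynomial_function_bounded_linear)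
    from real_polynomial_function_compose[OF this that] show ?thesis
      by (simp add: o_def)
  qed
  have "lap (\<lambda>x. p (c *\<^sub>R x + a)) x = c * c * lap p (c *\<^sub>R x + a)" for x
    using p(1) unfolding lap_def
    by (simp add: pdr pd_cmult comp rpf_pd sum_distrib_left mult.assoc)
  then show ?thesis
    using p comp by (simp add: harmonic_poly_def)
qed

text \<open>A polynomial close to \<open>f\<close> on the sphere may be replaced by a harmonic one
  with the same values there. The maximum principle then carries the uniform Cauchy property from
  the sphere to the closed ball.\<close>

lemma dirichlet_unit_ball:
  fixes f :: "'a::euclidean_space \<Rightarrow> real"
  assumes "continuous_on (sphere 0 1) f"
  obtains p u where "\<And>n. harmonic_poly (p n)" "uniform_limit (cball 0 1) p u sequentially"
    "\<And>x. x \<in> sphere 0 1 \<Longrightarrow> u x = f x"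
proof -
  have "\<exists>p. harmonic_poly p \<and> (\<forall>x\<in>sphere 0 1. \<bar>f x - p x\<bar> < inverse (Suc n))" for n
  proof -
    obtain g where g: "rpf g" "\<And>x. x \<in> sphere 0 1 \<Longrightarrow> \<bar>f x - g x\<bar> < inverse (Suc n)"
      using Stone_Weierstrass_real_polynomial_function[OF compact_sphere assms, of "inverse (Suc n)"] by auto
    obtain p where "harmonic_poly p" "\<And>x. norm x = 1 \<Longrightarrow> g x = p x"
      by (rule poly_eq_harmonic_on_sphere[OF g(1)]) (rule that)
    then show ?thesis
      using g(2) by (intro exI[of _ p]) auto
  qed
  then obtain p where p: "\<And>n. harmonic_poly (p n)"
    "\<And>n x. x \<in> sphere 0 1 \<Longrightarrow> \<bar>f x - p n x\<bar> < inverse (Suc n)"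
    by metis
  have "uniformly_Cauchy_on (cball 0 1) p"
    unfolding uniformly_Cauchy_on_def
  proof (intro allI impI)
    fix e :: real assume "e > 0"
    then obtain N where N: "inverse (real (Suc N)) < e / 2"
      using reals_Archimedean[of "e / 2"] by auto
    have "dist (p m x) (p n x) < e" if "m \<ge> N" "n \<ge> N" "x \<in> cball 0 1" for m n x
    proof -
      have le: "inverse (real (Suc k)) \<le> inverse (real (Suc N))" if "k \<ge> N" for k
        using that by simp
      have "\<bar>p m x - p n x\<bar> \<le> 2 * inverse (real (Suc N))"
      proof (rule dharmonic_abs_diff_le[where S = "ball 0 1" and u = "p m" and v = "p n"])
        fix z :: 'a assume "z \<in> frontier (ball 0 1)"
        then have "z \<in> sphere 0 1" by simp
        from p(2)[OF this, of m] p(2)[OF this, of n]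
        show "\<bar>p m z - p n z\<bar> \<le> 2 * inverse (real (Suc N))"
          using le[OF that(1)] le[OF that(2)] by linarith
      qed (use p that in \<open>auto intro!: harmonic_poly_dharmonic rpf_continuous_on simp: harmonic_poly_def\<close>)
      then show ?thesis
        using N by (simp add: dist_real_def)
    qed
    then show "\<exists>M. \<forall>x\<in>cball 0 1. \<forall>m\<ge>M. \<forall>n\<ge>M. dist (p m x) (p n x) < e"
      by blast
  qed
  then obtain u where u: "uniform_limit (cball 0 1) p u sequentially"
    using Cauchy_uniformly_convergent unfolding uniformly_convergent_on_def by blast
  have "u x = f x" if "x \<in> sphere 0 1" for x
  proof -
    have "(\<lambda>n. p n x) \<longlonglongrightarrow> u x"
      using tendsto_uniform_limitI[OF u] that by auto
    moreover have "(\<lambda>n. p n x) \<longlonglongrightarrow> f x"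
    proof (rule Lim_null_comparison[where g = "\<lambda>n. inverse (real (Suc n))", THEN LIM_zero_cancel])
      show "eventually (\<lambda>n. norm (p n x - f x) \<le> inverse (real (Suc n))) sequentially"
        using p(2)[OF that] by (auto simp: abs_minus_commute intro!: always_eventually less_imp_le)
    qed (rule LIMSEQ_inverse_real_of_nat)
    ultimately show ?thesis
      by (rule LIMSEQ_unique)
  qed
  then show ?thesis
    using that p(1) u by blast
qed

text \<open>The approximating harmonic polynomials are part of the conclusion because the regularity
  theory is read off from them.\<close>

lemma dirichlet_ball_poly:
  fixes f :: "'a::euclidean_space \<Rightarrow> real"
  assumes "continuous_on (sphere a r) f" "r > 0"
  obtains p u where "\<And>n. harmonic_poly (p n)" "uniform_limit (cball a r) p u sequentially"
    "\<And>x. x \<in> sphere a r \<Longrightarrow> u x = f x" "continuous_on (cball a r) u" "dharmonic_on (ball a r) u"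
proof -
  have "continuous_on (sphere 0 1) (\<lambda>x. f (a + r *\<^sub>R x))"
    by (rule continuous_on_compose2[OF assms(1)]) (use assms(2) in \<open>auto intro!: continuous_intros simp: dist_norm\<close>)
  then obtain p u where p: "\<And>n. harmonic_poly (p n)" "uniform_limit (cball 0 1) p u sequentially"
    "\<And>x. x \<in> sphere 0 1 \<Longrightarrow> u x = f (a + r *\<^sub>R x)"
    using dirichlet_unit_ball by blast
  define T where "T x = (1 / r) *\<^sub>R x + - ((1 / r) *\<^sub>R a)" for x
  have T: "T x = (1 / r) *\<^sub>R (x - a)" for x
    by (simp add: T_def scaleR_diff_right)
  have hp: "harmonic_poly (\<lambda>x. p n (T x))" for n
    unfolding T_def by (rule harmonic_poly_affine[OF p(1)])
  have lim: "uniform_limit (cball a r) (\<lambda>n x. p n (T x)) (\<lambda>x. u (T x)) sequentially"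
  proof (rule uniform_limit_compose'[OF p(2)])
    show "T \<in> cball a r \<rightarrow> cball 0 1"
      using assms(2) by (auto simp: T dist_norm norm_minus_commute)
  qed
  show ?thesis
  proof (rule that[OF hp lim])
    show "u (T x) = f x" if "x \<in> sphere a r" for x
    proof -
      have "T x \<in> sphere 0 1" "a + r *\<^sub>R T x = x"
        using that assms(2) by (auto simp: T dist_norm norm_minus_commute)
      then show ?thesis using p(3)[of "T x"] by simp
    qed
    show "continuous_on (cball a r) (\<lambda>x. u (T x))"
      by (rule uniform_limit_theorem[OF _ lim])
        (use hp in \<open>auto simp: harmonic_poly_def rpf_continuous_on\<close>)
    show "dharmonic_on (ball a r) (\<lambda>x. u (T x))"
      by (rule harmonic_limit_dharmonic[OF hp uniform_limit_on_subset[OF lim]]) auto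
  qed
qed

section \<open>Regularity of harmonic functions\<close>

text \<open>By the maximum principle \<open>u\<close> coincides with the harmonic extension of its
  own values on the sphere, and that extension is a uniform limit of harmonic polynomials.\<close>

lemma dharmonic_local_poly:
  fixes u :: "'a::euclidean_space \<Rightarrow> real"
  assumes "dharmonic_on S u" "cball a r \<subseteq> S" "r > 0"
  obtains p where "\<And>n. harmonic_poly (p n)" "uniform_limit (cball a r) p u sequentially"
proof -
  have c: "continuous_on (cball a r) u"
    using assms dharmonic_on_continuous continuous_on_subset by blast
  have "continuous_on (sphere a r) u"
    by (rule continuous_on_subset[OF c]) auto
  then obtain p v where p: "\<And>n. harmonic_poly (p n)" "uniform_limit (cball a r) p v sequentially"
    "\<And>x. x \<in> sphere a r \<Longrightarrow> v x = u x" "continuous_on (cball a r) v" "dharmonic_on (ball a r) v"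
    using dirichlet_ball_poly[OF _ assms(3)] by metis
  have "\<bar>u x - v x\<bar> \<le> 0" if "x \<in> cball a r" for x
  proof (rule dharmonic_abs_diff_le[where S = "ball a r" and u = u and v = v])
    show "dharmonic_on (ball a r) u"
      using assms by (meson ball_subset_cball dharmonic_on_subset order_trans)
  qed (use p c that assms(3) in auto)
  then have "uniform_limit (cball a r) p u sequentially \<longleftrightarrow> uniform_limit (cball a r) p v sequentially"
    by (intro uniform_limit_cong') auto
  then show ?thesis
    using that p by blast
qed

text \<open>This is the analogue of Weyl's lemma for the difference Laplacian. Local approximation
  by harmonic polynomials, with convergence of first and second derivatives, transfers
  differentiability, commuting partial derivatives and lap = 0 from the polynomials. As derivatives
  are harmonic again, the statement can be iterated.\<close>

lemma dharmonic_regular: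
  fixes u :: "'a::euclidean_space \<Rightarrow> real"
  assumes "dharmonic_on S u" "open S"
  shows dharmonic_differentiable: "\<And>x. x \<in> S \<Longrightarrow> u differentiable (at x)"
    and dharmonic_pd: "\<And>v. dharmonic_on S (pd v u)"
    and dharmonic_pd_commute: "\<And>x v w. x \<in> S \<Longrightarrow> pd v (pd w u) x = pd w (pd v u) x"
    and dharmonic_lap: "\<And>x. x \<in> S \<Longrightarrow> lap u x = 0"
proof -
  have loc: "\<exists>s>0. u differentiable (at x) \<and> (\<forall>v. dharmonic_on (ball x s) (pd v u)) \<and>
      (\<forall>v w. pd v (pd w u) x = pd w (pd v u) x) \<and> lap u x = 0" if x: "x \<in> S" for x
  proof -
    obtain e where e: "e > 0" "cball x e \<subseteq> S"
      using assms(2) x open_contains_cball by blast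
    obtain p where hp: "\<And>n. harmonic_poly (p n)" and "uniform_limit (cball x e) p u sequentially"
      using dharmonic_local_poly[OF assms(1) e(2,1)] by blast
    then have lim: "uniform_limit (ball x e) p u sequentially"
      by (meson ball_subset_cball uniform_limit_on_subset)
    have e2: "0 < e / 2" "e / 2 < e" "0 < e / 4" "e / 4 < e / 2"
      using e by auto
    note l1 = harmonic_limit_deriv[OF hp lim e2(1,2)]
    note l2 = harmonic_limit_deriv[OF harmonic_poly_pd[OF hp] l1(2) e2(3,4)]
    have x4: "x \<in> ball x (e / 4)" "x \<in> ball x (e / 2)"
      using e by auto
    have "pd v (pd w u) x = pd w (pd v u) x" for v w
    proof -
      have "pd v (pd w (p n)) = pd w (pd v (p n))" for n
        using hp by (intro pd_commute) (simp add: harmonic_poly_def)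
      then have "(\<lambda>n. pd w (pd v (p n)) x) \<longlonglongrightarrow> pd v (pd w u) x"
        using tendsto_uniform_limitI[OF l2(2)[of v w] x4(1)] by simp
      then show ?thesis
        using tendsto_uniform_limitI[OF l2(2)[of w v] x4(1)] LIMSEQ_unique by blast
    qed
    moreover have "lap u x = 0"
    proof -
      have "(\<lambda>n. lap (p n) x) \<longlonglongrightarrow> lap u x"
        unfolding lap_def by (intro tendsto_intros tendsto_uniform_limitI[OF l2(2)] x4)
      then show ?thesis
        using hp by (simp add: harmonic_poly_def LIMSEQ_const_iff)
    qed
    moreover have "dharmonic_on (ball x (e / 2)) (pd v u)" for v
      by (rule harmonic_limit_dharmonic[OF harmonic_poly_pd[OF hp] l1(2)])
    ultimately show ?thesis
      using l1(1)[OF x4(2)] e2(1) by blast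
  qed
  show "dharmonic_on S (pd v u)" for v
    using loc by (intro dharmonic_on_local) blast
  show "u differentiable (at x)" "pd v (pd w u) x = pd w (pd v u) x" "lap u x = 0" if "x \<in> S" for x v w
    using loc[OF that] by blast+
qed

lemma dharmonic_derivative_bound':
  fixes u :: "'a::euclidean_space \<Rightarrow> real"
  assumes "dharmonic_on (ball x r) u" "\<And>y. y \<in> ball x r \<Longrightarrow> \<bar>u y\<bar> \<le> M" "b \<in> Basis" "r > 0"
  shows "\<bar>pd b u x\<bar> \<le> 2 * (real DIM('a) + 1) * M / r"
  using assms by (intro dharmonic_derivative_bound dharmonic_differentiable[OF assms(1)]) auto

lemma dharmonic_lipschitz:
  fixes u :: "'a::euclidean_space \<Rightarrow> real"
  assumes u: "dharmonic_on (ball a R) u" and M: "\<And>y. y \<in> ball a R \<Longrightarrow> \<bar>u y\<bar> \<le> M"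
    and "R > 0" and xy: "x \<in> ball a (R / 2)" "y \<in> ball a (R / 2)"
  shows "\<bar>u x - u y\<bar> \<le> real DIM('a) * (2 * (real DIM('a) + 1) * M / (R / 2)) * dist x y"
proof -
  define L where "L = 2 * (real DIM('a) + 1) * M / (R / 2)"
  have "M \<ge> 0"
    using M[of a] \<open>R > 0\<close> by auto
  then have "L \<ge> 0"
    using \<open>R > 0\<close> by (simp add: L_def)
  have d: "u differentiable (at z)" if "z \<in> ball a (R / 2)" for z
    using dharmonic_differentiable[OF u open_ball, of z] that \<open>R > 0\<close> by auto
  have bd: "\<bar>pd b u z\<bar> \<le> L" if z: "z \<in> ball a (R / 2)" and b: "b \<in> Basis" for z b
  proof -
    have sub: "ball z (R / 2) \<subseteq> ball a R"
      using z by (simp add: ball_subset_ball_iff dist_commute)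
    show ?thesis
      unfolding L_def
      by (rule dharmonic_derivative_bound'[OF dharmonic_on_subset[OF u sub] _ b])
        (use sub M \<open>R > 0\<close> in auto)
  qed
  have "norm (u x - u y) \<le> (real DIM('a) * L) * norm (x - y)"
  proof (rule differentiable_bound[where S = "ball a (R / 2)" and f' = "\<lambda>z v. pd v u z"])
    fix z assume z: "z \<in> ball a (R / 2)"
    show "(u has_derivative (\<lambda>v. pd v u z)) (at z within ball a (R / 2))"
      by (rule has_derivative_at_withinI) (rule has_derivative_pd[OF d[OF z]])
    show "onorm (\<lambda>v. pd v u z) \<le> real DIM('a) * L"
    proof (rule onorm_bound)
      fix v
      have "norm (pd v u z) \<le> (\<Sum>b\<in>(Basis::'a set). L * norm v)"
        unfolding pd_Basis_sum[OF d[OF z], of v]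
      proof (rule order_trans[OF norm_sum], rule sum_mono)
        fix b :: 'a assume b: "b \<in> Basis"
        then show "norm ((v \<bullet> b) * pd b u z) \<le> L * norm v"
          using bd[OF z b] Basis_le_norm[OF b, of v] \<open>L \<ge> 0\<close>
          by (simp add: abs_mult mult.commute[of "\<bar>v \<bullet> b\<bar>"] mult_mono)
      qed
      then show "norm (pd v u z) \<le> real DIM('a) * L * norm v"
        by (simp add: mult.assoc)
    qed (use \<open>L \<ge> 0\<close> in simp)
  qed (use xy in auto)
  then show ?thesis
    by (simp add: L_def dist_norm)
qed

section \<open>Uniform rates and bounded limits\<close>

text \<open>The rate depends only on \<open>M\<close>, \<open>r\<close> and the dimension, so it
  applies simultaneously to a whole family of harmonic functions; this is used for the kernel as a
  function of its pole, for all boundary points at once. The three factors K / (r / 4) bound three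
  successive derivatives, each at the cost of a quarter of the radius.\<close>

lemma diff_laplacian_bound:
  fixes u :: "'a::euclidean_space \<Rightarrow> real"
  assumes u: "dharmonic_on (ball y r) u" and M: "\<And>z. z \<in> ball y r \<Longrightarrow> \<bar>u z\<bar> \<le> M"
    and "r > 0" and t: "t \<noteq> 0" "\<bar>t\<bar> < r / 4"
  defines "K \<equiv> 2 * (real DIM('a) + 1)"
  shows "\<bar>diff_laplacian u y t\<bar> \<le>
    real DIM('a) * (real DIM('a) * (K * (K * (K * M / (r / 4)) / (r / 4)) / (r / 4)) * \<bar>t\<bar>)"
proof -
  define M1 M2 where "M1 = K * M / (r / 4)" and "M2 = K * M1 / (r / 4)"
  have sub1: "ball z (r / 4) \<subseteq> ball y r" if "z \<in> ball y (3 * r / 4)" for z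
    using that by (simp add: ball_subset_ball_iff dist_commute)
  have sub2: "ball z (r / 4) \<subseteq> ball y (3 * r / 4)" if "z \<in> ball y (r / 2)" for z
    using that by (simp add: ball_subset_ball_iff dist_commute)
  have sub: "ball y (r / 4) \<subseteq> ball y r" "ball y (r / 2) \<subseteq> ball y r"
    using \<open>r > 0\<close> by auto
  note u1 = dharmonic_pd[OF u open_ball]
  note u2 = dharmonic_pd[OF u1 open_ball]
  have b1: "\<bar>pd b u z\<bar> \<le> M1" if "b \<in> Basis" "z \<in> ball y (3 * r / 4)" for b z
    unfolding M1_def K_def
    by (rule dharmonic_derivative_bound'[OF dharmonic_on_subset[OF u sub1[OF that(2)]] _ that(1)])
      (use M sub1[OF that(2)] \<open>r > 0\<close> in auto)
  have b2: "\<bar>pd b (pd b u) z\<bar> \<le> M2" if "b \<in> Basis" "z \<in> ball y (r / 2)" for b z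
    unfolding M2_def K_def
  proof (rule dharmonic_derivative_bound'[OF dharmonic_on_subset[OF u1] _ that(1)])
    show "ball z (r / 4) \<subseteq> ball y r"
      using sub2[OF that(2)] \<open>r > 0\<close> by auto
  qed (use b1[OF that(1)] sub2[OF that(2)] \<open>r > 0\<close> in auto)
  have "\<bar>diff_laplacian u y t - lap u y\<bar> \<le> real DIM('a) * (real DIM('a) * (K * M2 / (r / 4)) * \<bar>t\<bar>)"
  proof (rule diff_laplacian_approx)
    fix z assume z: "dist y z \<le> \<bar>t\<bar>"
    then have zin: "z \<in> ball y (r / 4)" "z \<in> ball y r" and yin: "y \<in> ball y (r / 4)"
      using t \<open>r > 0\<close> by auto
    show "u differentiable (at z)"
      by (rule dharmonic_differentiable[OF u open_ball zin(2)])
    fix b :: 'a assume b: "b \<in> Basis"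
    show "pd b u differentiable (at z)"
      by (rule dharmonic_differentiable[OF u1 open_ball zin(2)])
    have "\<bar>pd b (pd b u) z - pd b (pd b u) y\<bar> \<le> real DIM('a) * (2 * (real DIM('a) + 1) * M2 / (r / 2 / 2)) * dist z y"
      by (rule dharmonic_lipschitz[OF dharmonic_on_subset[OF u2 sub(2)] b2[OF b]])
        (use zin yin \<open>r > 0\<close> in auto)
    also have "\<dots> \<le> real DIM('a) * (2 * (real DIM('a) + 1) * M2 / (r / 2 / 2)) * \<bar>t\<bar>"
    proof (rule mult_left_mono)
      have "M2 \<ge> 0"
        using b2[OF b, of y] \<open>r > 0\<close> by auto
      then show "0 \<le> real DIM('a) * (2 * (real DIM('a) + 1) * M2 / (r / 2 / 2))"
        using \<open>r > 0\<close> by simp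
    qed (use z in \<open>simp add: dist_commute\<close>)
    finally show "\<bar>pd b (pd b u) z - pd b (pd b u) y\<bar> \<le> real DIM('a) * (K * M2 / (r / 4)) * \<bar>t\<bar>"
      by (simp add: K_def)
  qed (rule t)
  moreover have "lap u y = 0"
    by (rule dharmonic_lap[OF u open_ball]) (use \<open>r > 0\<close> in simp)
  ultimately show ?thesis
    by (simp add: M2_def M1_def)
qed

text \<open>The common bound gives a common Lipschitz constant, so pointwise convergence is uniform
  on a compact ball. The limit is then continuous and can be compared with the harmonic extension of
  its own sphere values.\<close>

lemma dharmonic_bounded_limit:
  fixes h :: "'a::euclidean_space \<Rightarrow> real"
  assumes w: "\<And>n. dharmonic_on (ball a R) (w n)" and M: "\<And>n x. x \<in> ball a R \<Longrightarrow> \<bar>w n x\<bar> \<le> M"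
    and lim: "\<And>x. x \<in> ball a R \<Longrightarrow> (\<lambda>n. w n x) \<longlonglongrightarrow> h x"
  shows "dharmonic_on (ball a R) h"
proof (rule dharmonic_on_local)
  fix x assume "x \<in> ball a R"
  then obtain r where r: "r > 0" "ball x r \<subseteq> ball a R"
    using open_ball openE by blast
  define L where "L = real DIM('a) * (2 * (real DIM('a) + 1) * M / (r / 2))"
  have "M \<ge> 0"
    using M[of x 0] \<open>x \<in> ball a R\<close> by auto
  then have "L \<ge> 0"
    using r by (simp add: L_def)
  have Lw: "\<bar>w n y - w n z\<bar> \<le> L * dist y z" if "y \<in> ball x (r / 2)" "z \<in> ball x (r / 2)" for n y z
    unfolding L_def
    by (rule dharmonic_lipschitz[OF dharmonic_on_subset[OF w r(2)]]) (use that r M in auto)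
  have sub2: "ball x (r / 2) \<subseteq> ball a R"
    using r by auto
  have Lh: "\<bar>h y - h z\<bar> \<le> L * dist y z" if yz: "y \<in> ball x (r / 2)" "z \<in> ball x (r / 2)" for y z
  proof (rule tendsto_upperbound[OF _ _ trivial_limit_sequentially])
    show "(\<lambda>n. \<bar>w n y - w n z\<bar>) \<longlonglongrightarrow> \<bar>h y - h z\<bar>"
      using yz sub2 by (intro tendsto_intros lim) auto
  qed (use Lw[OF yz] in simp)
  define C where "C = cball x (r / 4)"
  have C: "C \<subseteq> ball x (r / 2)"
    using r by (auto simp: C_def)
  have unif: "\<exists>n. \<forall>y\<in>C. \<bar>w n y - h y\<bar> < e" if "e > 0" for e
  proof -
    \<comment> \<open>With L d < e / 3, values at \<open>y\<close> and at the nearest point of a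
      finite \<open>d\<close>-net differ by less than e / 3 both for \<open>w n\<close> and for
      \<open>h\<close>.\<close>
    define d where "d = e / (3 * (L + 1))"
    have d: "d > 0" "L * d < e / 3"
      using that \<open>L \<ge> 0\<close> by (auto simp: d_def field_simps)
    have "compact C" "C \<subseteq> (\<Union>z\<in>C. ball z d)"
      using d(1) by (auto simp: C_def)
    then obtain k where k: "k \<subseteq> C" "finite k" "C \<subseteq> (\<Union>z\<in>k. ball z d)"
      using compactE_image[of C C "\<lambda>z. ball z d"] open_ball by metis
    have "eventually (\<lambda>n. \<forall>z\<in>k. dist (w n z) (h z) < e / 3) sequentially"
    proof (intro eventually_ball_finite ballI tendstoD[OF lim])
      show "z \<in> ball a R" if "z \<in> k" for z
        using that k(1) C sub2 by blast
    qed (use k \<open>e > 0\<close> in auto)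
    then obtain n where n: "\<And>z. z \<in> k \<Longrightarrow> dist (w n z) (h z) < e / 3"
      by (auto simp: eventually_sequentially)
    have "\<bar>w n y - h y\<bar> < e" if y: "y \<in> C" for y
    proof -
      obtain z where z: "z \<in> k" "dist y z < d"
        using k(3) y by (auto simp: dist_commute)
      have in2: "y \<in> ball x (r / 2)" "z \<in> ball x (r / 2)"
        using y z k(1) C by auto
      have "L * dist y z \<le> L * d"
        using z(2) \<open>L \<ge> 0\<close> by (intro mult_left_mono) auto
      then have "\<bar>w n y - w n z\<bar> < e / 3" "\<bar>h y - h z\<bar> < e / 3"
        using Lw[OF in2, of n] Lh[OF in2] d(2) by linarith+
      then show ?thesis
        using n[OF z(1)] unfolding dist_real_def by linarith
    qed
    then show ?thesis by blast
  qed
  have cont: "continuous_on C h"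
  proof (rule lipschitz_on_continuous_on[of L], rule lipschitz_onI)
    show "dist (h y) (h z) \<le> L * dist y z" if "y \<in> C" "z \<in> C" for y z
      using that C by (auto simp only: dist_real_def intro!: Lh)
  qed (rule \<open>L \<ge> 0\<close>)
  have "continuous_on (sphere x (r / 4)) h"
    by (rule continuous_on_subset[OF cont]) (auto simp: C_def)
  moreover have "r / 4 > 0"
    using r by simp
  ultimately obtain H where H: "\<And>y. y \<in> sphere x (r / 4) \<Longrightarrow> H y = h y"
    "continuous_on C H" "dharmonic_on (ball x (r / 4)) H"
    unfolding C_def using dirichlet_ball_poly by metis
  \<comment> \<open>A \<open>w n\<close> within a third of the supposed gap of \<open>h\<close> on
    \<open>C\<close> is, by the maximum principle, also within a third of it of \<open>H\<close>,
    because \<open>H\<close> equals \<open>h\<close> on the sphere. The triangle inequality excludes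
    the gap.\<close>
  have "h y = H y" if y: "y \<in> C" for y
  proof (rule ccontr)
    assume "h y \<noteq> H y"
    then have pos: "\<bar>h y - H y\<bar> / 3 > 0" by simp
    then obtain n where n: "\<And>y'. y' \<in> C \<Longrightarrow> \<bar>w n y' - h y'\<bar> < \<bar>h y - H y\<bar> / 3"
      using unif by blast
    have wC: "dharmonic_on (ball x (r / 2)) (w n)"
      by (rule dharmonic_on_subset[OF w sub2])
    have "\<bar>w n y - H y\<bar> \<le> \<bar>h y - H y\<bar> / 3"
    proof (rule dharmonic_abs_diff_le[where S = "ball x (r / 4)" and u = "w n" and v = H])
      show "dharmonic_on (ball x (r / 4)) (w n)"
        by (rule dharmonic_on_subset[OF wC]) (use r in auto)
      show "continuous_on (closure (ball x (r / 4))) (w n)"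
        using continuous_on_subset[OF dharmonic_on_continuous[OF wC] C] r by (simp add: C_def)
      show "\<bar>w n z - H z\<bar> \<le> \<bar>h y - H y\<bar> / 3" if "z \<in> frontier (ball x (r / 4))" for z
        using n[of z] H(1)[of z] that r by (simp add: C_def less_imp_le)
    qed (use H y r in \<open>auto simp: C_def\<close>)
    moreover have "\<bar>h y - H y\<bar> \<le> \<bar>w n y - H y\<bar> + \<bar>w n y - h y\<bar>"
      using abs_triangle_ineq4[of "w n y - H y" "w n y - h y"] by simp
    moreover have False if "a \<le> d / 3" "b < d / 3" "d \<le> a + b" "d / 3 > 0" for a b d :: real
      using that by linarith
    ultimately show False
      using n[OF y] pos by blast
  qed
  then have "dharmonic_on (ball x (r / 4)) h"
    by (intro dharmonic_on_cong[OF open_ball _ H(3)]) (auto simp: C_def)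
  then show "\<exists>r>0. dharmonic_on (ball x r) h"
    using r by (intro exI[of _ "r / 4"]) auto
qed

section \<open>Perron's method\<close>

text \<open>Continuity takes the place of the upper semicontinuity in \<open>subharmonic_on\<close>:
  barriers are continuous by definition, and maxima and harmonic replacements in a ball stay
  continuous.\<close>

definition dsubharmonic_on :: "'a::euclidean_space set \<Rightarrow> ('a \<Rightarrow> real) \<Rightarrow> bool"
  where "dsubharmonic_on S u \<longleftrightarrow> continuous_on S u \<and>
    (\<forall>a r h. r > 0 \<and> cball a r \<subseteq> S \<and> continuous_on (cball a r) h \<and> dharmonic_on (ball a r) h \<and>
       (\<forall>y\<in>sphere a r. u y \<le> h y) \<longrightarrow> (\<forall>y\<in>cball a r. u y \<le> h y))"

lemma dsubharmonicD:
  assumes "dsubharmonic_on S u" "r > 0" "cball a r \<subseteq> S" "continuous_on (cball a r) h"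
    "dharmonic_on (ball a r) h" "\<And>y. y \<in> sphere a r \<Longrightarrow> u y \<le> h y" "y \<in> cball a r"
  shows "u y \<le> h y"
  using assms unfolding dsubharmonic_on_def by blast

lemma dirichlet_ball:
  fixes f :: "'a::euclidean_space \<Rightarrow> real"
  assumes "continuous_on S f" "cball a r \<subseteq> S" "r > 0"
  obtains u where "\<And>x. x \<in> sphere a r \<Longrightarrow> u x = f x" "continuous_on (cball a r) u" "dharmonic_on (ball a r) u"
proof -
  have "sphere a r \<subseteq> S"
    using assms(2) sphere_cball by blast
  then have "continuous_on (sphere a r) f"
    using assms(1) continuous_on_subset by blast
  then show ?thesis
    using dirichlet_ball_poly[OF _ assms(3)] that by metis
qed

lemma ball_dharmonic_le:
  fixes u v :: "'a::euclidean_space \<Rightarrow> real"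
  assumes "r > 0" "continuous_on (cball a r) u" "dharmonic_on (ball a r) u"
    "continuous_on (cball a r) v" "dharmonic_on (ball a r) v"
    "\<And>z. z \<in> sphere a r \<Longrightarrow> u z \<le> v z" "x \<in> cball a r"
  shows "u x \<le> v x"
  using dharmonic_le[where S = "ball a r" and u = u and v = v and k = 0 and x = x] assms by simp

lemma dharmonic_imp_dsubharmonic:
  fixes u :: "'a::euclidean_space \<Rightarrow> real"
  assumes u: "dharmonic_on S u"
  shows "dsubharmonic_on S u"
  unfolding dsubharmonic_on_def
proof (intro conjI allI impI ballI)
  show "continuous_on S u" by (rule dharmonic_on_continuous[OF u])
  fix a r h y
  assume "0 < r \<and> cball a r \<subseteq> S \<and> continuous_on (cball a r) h \<and> dharmonic_on (ball a r) h \<and>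
    (\<forall>y\<in>sphere a r. u y \<le> h y)" and y: "y \<in> cball a r"
  then have h: "0 < r" "cball a r \<subseteq> S" "continuous_on (cball a r) h" "dharmonic_on (ball a r) h"
    "\<And>y. y \<in> sphere a r \<Longrightarrow> u y \<le> h y" by auto
  have "cball a r \<subseteq> S" "ball a r \<subseteq> S"
    using h(2) ball_subset_cball[of a r] by blast+
  then have "dharmonic_on (ball a r) u" "continuous_on (cball a r) u"
    using dharmonic_on_subset[OF u] dharmonic_on_continuous by blast+
  then show "u y \<le> h y"
    by (intro ball_dharmonic_le[where u = u and v = h, OF h(1) _ _ h(3,4) h(5) y])
qed

lemma dsubharmonic_max:
  assumes "dsubharmonic_on S u" "dsubharmonic_on S v"
  shows "dsubharmonic_on S (\<lambda>x. max (u x) (v x))"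
  unfolding dsubharmonic_on_def
proof (intro conjI allI impI ballI)
  show "continuous_on S (\<lambda>x. max (u x) (v x))"
    using assms by (auto simp: dsubharmonic_on_def intro!: continuous_intros)
  fix a r h y
  assume h: "0 < r \<and> cball a r \<subseteq> S \<and> continuous_on (cball a r) h \<and> dharmonic_on (ball a r) h \<and>
    (\<forall>y\<in>sphere a r. max (u y) (v y) \<le> h y)" and y: "y \<in> cball a r"
  then show "max (u y) (v y) \<le> h y"
    using dsubharmonicD[OF assms(1), of r a h y] dsubharmonicD[OF assms(2), of r a h y] by simp
qed

lemma dsubharmonic_cmult:
  assumes u: "dsubharmonic_on S u" and "c > 0"
  shows "dsubharmonic_on S (\<lambda>x. c * u x)"
  unfolding dsubharmonic_on_def
proof (intro conjI allI impI ballI)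
  show "continuous_on S (\<lambda>x. c * u x)"
    using u by (auto simp: dsubharmonic_on_def intro!: continuous_intros)
  fix a r h y
  assume h: "0 < r \<and> cball a r \<subseteq> S \<and> continuous_on (cball a r) h \<and> dharmonic_on (ball a r) h \<and>
    (\<forall>y\<in>sphere a r. c * u y \<le> h y)" and y: "y \<in> cball a r"
  have "u y \<le> (1 / c) * h y"
    by (rule dsubharmonicD[OF u, of r a])
      (use h y \<open>c > 0\<close> dharmonic_on_cmult[of "ball a r" h "1 / c"] in
        \<open>auto intro!: continuous_intros simp: field_simps\<close>)
  then show "c * u y \<le> h y"
    using \<open>c > 0\<close> by (simp add: field_simps)
qed

text \<open>A harmonic majorant of the sum does not split. Each summand is instead compared with the
  harmonic extension of its own values on the sphere, and the two extensions are added.\<close>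

lemma dsubharmonic_add:
  fixes u v :: "'a::euclidean_space \<Rightarrow> real"
  assumes u: "dsubharmonic_on S u" and v: "dsubharmonic_on S v"
  shows "dsubharmonic_on S (\<lambda>x. u x + v x)"
  unfolding dsubharmonic_on_def
proof (intro conjI allI impI ballI)
  have c: "continuous_on S u" "continuous_on S v"
    using u v by (auto simp: dsubharmonic_on_def)
  then show "continuous_on S (\<lambda>x. u x + v x)"
    by (intro continuous_intros)
  fix a r h y
  assume "0 < r \<and> cball a r \<subseteq> S \<and> continuous_on (cball a r) h \<and> dharmonic_on (ball a r) h \<and>
    (\<forall>y\<in>sphere a r. u y + v y \<le> h y)" and y: "y \<in> cball a r"
  then have r: "r > 0" "cball a r \<subseteq> S" and h: "continuous_on (cball a r) h" "dharmonic_on (ball a r) h"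
    "\<And>y. y \<in> sphere a r \<Longrightarrow> u y + v y \<le> h y" by auto
  obtain h1 where h1: "\<And>x. x \<in> sphere a r \<Longrightarrow> h1 x = u x" "continuous_on (cball a r) h1"
    "dharmonic_on (ball a r) h1"
    using dirichlet_ball[OF c(1) r(2,1)] by metis
  obtain h2 where h2: "\<And>x. x \<in> sphere a r \<Longrightarrow> h2 x = v x" "continuous_on (cball a r) h2"
    "dharmonic_on (ball a r) h2"
    using dirichlet_ball[OF c(2) r(2,1)] by metis
  have "u y \<le> h1 y"
    by (rule dsubharmonicD[OF u r h1(2,3) _ y]) (simp add: h1(1))
  moreover have "v y \<le> h2 y"
    by (rule dsubharmonicD[OF v r h2(2,3) _ y]) (simp add: h2(1))
  moreover have "h1 y + h2 y \<le> h y"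
    by (rule ball_dharmonic_le[where u = "\<lambda>y. h1 y + h2 y" and v = h, OF r(1) _ _ h(1,2) _ y])
      (use h1 h2 h(3) in \<open>auto intro!: continuous_intros dharmonic_on_add\<close>)
  ultimately show "u y + v y \<le> h y" by linarith
qed

text \<open>On a sphere of radius s about \<open>y\<close> the term |z - c|^2 is affine in z. A
  local maximum of the perturbed function would give \<open>u\<close> an affine majorant on the
  sphere whose value at \<open>y\<close> is only u y - e s^2.\<close>

lemma dsubharmonic_no_local_max:
  fixes u :: "'a::euclidean_space \<Rightarrow> real"
  assumes u: "dsubharmonic_on S u"
  shows "no_local_max S u"
  unfolding no_local_max_def
proof (intro ballI allI impI notI)
  fix y c :: 'a and e r :: real
  assume y: "y \<in> S" "e > 0" "r > 0" "ball y r \<subseteq> S"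
    and max: "\<forall>z\<in>ball y r. u z + e * (norm (z - c))\<^sup>2 \<le> u y + e * (norm (y - c))\<^sup>2"
  define s where "s = r / 2"
  have s: "s > 0" "s < r" "cball y s \<subseteq> S"
    using y by (auto simp: s_def)
  define h where "h z = (- 2 * e) *\<^sub>R (y - c) \<bullet> z + (u y - e * s\<^sup>2 + 2 * e * ((y - c) \<bullet> y))" for z
  have "u y \<le> h y"
  proof (rule dsubharmonicD[OF u s(1,3)])
    show "continuous_on (cball y s) h" "dharmonic_on (ball y s) h"
      unfolding h_def by (intro continuous_intros) (rule dharmonic_on_affine)
    fix z assume z: "z \<in> sphere y s"
    have "(norm (z - c))\<^sup>2 = (norm (z - y))\<^sup>2 + (norm (y - c))\<^sup>2 + 2 * ((y - c) \<bullet> (z - y))"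
      by (simp add: power2_norm_eq_inner inner_diff_left inner_diff_right inner_commute)
    then have "(norm (z - c))\<^sup>2 = s\<^sup>2 + (norm (y - c))\<^sup>2 + 2 * ((y - c) \<bullet> (z - y))"
      using z by (simp add: dist_norm norm_minus_commute)
    moreover have "u z + e * (norm (z - c))\<^sup>2 \<le> u y + e * (norm (y - c))\<^sup>2"
      using max z s by simp
    ultimately have "u z + e * (s\<^sup>2 + (norm (y - c))\<^sup>2 + 2 * ((y - c) \<bullet> (z - y))) \<le> u y + e * (norm (y - c))\<^sup>2"
      by simp
    then show "u z \<le> h z"
      by (simp add: h_def inner_diff_right algebra_simps)
  qed (use s in auto)
  moreover have "h y = u y - e * s\<^sup>2"
    by (simp add: h_def)
  moreover have "e * s\<^sup>2 > 0"
    using y s by simp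
  ultimately show False
    by linarith
qed

text \<open>This is the Poisson modification in Perron's method. A test ball may overlap the
  modified ball only partly; since \<open>v\<close> already lies below the test function, only the
  intersection of the two balls needs an argument, and on its boundary \<open>w\<close> lies below
  as well. The set \<open>T\<close> is the closure of the domain in the application, so that the
  lift stays in the Perron family.\<close>

lemma dsubharmonic_lift:
  fixes v :: "'a::euclidean_space \<Rightarrow> real"
  assumes v: "dsubharmonic_on S v" and "open S" and r: "r > 0" "cball a r \<subseteq> S"
    and w: "\<And>x. x \<in> sphere a r \<Longrightarrow> w x = v x" "continuous_on (cball a r) w" "dharmonic_on (ball a r) w"
    and T: "S \<subseteq> T" "continuous_on T v"
  defines "l \<equiv> (\<lambda>x. if x \<in> cball a r then w x else v x)"
  shows "continuous_on T l" "dsubharmonic_on S l" "\<And>x. v x \<le> l x"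
proof -
  have vw: "v x \<le> w x" if "x \<in> cball a r" for x
    by (rule dsubharmonicD[OF v r w(2,3) _ that]) (simp add: w(1))
  then show le: "v x \<le> l x" for x
    by (simp add: l_def)
  have "continuous_on (cball a r \<union> (T - ball a r)) l"
    unfolding l_def
  proof (rule continuous_on_cases_local)
    show "closedin (top_of_set (cball a r \<union> (T - ball a r))) (cball a r)"
      by (rule closedin_subset_trans[of UNIV]) auto
    have "x \<in> T" if "x \<in> cball a r" for x
      using that r(2) T(1) by blast
    then have "(cball a r \<union> (T - ball a r)) - ball a r = T - ball a r"
      by auto
    moreover have "closedin (top_of_set (cball a r \<union> (T - ball a r)))
        ((cball a r \<union> (T - ball a r)) - ball a r)"
      unfolding Diff_eq by (rule closedin_closed_Int) (simp add: closed_Compl)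
    ultimately show "closedin (top_of_set (cball a r \<union> (T - ball a r))) (T - ball a r)"
      by simp
    show "w x = v x" if "x \<in> cball a r \<and> x \<notin> cball a r \<or> x \<in> T - ball a r \<and> x \<in> cball a r" for x
      using that by (auto intro!: w(1))
  qed (use w T continuous_on_subset in \<open>auto intro: continuous_on_subset\<close>)
  moreover have "cball a r \<union> (T - ball a r) = T"
    using r T(1) by auto
  ultimately show c: "continuous_on T l" by simp
  show "dsubharmonic_on S l"
    unfolding dsubharmonic_on_def
  proof (intro conjI allI impI ballI)
    show "continuous_on S l"
      by (rule continuous_on_subset[OF c T(1)])
    fix a' r' h y
    assume "0 < r' \<and> cball a' r' \<subseteq> S \<and> continuous_on (cball a' r') h \<and> dharmonic_on (ball a' r') h \<and>
      (\<forall>y\<in>sphere a' r'. l y \<le> h y)" and y: "y \<in> cball a' r'"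
    then have r': "r' > 0" "cball a' r' \<subseteq> S" and h: "continuous_on (cball a' r') h"
      "dharmonic_on (ball a' r') h" and lh: "\<And>y. y \<in> sphere a' r' \<Longrightarrow> l y \<le> h y" by auto
    have vh: "v x \<le> h x" if x: "x \<in> cball a' r'" for x
      by (rule dsubharmonicD[OF v r' h _ x]) (use lh le order_trans in blast)
    show "l y \<le> h y"
    proof (cases "y \<in> cball a r")
      case False
      then show ?thesis using vh[OF y] by (simp add: l_def)
    next
      case True
      have wh: "w z \<le> h z" if z: "z \<in> cball a r" "z \<in> cball a' r'" "z \<in> sphere a r \<or> z \<in> sphere a' r'" for z
        using z(3)
      proof
        assume "z \<in> sphere a r"
        then show ?thesis using w(1) vh z by simp
      next
        assume "z \<in> sphere a' r'"
        then show ?thesis using lh[of z] z(1) by (simp add: l_def)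
      qed
      show ?thesis
      proof (cases "y \<in> ball a r \<inter> ball a' r'")
        case True
        let ?B = "ball a r \<inter> ball a' r'"
        have cl: "closure ?B \<subseteq> cball a r \<inter> cball a' r'"
          by (rule closure_minimal) (auto intro!: closed_Int)
        have "w y \<le> h y + 0"
        proof (rule dharmonic_le[where S = ?B and u = w and v = h])
          show "continuous_on (closure ?B) w" "continuous_on (closure ?B) h"
            using cl w(2) h(1) by (auto intro: continuous_on_subset)
          show "dharmonic_on ?B w" "dharmonic_on ?B h"
            using w(3) h(2) by (auto intro: dharmonic_on_subset)
          show "y \<in> closure ?B"
            using True closure_subset[of ?B] by (rule subsetD[rotated])
          fix z assume "z \<in> frontier ?B"
          then have "z \<in> closure ?B" "z \<notin> ?B"
            by (auto simp: frontier_def interior_open open_Int)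
          then have "z \<in> cball a r" "z \<in> cball a' r'" "z \<in> sphere a r \<or> z \<in> sphere a' r'"
            using cl by auto
          then show "w z \<le> h z + 0"
            using wh by simp
        qed (auto simp: open_Int)
        then show ?thesis
          using True by (simp add: l_def)
      next
        case False
        then have "y \<in> sphere a r \<or> y \<in> sphere a' r'"
          using True y by auto
        then show ?thesis
          using wh[OF True y] True by (simp add: l_def)
      qed
    qed
  qed
qed

section \<open>The Perron solution and its boundary values\<close>

definition perron_family :: "'a::euclidean_space set \<Rightarrow> ('a \<Rightarrow> real) \<Rightarrow> ('a \<Rightarrow> real) set"
  where "perron_family D f = {v. continuous_on (closure D) v \<and> dsubharmonic_on D v \<and>
    (\<forall>z\<in>frontier D. v z \<le> f z)}"

definition perron :: "'a::euclidean_space set \<Rightarrow> ('a \<Rightarrow> real) \<Rightarrow> 'a \<Rightarrow> real"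
  where "perron D f x = (SUP v\<in>perron_family D f. v x)"

lemma perron_family_max:
  "u \<in> perron_family D f \<Longrightarrow> v \<in> perron_family D f \<Longrightarrow> (\<lambda>x. max (u x) (v x)) \<in> perron_family D f"
  by (auto simp: perron_family_def intro!: continuous_intros dsubharmonic_max)

locale perron_setup =
  fixes D :: "'a::euclidean_space set" and f :: "'a \<Rightarrow> real" and M :: real
  assumes op: "open D" and bd: "bounded D" and fM: "\<And>z. z \<in> frontier D \<Longrightarrow> \<bar>f z\<bar> \<le> M"
begin

lemma const_in_family: "(\<lambda>x. - M) \<in> perron_family D f"
  using fM by (force simp: perron_family_def intro: dharmonic_imp_dsubharmonic dharmonic_on_const)

lemma family_le:
  assumes v: "v \<in> perron_family D f" and x: "x \<in> closure D"
  shows "v x \<le> M"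
proof (rule maximum_principle[OF op bd _ _ _ x])
  show "v z \<le> M" if z: "z \<in> frontier D" for z
    using v z fM[OF z] abs_ge_self[of "f z"] by (fastforce simp: perron_family_def)
qed (use v in \<open>auto simp: perron_family_def intro: dsubharmonic_no_local_max\<close>)

lemma le_perron: "v \<in> perron_family D f \<Longrightarrow> x \<in> closure D \<Longrightarrow> v x \<le> perron D f x"
  unfolding perron_def using family_le by (intro cSUP_upper) (auto intro!: bdd_aboveI2)

lemma perron_le: "(\<And>v. v \<in> perron_family D f \<Longrightarrow> v x \<le> c) \<Longrightarrow> perron D f x \<le> c"
  unfolding perron_def using const_in_family by (intro cSUP_least) auto

lemma perron_approx:
  assumes "x \<in> closure D" "e > 0"
  shows "\<exists>v\<in>perron_family D f. v x > perron D f x - e"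
proof (rule ccontr)
  assume "\<not> ?thesis"
  then have "perron D f x \<le> perron D f x - e"
    by (intro perron_le) force
  then show False using assms(2) by simp
qed

text \<open>Prescribing the values on a countable set that contains a dense one replaces Harnack's
  inequality in the proof that the Perron function is harmonic.\<close>

lemma perron_countable:
  assumes a: "cball a r \<subseteq> D" "r > 0" and Q: "countable Q" "Q \<noteq> {}" "Q \<subseteq> ball a r"
  shows "\<exists>h. dharmonic_on (ball a r) h \<and> (\<forall>q\<in>Q. h q = perron D f q)"
proof -
  have D: "D \<subseteq> closure D" by (rule closure_subset)
  define q where "q = from_nat_into Q"
  have q: "q i \<in> Q" "range q = Q" for i
    using Q by (auto simp: q_def from_nat_into range_from_nat_into)
  have "\<exists>v\<in>perron_family D f. v (q i) > perron D f (q i) - inverse (Suc j)" for i j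
  proof (rule perron_approx)
    show "q i \<in> closure D"
      using q(1)[of i] Q(3) a D ball_subset_cball[of a r] by blast
  qed simp
  then obtain v where v: "\<And>i j. v i j \<in> perron_family D f"
    "\<And>i j. v i j (q i) > perron D f (q i) - inverse (Suc j)"
    by metis
  \<comment> \<open>Running maxima along the enumeration of all pairs (i, j): the sequence increases
    and eventually dominates every \<open>v i j\<close>, while each member stays in the
    family.\<close>
  define V where "V n = rec_nat (\<lambda>x. - M) (\<lambda>k g x. max (g x) (case prod_decode k of (i, j) \<Rightarrow> v i j x)) n" for n
  have V_Suc: "V (Suc k) x = max (V k x) (case prod_decode k of (i, j) \<Rightarrow> v i j x)" for k x
    by (simp add: V_def)
  have VF: "V n \<in> perron_family D f" for n
  proof (induction n)
    case 0
    then show ?case using const_in_family by (simp add: V_def)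
  next
    case (Suc k)
    have "V (Suc k) = (\<lambda>x. max (V k x) (v (fst (prod_decode k)) (snd (prod_decode k)) x))"
      by (rule ext) (simp add: V_Suc split: prod.split)
    then show ?case using perron_family_max[OF Suc v(1)] by simp
  qed
  have Vc: "continuous_on (closure D) (V n)" and Vs: "dsubharmonic_on D (V n)" for n
    using VF[of n] by (auto simp: perron_family_def)
  have Vge: "- M \<le> V n x" for n x
    by (induction n) (auto simp: V_def)
  have sub: "cball a r \<subseteq> closure D" "ball a r \<subseteq> closure D"
    using a D ball_subset_cball[of a r] by blast+
  have "\<exists>w. (\<forall>x\<in>sphere a r. w x = V n x) \<and> continuous_on (cball a r) w \<and> dharmonic_on (ball a r) w" for n
    using dirichlet_ball[OF Vc[of n] sub(1) a(2)] by metis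
  then obtain W where W: "\<And>n x. x \<in> sphere a r \<Longrightarrow> W n x = V n x"
    "\<And>n. continuous_on (cball a r) (W n)" "\<And>n. dharmonic_on (ball a r) (W n)"
    by metis
  note lift = dsubharmonic_lift[OF Vs op a(2,1) W D Vc]
  have LF: "(\<lambda>x. if x \<in> cball a r then W n x else V n x) \<in> perron_family D f" for n
  proof -
    have "z \<notin> cball a r" if "z \<in> frontier D" for z
      using that a op by (auto simp: frontier_def interior_open)
    then show ?thesis
      using lift(1,2) VF[of n] by (auto simp: perron_family_def)
  qed
  have Wle: "W n x \<le> perron D f x" if "x \<in> cball a r" for n x
    using le_perron[OF LF[of n], of x] that sub by auto
  have VW: "V n x \<le> W n x" if "x \<in> cball a r" for n x
    using lift(3)[of n x] that by simp
  have mono: "W n x \<le> W (Suc n) x" if "x \<in> cball a r" for n x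
    by (rule ball_dharmonic_le[OF a(2) W(2,3) W(2,3) _ that]) (simp add: W(1) V_Suc)
  have WM: "\<bar>W n x\<bar> \<le> M" if x: "x \<in> cball a r" for n x
  proof -
    have "W n x \<le> M"
      using family_le[OF LF[of n], of x] x sub by auto
    then show ?thesis
      using VW[OF x, of n] Vge[of n x] by linarith
  qed
  have inc: "incseq (\<lambda>n. W n x)" if "x \<in> cball a r" for x
    using mono[OF that] by (simp add: incseq_Suc_iff)
  have "\<exists>l. (\<lambda>n. W n x) \<longlonglongrightarrow> l" if x: "x \<in> cball a r" for x
    using WM[OF x] by (intro exI) (rule LIMSEQ_incseq_SUP[OF bdd_aboveI2[of _ _ M] inc[OF x]], use abs_le_D1 in blast)
  then obtain h where h: "\<And>x. x \<in> cball a r \<Longrightarrow> (\<lambda>n. W n x) \<longlonglongrightarrow> h x"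
    by metis
  have "dharmonic_on (ball a r) h"
    by (rule dharmonic_bounded_limit[where w = W and M = M]) (use WM h W(3) in auto)
  moreover have "h x = perron D f x" if xQ: "x \<in> Q" for x
  proof (rule antisym)
    have x: "x \<in> cball a r" using xQ Q by auto
    show "h x \<le> perron D f x"
      by (rule LIMSEQ_le_const2[OF h[OF x]]) (use Wle[OF x] in auto)
    obtain i where i: "x = q i"
      using xQ q(2) by auto
    show "perron D f x \<le> h x"
    proof (rule field_le_epsilon)
      fix e :: real assume "e > 0"
      then obtain j where j: "inverse (real (Suc j)) < e"
        using reals_Archimedean by blast
      define k where "k = prod_encode (i, j)"
      have "v i j x \<le> V (Suc k) x"
        by (simp add: V_Suc k_def)
      also have "\<dots> \<le> W (Suc k) x"
        by (rule VW[OF x])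
      also have "\<dots> \<le> h x"
        by (rule incseq_le[OF inc[OF x] h[OF x]])
      finally show "perron D f x \<le> h x + e"
        using v(2)[of i j] j i by simp
    qed
  qed
  ultimately show ?thesis by blast
qed

text \<open>A harmonic \<open>h\<close> agrees with the supremum on a countable dense set. The
  supremum is not yet known to be continuous, so for each further point \<open>y\<close> a second
  harmonic \<open>g\<close> is produced that also matches at \<open>y\<close>; continuity of
  \<open>h\<close> and \<open>g\<close> forces them to be equal.\<close>

lemma perron_dharmonic: "dharmonic_on D (perron D f)"
proof (rule dharmonic_on_local)
  fix a assume "a \<in> D"
  then obtain r where r: "r > 0" "cball a r \<subseteq> D"
    using op open_contains_cball by blast
  obtain C :: "'a set" where C: "countable C" "\<And>X. open X \<Longrightarrow> X \<noteq> {} \<Longrightarrow> \<exists>d\<in>C. d \<in> X"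
    using countable_dense_setE by blast
  define Q where "Q = C \<inter> ball a r"
  have Q: "countable Q" "Q \<noteq> {}" "Q \<subseteq> ball a r"
    using C(1) C(2)[of "ball a r"] r by (auto simp: Q_def)
  obtain h where h: "dharmonic_on (ball a r) h" "\<And>q. q \<in> Q \<Longrightarrow> h q = perron D f q"
    using perron_countable[OF r(2,1) Q] by blast
  have "h y = perron D f y" if y: "y \<in> ball a r" for y
  proof -
    obtain g where g: "dharmonic_on (ball a r) g" "\<And>q. q \<in> insert y Q \<Longrightarrow> g q = perron D f q"
      using perron_countable[OF r(2,1), of "insert y Q"] Q y by auto
    have "continuous_on (ball a r) (\<lambda>x. h x - g x)"
      using h g by (intro continuous_intros dharmonic_on_continuous)
    then have "open (ball a r \<inter> (\<lambda>x. h x - g x) -` (- {0}))"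
      by (intro continuous_open_preimage) auto
    moreover have "\<not> (\<exists>d\<in>C. d \<in> ball a r \<inter> (\<lambda>x. h x - g x) -` (- {0}))"
      using h(2) g(2) by (auto simp: Q_def)
    ultimately have "ball a r \<inter> (\<lambda>x. h x - g x) -` (- {0}) = {}"
      using C(2) by blast
    then have "h y - g y = 0"
      using y by blast
    then show ?thesis using g(2)[of y] by simp
  qed
  then have "dharmonic_on (ball a r) (perron D f)"
    by (intro dharmonic_on_cong[OF open_ball _ h(1)])
  then show "\<exists>r>0. dharmonic_on (ball a r) (perron D f)"
    using r by blast
qed

text \<open>For large \<open>C\<close> the barrier traps the data between f \<open>\<zeta>\<close> -
  d + C b and f \<open>\<zeta>\<close> + d - C b on the frontier. The lower function is itself a
  member of the family; for the upper one the maximum principle is applied to v + C b for every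
  member v.\<close>

lemma perron_boundary:
  assumes cf: "continuous_on (frontier D) f" and z: "\<zeta> \<in> frontier D"
    and b: "continuous_on (closure D) b" "dsubharmonic_on D b" "b \<zeta> = 0"
      "\<And>x. x \<in> closure D - {\<zeta>} \<Longrightarrow> b x < 0"
  shows "(perron D f \<longlongrightarrow> f \<zeta>) (at \<zeta> within D)"
proof (rule tendstoI)
  fix e :: real assume "e > 0"
  define d where "d = e / 2"
  have d: "d > 0" using \<open>e > 0\<close> by (simp add: d_def)
  have D: "D \<subseteq> closure D" "frontier D \<subseteq> closure D"
    by (auto simp: frontier_def closure_subset)
  obtain s where s: "s > 0" "\<And>x. x \<in> frontier D \<Longrightarrow> dist x \<zeta> < s \<Longrightarrow> \<bar>f x - f \<zeta>\<bar> < d"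
    using cf z d unfolding continuous_on_iff dist_real_def by blast
  have "M \<ge> 0" using fM[OF z] by linarith
  have "\<exists>\<beta>>0. \<forall>x\<in>frontier D - ball \<zeta> s. b x \<le> - \<beta>"
  proof (cases "frontier D - ball \<zeta> s = {}")
    case True
    then show ?thesis by (metis empty_iff zero_less_one)
  next
    case False
    have "compact (frontier D - ball \<zeta> s)"
      using compact_frontier_bounded[OF bd] by (intro compact_diff) auto
    moreover have "continuous_on (frontier D - ball \<zeta> s) b"
      using b(1) D by (auto intro: continuous_on_subset)
    ultimately obtain x0 where x0: "x0 \<in> frontier D - ball \<zeta> s"
      "\<And>x. x \<in> frontier D - ball \<zeta> s \<Longrightarrow> b x \<le> b x0"
      using continuous_attains_sup[OF _ False] by blast
    have "x0 \<noteq> \<zeta>" using x0 s by auto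
    then have "b x0 < 0"
      using x0 D by (intro b(4)) auto
    then show ?thesis
      using x0 by (intro exI[of _ "- b x0"]) auto
  qed
  then obtain \<beta> where \<beta>: "\<beta> > 0" "\<And>x. x \<in> frontier D \<Longrightarrow> dist \<zeta> x \<ge> s \<Longrightarrow> b x \<le> - \<beta>"
    by auto
  \<comment> \<open>At distance at least \<open>s\<close> from \<open>\<zeta>\<close> the barrier is
    below - \<open>\<beta>\<close> and must outweigh the largest oscillation 2 M of the data; the
    summand 1 keeps \<open>C\<close> positive when M = 0.\<close>
  define C where "C = 2 * M / \<beta> + 1"
  have C: "C > 0" "C * \<beta> \<ge> 2 * M"
    using \<beta> \<open>M \<ge> 0\<close> by (auto simp: C_def field_simps intro: add_nonneg_pos)
  have b0: "b x \<le> 0" if "x \<in> closure D" for x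
    using b(3) b(4)[of x] that by (cases "x = \<zeta>") auto
  have Cb: "C * b x \<le> - \<bar>f x - f \<zeta>\<bar> + d" if x: "x \<in> frontier D" for x
  proof (cases "dist \<zeta> x \<ge> s")
    case True
    have "C * b x \<le> C * (- \<beta>)"
      using \<beta>(2)[OF x True] C(1) by (intro mult_left_mono) auto
    moreover have "\<bar>f x - f \<zeta>\<bar> \<le> 2 * M"
      using fM[OF x] fM[OF z] by linarith
    ultimately show ?thesis
      using C(2) d by simp
  next
    case False
    then have "\<bar>f x - f \<zeta>\<bar> < d"
      using s(2)[OF x] by (simp add: dist_commute)
    moreover have "C * b x \<le> 0"
    proof (rule mult_nonneg_nonpos)
      show "b x \<le> 0" using x D by (intro b0) auto
    qed (use C(1) in simp)
    ultimately show ?thesis by linarith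
  qed
  have Cs: "dsubharmonic_on D (\<lambda>x. C * b x)" "continuous_on (closure D) (\<lambda>x. C * b x)"
    using b C by (auto intro: dsubharmonic_cmult continuous_intros)
  have low: "f \<zeta> - d + C * b x \<le> perron D f x" if x: "x \<in> D" for x
  proof -
    have "f \<zeta> - d + C * b y \<le> f y" if "y \<in> frontier D" for y
      using Cb[OF that] by linarith
    moreover have "dsubharmonic_on D (\<lambda>x. (f \<zeta> - d) + C * b x)"
      by (rule dsubharmonic_add[OF dharmonic_imp_dsubharmonic[OF dharmonic_on_const] Cs(1)])
    ultimately have "(\<lambda>x. (f \<zeta> - d) + C * b x) \<in> perron_family D f"
      using Cs(2) by (simp add: perron_family_def continuous_on_add)
    from le_perron[OF this] show ?thesis
      using x D by auto
  qed
  have up: "perron D f x \<le> f \<zeta> + d - C * b x" if x: "x \<in> D" for x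
  proof (rule perron_le)
    fix v assume "v \<in> perron_family D f"
    then have v: "continuous_on (closure D) v" "dsubharmonic_on D v" "\<And>z. z \<in> frontier D \<Longrightarrow> v z \<le> f z"
      by (auto simp: perron_family_def)
    have "v x + C * b x \<le> f \<zeta> + d"
    proof (rule maximum_principle[OF op bd, of "\<lambda>x. v x + C * b x"])
      show "no_local_max D (\<lambda>x. v x + C * b x)"
        using v Cs by (intro dsubharmonic_no_local_max dsubharmonic_add)
      show "v z + C * b z \<le> f \<zeta> + d" if "z \<in> frontier D" for z
        using v(3)[OF that] Cb[OF that] by linarith
    qed (use v Cs x D in \<open>auto intro!: continuous_on_add\<close>)
    then show "v x \<le> f \<zeta> + d - C * b x" by simp
  qed
  have "(b \<longlongrightarrow> 0) (at \<zeta> within closure D)"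
  proof -
    have "\<zeta> \<in> closure D" using z D by blast
    then show ?thesis using b(1,3) unfolding continuous_on_def by metis
  qed
  then have "(b \<longlongrightarrow> 0) (at \<zeta> within D)"
    using tendsto_within_subset D(1) by blast
  then have "((\<lambda>x. C * b x) \<longlongrightarrow> 0) (at \<zeta> within D)"
    by (rule tendsto_mult_right_zero)
  from tendstoD[OF this d] have "eventually (\<lambda>x. \<bar>C * b x\<bar> < d) (at \<zeta> within D)"
    by (simp add: dist_real_def)
  moreover have "eventually (\<lambda>x. x \<in> D) (at \<zeta> within D)"
    by (simp add: eventually_at_filter)
  ultimately show "eventually (\<lambda>x. dist (perron D f x) (f \<zeta>) < e) (at \<zeta> within D)"
  proof eventually_elim
    case (elim x)
    then show ?case
      using low[of x] up[of x] by (auto simp: dist_real_def d_def)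
  qed
qed

end

definition solves_dirichlet :: "'a::euclidean_space set \<Rightarrow> ('a \<Rightarrow> real) \<Rightarrow> ('a \<Rightarrow> real) \<Rightarrow> bool"
  where "solves_dirichlet D f u \<longleftrightarrow>
    continuous_on (closure D) u \<and> dharmonic_on D u \<and> (\<forall>z\<in>frontier D. u z = f z)"

theorem dirichlet_problem_solvable:
  fixes D :: "'a::euclidean_space set"
  assumes D: "open D" "bounded D"
    and barrier: "\<And>\<zeta>. \<zeta> \<in> frontier D \<Longrightarrow> \<exists>b. continuous_on (closure D) b \<and> dsubharmonic_on D b \<and>
      b \<zeta> = 0 \<and> (\<forall>x\<in>closure D - {\<zeta>}. b x < 0)"
    and f: "continuous_on (frontier D) f"
  shows "\<exists>u. solves_dirichlet D f u"
proof -
  have "compact (f ` frontier D)"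
    using f compact_frontier_bounded[OF D(2)] by (rule compact_continuous_image)
  then obtain M where M: "\<And>z. z \<in> frontier D \<Longrightarrow> \<bar>f z\<bar> \<le> M"
    using compact_imp_bounded bounded_iff by (metis imageI real_norm_def)
  interpret perron_setup D f M
    by unfold_locales (use D M in auto)
  define u where "u x = (if x \<in> D then perron D f x else f x)" for x
  have fr: "x \<notin> D" if "x \<in> frontier D" for x
    using that D(1) by (simp add: frontier_def interior_open)
  have cl: "closure D = D \<union> frontier D"
    using D(1) by (auto simp: frontier_def interior_open closure_subset[THEN subsetD])
  have "dharmonic_on D u"
    by (rule dharmonic_on_cong[OF D(1) _ perron_dharmonic]) (simp add: u_def)
  moreover have "continuous_on (closure D) u"
    unfolding continuous_on_def
  proof
    fix x assume "x \<in> closure D"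
    then consider "x \<in> D" | "x \<in> frontier D" using cl by auto
    then show "(u \<longlongrightarrow> u x) (at x within closure D)"
    proof cases
      case 1
      then have "isCont u x"
        using dharmonic_on_continuous[OF \<open>dharmonic_on D u\<close>] D(1) by (simp add: continuous_on_eq_continuous_at)
      then show ?thesis
        unfolding isCont_def by (rule tendsto_within_subset) simp
    next
      case 2
      obtain b where b: "continuous_on (closure D) b" "dsubharmonic_on D b" "b x = 0"
        "\<And>y. y \<in> closure D - {x} \<Longrightarrow> b y < 0"
        using barrier[OF 2] by blast
      have "(perron D f \<longlongrightarrow> f x) (at x within D)"
        by (rule perron_boundary[OF f 2 b])
      then have "(u \<longlongrightarrow> f x) (at x within D)"
        by (rule Lim_transform_eventually) (auto simp: u_def eventually_at_filter)
      moreover have "(f \<longlongrightarrow> f x) (at x within frontier D)"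
        using f 2 by (simp add: continuous_on_def)
      then have "(u \<longlongrightarrow> f x) (at x within frontier D)"
        by (rule Lim_transform_eventually) (auto simp: u_def eventually_at_filter fr)
      ultimately have "(u \<longlongrightarrow> f x) (at x within D \<union> frontier D)"
        by (simp add: Lim_within_Un)
      then show ?thesis
        using fr[OF 2] cl by (simp add: u_def)
    qed
  qed
  ultimately show ?thesis
    unfolding solves_dirichlet_def using fr by (intro exI[of _ u]) (auto simp: u_def)
qed

section \<open>Green functions\<close>

lemma sum_Basis_complex_vec:
  "(\<Sum>b\<in>(Basis :: (complex ^ 'n::finite) set). g b) = (\<Sum>j\<in>UNIV. g (axis j 1) + g (axis j \<i>))"
proof -
  have "(\<Sum>b\<in>(Basis :: (complex ^ 'n) set). g b) = (\<Sum>j\<in>UNIV. \<Sum>b\<in>(\<Union>u\<in>Basis. {axis j (u::complex)}). g b)"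
    unfolding Basis_vec_def by (rule sum.UNION_disjoint) (auto simp: axis_eq_axis)
  also have "\<dots> = (\<Sum>j\<in>UNIV. g (axis j 1) + g (axis j \<i>))"
    by (intro sum.cong refl) (simp add: Basis_complex_def axis_eq_axis add.commute)
  finally show ?thesis .
qed

lemma dir_deriv_eq:
  assumes "(f has_derivative f') (at z)"
  shows "dir_deriv v f z = f' v"
proof -
  have "((\<lambda>t::real. z + t *\<^sub>R v) has_derivative (\<lambda>t. t *\<^sub>R v)) (at 0)"
    by (auto intro!: derivative_eq_intros)
  moreover have "(f has_derivative f') (at (z + 0 *\<^sub>R v))"
    using assms by simp
  ultimately have "((\<lambda>t. f (z + t *\<^sub>R v)) has_derivative (\<lambda>t. f' (t *\<^sub>R v))) (at 0)"
    by (rule has_derivative_compose)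
  moreover have "f' (t *\<^sub>R v) = t *\<^sub>R f' v" for t
    using has_derivative_linear[OF assms] by (simp add: linear_scale)
  ultimately show ?thesis
    unfolding dir_deriv_def by (intro vector_derivative_at) (simp add: has_vector_derivative_def)
qed

text \<open>The imaginary part is the commutator of the mixed partial derivatives. A vanishing
  \<open>laplacian\<close> yields lap = 0 from the real part; in the converse direction the
  commutator vanishes by \<open>dharmonic_pd_commute\<close>.\<close>

lemma laplacian_eq_pd:
  fixes u :: "complex ^ 'n::finite \<Rightarrow> real"
  assumes "open S" "z \<in> S"
    and d1: "\<And>x. x \<in> S \<Longrightarrow> u differentiable (at x)"
    and d2: "\<And>v x. x \<in> S \<Longrightarrow> pd v u differentiable (at x)"
  shows "laplacian (\<lambda>w. complex_of_real (u w)) z =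
    Complex (lap u z) (\<Sum>j\<in>UNIV. pd (axis j 1) (pd (axis j \<i>) u) z - pd (axis j \<i>) (pd (axis j 1) u) z)"
proof -
  have ofr: "((\<lambda>w. complex_of_real (g w)) has_derivative (\<lambda>v. complex_of_real (pd v g x))) (at x)"
    if "g differentiable (at x)" for g :: "complex ^ 'n \<Rightarrow> real" and x
    using has_derivative_pd[OF that] by (rule has_derivative_of_real)
  have zb: "dzbar j (\<lambda>w. complex_of_real (u w)) x
      = (complex_of_real (pd (axis j 1) u x) + \<i> * complex_of_real (pd (axis j \<i>) u x)) / 2"
    if "x \<in> S" for x j
    unfolding dzbar_def by (simp only: dir_deriv_eq[OF ofr[OF d1[OF that]]])
  have "dz j (dzbar j (\<lambda>w. complex_of_real (u w))) z
      = Complex (pd (axis j 1) (pd (axis j 1) u) z + pd (axis j \<i>) (pd (axis j \<i>) u) z)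
          (pd (axis j 1) (pd (axis j \<i>) u) z - pd (axis j \<i>) (pd (axis j 1) u) z) / 4" for j
  proof -
    have "((\<lambda>x. complex_of_real (pd (axis j 1) u x) + \<i> * complex_of_real (pd (axis j \<i>) u x))
      has_derivative (\<lambda>v. complex_of_real (pd v (pd (axis j 1) u) z)
        + \<i> * complex_of_real (pd v (pd (axis j \<i>) u) z))) (at z)"
      by (intro has_derivative_add has_derivative_mult_right ofr d2 \<open>z \<in> S\<close>)
    from bounded_linear.has_derivative[OF bounded_linear_divide this, of 2] have "(dzbar j (\<lambda>w. complex_of_real (u w)) has_derivative (\<lambda>v. (complex_of_real (pd v (pd (axis j 1) u) z)
        + \<i> * complex_of_real (pd v (pd (axis j \<i>) u) z)) / 2)) (at z)"
      by (rule has_derivative_transform_within_open[OF _ \<open>open S\<close> \<open>z \<in> S\<close>]) (simp add: zb)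
    note dd = dir_deriv_eq[OF this]
    show ?thesis
      unfolding dz_def dd by (simp add: complex_eq_iff)
  qed
  note dd = this
  show ?thesis
    unfolding laplacian_def lap_def sum_Basis_complex_vec dd
    by (simp add: complex_eq_iff sum_divide_distrib[symmetric])
qed

lemma C2_on_pd:
  fixes u :: "'a::euclidean_space \<Rightarrow> real"
  assumes "C2_on S u" "open S"
  shows "\<And>x. x \<in> S \<Longrightarrow> u differentiable (at x)"
    and "\<And>v x. x \<in> S \<Longrightarrow> pd v u differentiable (at x)"
    and "\<And>v w. continuous_on S (pd v (pd w u))"
proof -
  obtain f' :: "'a \<Rightarrow> 'a \<Rightarrow>\<^sub>L real" and f'' :: "'a \<Rightarrow> 'a \<Rightarrow>\<^sub>L ('a \<Rightarrow>\<^sub>L real)" where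
    f': "\<And>x. x \<in> S \<Longrightarrow> (u has_derivative blinfun_apply (f' x)) (at x)"
    and f'': "\<And>x. x \<in> S \<Longrightarrow> (f' has_derivative blinfun_apply (f'' x)) (at x)" and c: "continuous_on S f''"
    using assms(1) unfolding C2_on_def by blast
  show "u differentiable (at x)" if "x \<in> S" for x
    using f'[OF that] by (auto simp: differentiable_def)
  have D: "(pd v u has_derivative (\<lambda>h. blinfun_apply (blinfun_apply (f'' x) h) v)) (at x)" if "x \<in> S" for v x
  proof -
    have "((\<lambda>x. blinfun_apply (f' x) v) has_derivative (\<lambda>h. blinfun_apply (blinfun_apply (f'' x) h) v)) (at x)"
      using bounded_linear.has_derivative[OF blinfun.bounded_linear_left f''[OF that], of v] by simp
    then show ?thesis
      by (rule has_derivative_transform_within_open[OF _ \<open>open S\<close> that]) (simp add: pd_eq[OF f'])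
  qed
  then show "pd v u differentiable (at x)" if "x \<in> S" for v x
    using that by (auto simp: differentiable_def)
  have "continuous_on S (\<lambda>x. blinfun_apply (blinfun_apply (f'' x) v) w)" for v w
    by (intro continuous_intros c)
  then show "continuous_on S (pd v (pd w u))" for v w
    by (rule continuous_on_eq) (simp add: pd_eq[OF D])
qed

lemma harmonic_on_imp_dharmonic:
  fixes u :: "complex ^ 'n::finite \<Rightarrow> real"
  assumes "harmonic_on S u" "open S"
  shows "dharmonic_on S u"
proof -
  have C2: "C2_on S u" and l: "\<And>z. z \<in> S \<Longrightarrow> laplacian (\<lambda>w. complex_of_real (u w)) z = 0"
    using assms(1) by (auto simp: harmonic_on_def)
  note D = C2_on_pd[OF C2 assms(2)]
  show ?thesis
  proof (rule dharmonic_if_laplacian_zero[OF assms(2)])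
    show "lap u z = 0" if "z \<in> S" for z
      using laplacian_eq_pd[OF assms(2) that D(1,2)] l[OF that] by (simp add: complex_eq_iff)
  qed (use D in auto)
qed

lemma dharmonic_imp_C2_on:
  fixes u :: "'a::euclidean_space \<Rightarrow> real"
  assumes u: "dharmonic_on S u" "open S"
  shows "C2_on S u"
proof -
  have d: "u differentiable (at x)" and d1: "pd v u differentiable (at x)" if "x \<in> S" for x v
    using dharmonic_differentiable[OF u that] dharmonic_differentiable[OF dharmonic_pd[OF u] u(2) that] by auto
  define f' where "f' x = (\<Sum>b\<in>Basis. pd b u x *\<^sub>R blinfun_inner_left b)" for x
  define f'' where "f'' x = (\<Sum>b\<in>Basis. \<Sum>c\<in>Basis. pd c (pd b u) x *\<^sub>R
    (blinfun_scaleR_left (blinfun_inner_left b) o\<^sub>L blinfun_inner_left c))" for x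
  have "(u has_derivative blinfun_apply (f' x)) (at x)" if "x \<in> S" for x
  proof -
    have "blinfun_apply (f' x) = (\<lambda>v. pd v u x)"
    proof
      fix v
      show "blinfun_apply (f' x) v = pd v u x"
        unfolding pd_Basis_sum[OF d[OF that], of v]
        by (simp add: f'_def blinfun.sum_left blinfun.scaleR_left mult.commute)
    qed
    then show ?thesis
      using has_derivative_pd[OF d[OF that]] by simp
  qed
  moreover have "(f' has_derivative blinfun_apply (f'' x)) (at x)" if x: "x \<in> S" for x
  proof -
    have "(f' has_derivative (\<lambda>h. \<Sum>b\<in>Basis. pd h (pd b u) x *\<^sub>R blinfun_inner_left b)) (at x)"
      unfolding f'_def by (intro has_derivative_sum has_derivative_scaleR_left has_derivative_pd d1 x)
    moreover have "(\<lambda>h. \<Sum>b\<in>Basis. pd h (pd b u) x *\<^sub>R blinfun_inner_left b) = blinfun_apply (f'' x)"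
    proof
      fix h
      show "(\<Sum>b\<in>Basis. pd h (pd b u) x *\<^sub>R blinfun_inner_left b) = blinfun_apply (f'' x) h"
        unfolding pd_Basis_sum[OF d1[OF x], of h]
        by (simp add: f''_def blinfun.sum_left blinfun.scaleR_left scaleR_sum_left mult.commute)
    qed
    ultimately show ?thesis by simp
  qed
  moreover have "continuous_on S f''"
    unfolding f''_def
    by (intro continuous_intros dharmonic_on_continuous dharmonic_pd u)
  ultimately show ?thesis
    unfolding C2_on_def by blast
qed

lemma dharmonic_imp_harmonic_on:
  fixes u :: "complex ^ 'n::finite \<Rightarrow> real"
  assumes u: "dharmonic_on S u" "open S"
  shows "harmonic_on S u"
  unfolding harmonic_on_def
proof (intro conjI ballI)
  show "C2_on S u" by (rule dharmonic_imp_C2_on[OF u])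
  fix z assume z: "z \<in> S"
  show "laplacian (\<lambda>w. complex_of_real (u w)) z = 0"
    using laplacian_eq_pd[OF u(2) z dharmonic_differentiable[OF u]
        dharmonic_differentiable[OF dharmonic_pd[OF u] u(2)]]
      dharmonic_lap[OF u z] dharmonic_pd_commute[OF u z]
    by (simp add: complex_eq_iff)
qed

lemma subharmonic_on_imp_dsubharmonic:
  assumes "subharmonic_on S u" "continuous_on S u"
  shows "dsubharmonic_on S u"
  unfolding dsubharmonic_on_def
proof (intro conjI allI impI assms(2))
  fix a r h
  assume h: "0 < r \<and> cball a r \<subseteq> S \<and> continuous_on (cball a r) h \<and> dharmonic_on (ball a r) h \<and>
    (\<forall>y\<in>sphere a r. u y \<le> h y)"
  then have "harmonic_on (ball a r) h"
    by (intro dharmonic_imp_harmonic_on) auto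
  then show "\<forall>y\<in>cball a r. u y \<le> h y"
    using h assms(1) unfolding subharmonic_on_def by blast
qed

lemma regular_domain_solvable:
  assumes "regular_domain D" "bounded D" "continuous_on (frontier D) f"
  shows "\<exists>u. solves_dirichlet D f u"
proof (rule dirichlet_problem_solvable[OF _ assms(2) _ assms(3)])
  show "open D"
    using assms(1) by (simp add: regular_domain_def)
  fix \<zeta> assume "\<zeta> \<in> frontier D"
  then obtain b where b: "continuous_on (closure D) b" "subharmonic_on D b" "b \<zeta> = 0"
    "\<forall>z\<in>closure D - {\<zeta>}. b z < 0"
    using assms(1) unfolding regular_domain_def barrier_at_def by blast
  have "dsubharmonic_on D b"
    using b(2) continuous_on_subset[OF b(1) closure_subset] by (rule subharmonic_on_imp_dsubharmonic)
  then show "\<exists>b. continuous_on (closure D) b \<and> dsubharmonic_on D b \<and> b \<zeta> = 0 \<and> (\<forall>x\<in>closure D - {\<zeta>}. b x < 0)"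
    using b by blast
qed

section \<open>The Newtonian kernel\<close>

text \<open>This is |y|^(-2 k), the fundamental solution up to a constant in real dimension 2 k + 2,
  so k = n - 1. The inner product avoids square roots. For k > 0 its value at the origin is inverse
  0 = 0, which matches \<open>pole_term\<close> at its pole.\<close>

definition newton :: "nat \<Rightarrow> 'a::real_inner \<Rightarrow> real"
  where "newton k y = inverse ((y \<bullet> y) ^ k)"

lemma pole_term_eq_newton:
  fixes p :: "complex ^ 'n::finite"
  assumes "CARD('n) > 1"
  shows "pole_term p z = newton (CARD('n) - 1) (z - p)"
proof -
  have "nat (2 * int CARD('n) - 2) = 2 * (CARD('n) - 1)"
    using assms by (simp add: nat_diff_distrib')
  then show ?thesis
    using assms by (simp add: pole_term_def newton_def power_int_def power_mult power_inverse
        power2_norm_eq_inner)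
qed

lemma newton_minus: "newton k (- y) = newton k y"
  by (simp add: newton_def)

lemma newton_scale: "newton k (c *\<^sub>R y) = inverse (c ^ (2 * k)) * newton k y"
  by (simp add: newton_def power_mult_distrib power_mult power2_eq_square mult.assoc[symmetric])

lemma newton_nonneg: "newton k y \<ge> 0"
  by (simp add: newton_def)

lemma newton_le:
  assumes "c > 0" "norm y \<ge> c"
  shows "newton k y \<le> inverse (c ^ (2 * k))"
proof -
  have "c ^ (2 * k) \<le> (norm y) ^ (2 * k)"
    using assms by (intro power_mono) auto
  also have "\<dots> = (y \<bullet> y) ^ k"
    by (simp add: power_mult power2_norm_eq_inner)
  finally show ?thesis
    using assms by (simp add: newton_def le_imp_inverse_le)
qed

lemma newton_has_derivative:
  assumes "y \<noteq> 0"
  shows "(newton k has_derivative (\<lambda>v. - 2 * real k * (y \<bullet> v) * newton (Suc k) y)) (at y)"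
proof -
  have "((\<lambda>y. y \<bullet> y) has_derivative (\<lambda>v. 2 * (y \<bullet> v))) (at y)"
    by (auto intro!: derivative_eq_intros simp: inner_commute)
  moreover have "((\<lambda>s. inverse (s ^ k)) has_derivative (\<lambda>h. h * (- (real k * inverse ((y \<bullet> y) ^ Suc k))))) (at (y \<bullet> y))"
    (is "(?g has_derivative _) _")
  proof -
    have "(?g has_real_derivative (- (real k * inverse ((y \<bullet> y) ^ Suc k)))) (at (y \<bullet> y))"
      using DERIV_power[OF DERIV_inverse[of "y \<bullet> y"], of k] assms
      by (cases k) (simp_all add: power2_eq_square power_inverse mult.assoc)
    then show ?thesis
      unfolding has_field_derivative_def mult_commute_abs .
  qed
  ultimately have "((\<lambda>y. inverse ((y \<bullet> y) ^ k)) has_derivative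
      (\<lambda>v. (2 * (y \<bullet> v)) * (- (real k * inverse ((y \<bullet> y) ^ Suc k))))) (at y)"
    by (rule has_derivative_compose)
  moreover have "(\<lambda>v. (2 * (y \<bullet> v)) * (- (real k * inverse ((y \<bullet> y) ^ Suc k))))
      = (\<lambda>v. - 2 * real k * (y \<bullet> v) * newton (Suc k) y)"
    by (simp add: fun_eq_iff newton_def)
  ultimately show ?thesis
    unfolding newton_def[abs_def] by simp
qed

lemma newton_continuous_on: "0 \<notin> S \<Longrightarrow> continuous_on S (newton k)"
  unfolding newton_def[abs_def] by (intro continuous_intros) auto

text \<open>In dimension m the Laplacian of |x|^(-2 k) is 2 k (2 k + 2 - m) |x|^(-2 k - 2).\<close>

lemma newton_dharmonic:
  assumes "DIM('a) = 2 * k + 2"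
  shows "dharmonic_on (- {0::'a::euclidean_space}) (newton k)"
proof (rule dharmonic_if_laplacian_zero)
  show "open (- {0::'a})" by auto
  show "newton k differentiable (at x)" if "x \<in> - {0}" for x :: 'a
    using newton_has_derivative[of x k] that by (auto simp: differentiable_def)
  have p1: "pd b (newton k) x = - 2 * real k * (x \<bullet> b) * newton (Suc k) x" if "x \<noteq> 0" for x b :: 'a
    by (rule pd_eq[OF newton_has_derivative[OF that]])
  have D2: "(pd b (newton k) has_derivative (\<lambda>v. - 2 * real k * ((x \<bullet> b) *
      (- 2 * real (Suc k) * (x \<bullet> v) * newton (Suc (Suc k)) x) + (v \<bullet> b) * newton (Suc k) x))) (at x)"
    if "x \<noteq> 0" for x b :: 'a
  proof -
    have "((\<lambda>x. - 2 * real k * ((x \<bullet> b) * newton (Suc k) x)) has_derivative (\<lambda>v. - 2 * real k * ((x \<bullet> b) *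
      (- 2 * real (Suc k) * (x \<bullet> v) * newton (Suc (Suc k)) x) + (v \<bullet> b) * newton (Suc k) x))) (at x)"
      by (intro has_derivative_mult_right has_derivative_mult newton_has_derivative that
          bounded_linear_imp_has_derivative bounded_linear_inner_left)
    then show ?thesis
      by (rule has_derivative_transform_within_open[where s = "- {0}"]) (use that p1 in auto)
  qed
  then show "pd b (newton k) differentiable (at x)" if "x \<in> - {0}" for x b :: 'a
    using that by (auto simp: differentiable_def)
  have p2: "pd b (pd b (newton k)) x = - 2 * real k *
      ((x \<bullet> b) * (- 2 * real (Suc k) * (x \<bullet> b) * newton (Suc (Suc k)) x) + newton (Suc k) x)"
    if "x \<noteq> 0" "b \<in> Basis" for x b :: 'a
    using pd_eq[OF D2[OF that(1), of b], of b] that by simp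
  show "continuous_on (- {0}) (pd b (pd b (newton k)))" if "b \<in> Basis" for b :: 'a
  proof (rule continuous_on_eq)
    show "continuous_on (- {0}) (\<lambda>x. - 2 * real k *
      ((x \<bullet> b) * (- 2 * real (Suc k) * (x \<bullet> b) * newton (Suc (Suc k)) x) + newton (Suc k) x))"
      by (intro continuous_intros newton_continuous_on) auto
  qed (use p2 that in simp)
  fix x :: 'a assume "x \<in> - {0}"
  then have x: "x \<noteq> 0" by simp
  have "lap (newton k) x = (\<Sum>b\<in>Basis. 4 * real k * real (Suc k) * newton (Suc (Suc k)) x * ((x \<bullet> b) * (x \<bullet> b))
      - 2 * real k * newton (Suc k) x)"
    unfolding lap_def using x by (intro sum.cong refl) (simp add: p2 algebra_simps)
  also have "\<dots> = 4 * real k * real (Suc k) * newton (Suc (Suc k)) x * (x \<bullet> x)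
      - real DIM('a) * (2 * real k * newton (Suc k) x)"
    unfolding sum_subtractf euclidean_inner[of x x] sum_distrib_left by simp
  also have "newton (Suc (Suc k)) x * (x \<bullet> x) = newton (Suc k) x"
    using x by (simp add: newton_def)
  then have "4 * real k * real (Suc k) * newton (Suc (Suc k)) x * (x \<bullet> x)
      = 4 * real k * real (Suc k) * newton (Suc k) x"
    by (simp only: mult.assoc)
  finally show "lap (newton k) x = 0"
    using assms by (simp add: algebra_simps)
qed

lemma newton_dharmonic_shift:
  assumes "DIM('a) = 2 * k + 2" "p \<notin> S"
  shows "dharmonic_on S (\<lambda>z::'a::euclidean_space. newton k (z - p))"
  using dharmonic_on_subset[OF dharmonic_on_translate[OF newton_dharmonic[OF assms(1)], of "- p"], of S] assms(2)
  by auto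

section \<open>Uniqueness of Green functions and formulas for the Robin function\<close>

text \<open>One inequality is enough, by symmetry. The poles cancel in the difference, which extends
  harmonically over \<open>p\<close>; its positive superlevel sets are compact because it tends to 0
  at the frontier and, for unbounded \<open>\<Omega>\<close>, at infinity.\<close>

lemma is_green_unique:
  fixes \<Omega> :: "(complex ^ 'n::finite) set"
  assumes "open \<Omega>" "p \<in> \<Omega>" and G: "is_green \<Omega> p G" and H: "is_green \<Omega> p H" and z: "z \<in> \<Omega> - {p}"
  shows "G z \<le> H z"
proof -
  obtain r1 g where g: "r1 > 0" "harmonic_on (ball p r1) g" "\<And>z. z \<in> ball p r1 - {p} \<Longrightarrow> g z = G z - pole_term p z"
    using G unfolding is_green_def by blast
  obtain r2 h where h: "r2 > 0" "harmonic_on (ball p r2) h" "\<And>z. z \<in> ball p r2 - {p} \<Longrightarrow> h z = H z - pole_term p z"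
    using H unfolding is_green_def by blast
  \<comment> \<open>The value at \<open>p\<close> comes from the two regular parts, which removes
    the singularity.\<close>
  define d where "d z = (if z = p then g p - h p else G z - H z)" for z
  have op: "open (\<Omega> - {p})" using assms(1) by auto
  have "dharmonic_on (\<Omega> - {p}) (\<lambda>z. G z - H z)"
    using G H op by (intro dharmonic_on_diff harmonic_on_imp_dharmonic) (auto simp: is_green_def)
  then have d1: "dharmonic_on (\<Omega> - {p}) d"
    by (rule dharmonic_on_cong[OF op, rotated]) (simp add: d_def)
  define r where "r = min r1 r2"
  have r: "r > 0" "ball p r \<subseteq> ball p r1" "ball p r \<subseteq> ball p r2"
    using g(1) h(1) by (auto simp: r_def)
  have "dharmonic_on (ball p r) g" "dharmonic_on (ball p r) h"
    using dharmonic_on_subset[OF harmonic_on_imp_dharmonic[OF g(2)] r(2)]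
      dharmonic_on_subset[OF harmonic_on_imp_dharmonic[OF h(2)] r(3)] by auto
  then have "dharmonic_on (ball p r) (\<lambda>z. g z - h z)"
    by (rule dharmonic_on_diff)
  then have d2: "dharmonic_on (ball p r) d"
    by (rule dharmonic_on_cong[OF open_ball, rotated]) (auto simp: d_def r_def g(3) h(3))
  have d: "dharmonic_on \<Omega> d"
  proof (rule dharmonic_on_local)
    fix x assume "x \<in> \<Omega>"
    show "\<exists>s>0. dharmonic_on (ball x s) d"
    proof (cases "x = p")
      case False
      then obtain s where "s > 0" "ball x s \<subseteq> \<Omega> - {p}"
        using op \<open>x \<in> \<Omega>\<close> openE[of "\<Omega> - {p}" x] by blast
      then show ?thesis using dharmonic_on_subset[OF d1] by blast
    qed (use d2 r in blast)
  qed
  have fr: "(d \<longlongrightarrow> 0) (at \<zeta> within \<Omega>)" if "\<zeta> \<in> frontier \<Omega>" for \<zeta>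
  proof -
    have "\<zeta> \<noteq> p" using that assms by (auto simp: frontier_def interior_open)
    have "((\<lambda>z. G z - H z) \<longlongrightarrow> 0 - 0) (at \<zeta> within \<Omega>)"
      using G H that by (intro tendsto_diff) (auto simp: is_green_def)
    moreover have "eventually (\<lambda>z. z \<noteq> p) (at \<zeta> within \<Omega>)"
      using \<open>\<zeta> \<noteq> p\<close> by (auto simp: eventually_at_topological intro!: exI[of _ "- {p}"])
    then have "eventually (\<lambda>z. G z - H z = d z) (at \<zeta> within \<Omega>)"
      by eventually_elim (simp add: d_def)
    ultimately show ?thesis
      by (simp add: tendsto_cong)
  qed
  have "compact {z\<in>\<Omega>. d z \<ge> c}" if "c > 0" for c
  proof -
    define K where "K = {z\<in>\<Omega>. d z \<ge> c}"
    have "closed K"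
      unfolding closed_limpt islimpt_def
    proof safe
      fix x assume lim: "\<forall>T. x \<in> T \<longrightarrow> open T \<longrightarrow> (\<exists>y\<in>K. y \<in> T \<and> y \<noteq> x)"
      have "x \<in> closure \<Omega>"
        using lim unfolding closure_iff_nhds_not_empty K_def by blast
      then consider "x \<in> \<Omega>" | "x \<in> frontier \<Omega>"
        using assms(1) by (auto simp: frontier_def interior_open)
      then show "x \<in> K"
      proof cases
        case 1
        show ?thesis
        proof (rule ccontr)
          assume "x \<notin> K"
          then have "d x < c" using 1 by (simp add: K_def)
          have "open (\<Omega> \<inter> d -` {..<c})"
            by (intro continuous_open_preimage dharmonic_on_continuous d assms(1)) auto
          moreover have "x \<in> \<Omega> \<inter> d -` {..<c}"
            using 1 \<open>d x < c\<close> by simp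
          ultimately show False
            using lim[rule_format, of "\<Omega> \<inter> d -` {..<c}"] by (auto simp: K_def)
        qed
      next
        case 2
        have "eventually (\<lambda>z. d z < c) (at x within \<Omega>)"
          using order_tendstoD(2)[OF fr[OF 2] that] .
        then obtain T where "open T" "x \<in> T" "\<And>y. y \<in> T \<Longrightarrow> y \<noteq> x \<Longrightarrow> y \<in> \<Omega> \<Longrightarrow> d y < c"
          unfolding eventually_at_topological by blast
        then show ?thesis
          using lim[rule_format, of T] by (force simp: K_def)
      qed
    qed
    moreover have "bounded K"
    proof (cases "bounded \<Omega>")
      case True
      then show ?thesis by (rule bounded_subset) (auto simp: K_def)
    next
      case False
      have "((\<lambda>z. G z - H z) \<longlongrightarrow> 0 - 0) (inf at_infinity (principal \<Omega>))"
        using G H False by (intro tendsto_diff) (auto simp: is_green_def)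
      then have "eventually (\<lambda>z. G z - H z < c) (inf at_infinity (principal \<Omega>))"
        using that by (intro order_tendstoD(2)) auto
      then obtain B where B: "\<And>z. norm z \<ge> B \<Longrightarrow> z \<in> \<Omega> \<Longrightarrow> G z - H z < c"
        unfolding eventually_inf_principal eventually_at_infinity by blast
      have "K \<subseteq> cball 0 (max B (norm p))"
      proof
        fix x assume "x \<in> K"
        then show "x \<in> cball 0 (max B (norm p))"
          using B[of x] by (cases "x = p"; cases "B \<le> norm x") (auto simp: K_def d_def le_max_iff_disj)
      qed
      then show ?thesis by (meson bounded_cball bounded_subset)
    qed
    ultimately show ?thesis
      unfolding K_def[symmetric] by (simp add: compact_eq_bounded_closed)
  qed
  then have "d z \<le> 0"
    using z by (intro maximum_principle_superlevel[OF assms(1) dharmonic_on_continuous[OF d] dharmonic_no_local_max[OF d]]) auto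
  then show ?thesis
    using z by (simp add: d_def)
qed

text \<open>Uniqueness makes the choice in \<open>green\<close> harmless, so any explicit regular
  part computes the Robin function.\<close>

lemma robin_eq:
  fixes \<Omega> :: "(complex ^ 'n::finite) set"
  assumes "open \<Omega>" "p \<in> \<Omega>" and G: "is_green \<Omega> p (\<lambda>z. pole_term p z - u z)" and u: "isCont u p"
  shows "robin \<Omega> p = - u p"
proof -
  have g: "is_green \<Omega> p (green \<Omega> p)"
    unfolding green_def by (rule someI[of "is_green \<Omega> p", OF G])
  have eq: "green \<Omega> p z = pole_term p z - u z" if "z \<in> \<Omega> - {p}" for z
    by (rule antisym) (rule is_green_unique[OF assms(1,2) g G that], rule is_green_unique[OF assms(1,2) G g that])
  have "((\<lambda>z. green \<Omega> p z - pole_term p z) \<longlongrightarrow> - u p) (at p)"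
  proof (rule Lim_transform_eventually)
    show "((\<lambda>z. - u z) \<longlongrightarrow> - u p) (at p)"
      using u by (intro tendsto_minus) (simp add: isCont_def)
    have "eventually (\<lambda>z. z \<in> \<Omega> - {p}) (at p)"
      using eventually_at_in_open[OF assms(1,2)] by simp
    then show "eventually (\<lambda>z. - u z = green \<Omega> p z - pole_term p z) (at p)"
      by eventually_elim (simp add: eq)
  qed
  then show ?thesis
    unfolding robin_def by (intro tendsto_Lim) auto
qed

lemma robin_eq_dirichlet:
  fixes D :: "(complex ^ 'n::finite) set"
  assumes n: "CARD('n) > 1" and D: "open D" "bounded D" "p \<in> D"
    and u: "solves_dirichlet D (\<lambda>w. newton (CARD('n) - 1) (w - p)) u"
  shows "robin D p = - u p"
proof (rule robin_eq[OF D(1,3)])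
  have u': "continuous_on (closure D) u" "dharmonic_on D u"
    "\<And>z. z \<in> frontier D \<Longrightarrow> u z = newton (CARD('n) - 1) (z - p)"
    using u by (auto simp: solves_dirichlet_def)
  have dim: "DIM(complex ^ 'n) = 2 * (CARD('n) - 1) + 2"
    using n by simp
  show "isCont u p"
    using dharmonic_on_continuous[OF u'(2)] D by (simp add: continuous_on_eq_continuous_at)
  note pole = pole_term_eq_newton[OF n]
  show "is_green D p (\<lambda>z. pole_term p z - u z)"
    unfolding is_green_def
  proof (intro conjI ballI impI)
    show "harmonic_on (D - {p}) (\<lambda>z. pole_term p z - u z)"
      unfolding pole using D u'(2) dim
      by (intro dharmonic_imp_harmonic_on dharmonic_on_diff newton_dharmonic_shift)
        (auto intro: dharmonic_on_subset)
    fix \<zeta> assume z: "\<zeta> \<in> frontier D"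
    then have "\<zeta> \<noteq> p" "\<zeta> \<in> closure D"
      using D by (auto simp: frontier_def interior_open)
    have "(u \<longlongrightarrow> u \<zeta>) (at \<zeta> within closure D)"
      using u'(1) \<open>\<zeta> \<in> closure D\<close> by (simp add: continuous_on_def)
    then have "(u \<longlongrightarrow> u \<zeta>) (at \<zeta> within D)"
      by (rule tendsto_within_subset) (rule closure_subset)
    moreover have "((\<lambda>z. newton (CARD('n) - 1) (z - p)) \<longlongrightarrow> newton (CARD('n) - 1) (\<zeta> - p)) (at \<zeta> within D)"
      unfolding newton_def using \<open>\<zeta> \<noteq> p\<close> by (intro tendsto_intros) auto
    ultimately have "((\<lambda>z. newton (CARD('n) - 1) (z - p) - u z) \<longlongrightarrow> newton (CARD('n) - 1) (\<zeta> - p) - u \<zeta>) (at \<zeta> within D)"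
      by (intro tendsto_diff)
    then show "((\<lambda>z. pole_term p z - u z) \<longlongrightarrow> 0) (at \<zeta> within D)"
      using u'(3)[OF z] by (simp add: pole)
  next
    obtain r where r: "r > 0" "ball p r \<subseteq> D"
      using D openE by blast
    have "harmonic_on (ball p r) (\<lambda>z. - 1 * u z)"
      using dharmonic_on_subset[OF u'(2) r(2)] by (intro dharmonic_imp_harmonic_on dharmonic_on_cmult) auto
    then show "\<exists>r>0. \<exists>h. harmonic_on (ball p r) h \<and> (\<forall>z\<in>ball p r - {p}. h z = pole_term p z - u z - pole_term p z)"
      using r(1) by (intro exI[of _ r] conjI exI[of _ "\<lambda>z. - 1 * u z"]) auto
  qed (use D in simp)
qed

section \<open>Joint harmonicity in the point and the pole\<close>

lemma sum_Basis_prod: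
  "sum f (Basis :: ('a::euclidean_space \<times> 'b::euclidean_space) set)
    = (\<Sum>b\<in>Basis. f (b, 0)) + (\<Sum>b\<in>Basis. f (0, b))"
proof -
  have "inj_on (\<lambda>u. (u::'a, 0::'b)) Basis" "inj_on (\<lambda>u. (0::'a, u::'b)) Basis"
    by (auto intro!: inj_onI)
  then show ?thesis
    unfolding Basis_prod_def by (subst sum.union_disjoint) (auto simp: sum.reindex)
qed

lemma diff_laplacian_prod:
  "diff_laplacian u (x, y) t = diff_laplacian (\<lambda>x. u (x, y)) x t + diff_laplacian (\<lambda>y. u (x, y)) y t"
  by (simp add: diff_laplacian_def sum_Basis_prod add_divide_distrib)

lemma dharmonic_on_prod:
  assumes "continuous_on S u"
    and "\<And>x y. (x, y) \<in> S \<Longrightarrow> (diff_laplacian (\<lambda>x. u (x, y)) x \<longlongrightarrow> 0) (at 0)"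
    and "\<And>x y. (x, y) \<in> S \<Longrightarrow> (diff_laplacian (\<lambda>y. u (x, y)) y \<longlongrightarrow> 0) (at 0)"
  shows "dharmonic_on S u"
  unfolding dharmonic_on_def
proof safe
  fix x y assume xy: "(x, y) \<in> S"
  have "diff_laplacian u (x, y) = (\<lambda>t. diff_laplacian (\<lambda>x. u (x, y)) x t + diff_laplacian (\<lambda>y. u (x, y)) y t)"
    by (rule ext) (rule diff_laplacian_prod)
  then show "(diff_laplacian u (x, y) \<longlongrightarrow> 0) (at 0)"
    using tendsto_add_zero[OF assms(2,3)[OF xy]] by simp
qed (rule assms(1))

section \<open>Dependence of Dirichlet solutions on the pole\<close>

lemma solves_dirichlet_bound:
  fixes u :: "'a::euclidean_space \<Rightarrow> real"
  assumes D: "open D" "bounded D" and u: "solves_dirichlet D f u"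
    and f: "\<And>w. w \<in> frontier D \<Longrightarrow> \<bar>f w\<bar> \<le> e" and z: "z \<in> closure D"
  shows "\<bar>u z\<bar> \<le> e"
proof -
  have "\<bar>u z - 0\<bar> \<le> e"
    by (rule dharmonic_abs_diff_le[where u = u and v = "\<lambda>z. 0", OF D _ _ _ _ _ z])
      (use u f in \<open>auto simp: solves_dirichlet_def intro: dharmonic_on_const\<close>)
  then show ?thesis by simp
qed

lemma solves_dirichlet_add:
  "solves_dirichlet D f u \<Longrightarrow> solves_dirichlet D g v \<Longrightarrow> solves_dirichlet D (\<lambda>x. f x + g x) (\<lambda>x. u x + v x)"
  by (auto simp: solves_dirichlet_def intro!: continuous_on_add dharmonic_on_add)

lemma solves_dirichlet_cmult:
  "solves_dirichlet D f u \<Longrightarrow> solves_dirichlet D (\<lambda>x. c * f x) (\<lambda>x. c * u x)"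
  by (auto simp: solves_dirichlet_def intro!: continuous_on_mult_left dharmonic_on_cmult)

lemma solves_dirichlet_diff:
  "solves_dirichlet D f u \<Longrightarrow> solves_dirichlet D g v \<Longrightarrow> solves_dirichlet D (\<lambda>x. f x - g x) (\<lambda>x. u x - v x)"
  by (auto simp: solves_dirichlet_def intro!: continuous_on_diff dharmonic_on_diff)

lemma solves_dirichlet_sum:
  "finite I \<Longrightarrow> (\<And>i. i \<in> I \<Longrightarrow> solves_dirichlet D (f i) (u i)) \<Longrightarrow>
    solves_dirichlet D (\<lambda>x. \<Sum>i\<in>I. f i x) (\<lambda>x. \<Sum>i\<in>I. u i x)"
proof (induction I rule: finite_induct)
  case empty
  then show ?case by (simp add: solves_dirichlet_def dharmonic_on_const)
qed (auto intro!: solves_dirichlet_add)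

lemma newton_family_near:
  fixes q :: "'a::euclidean_space"
  assumes dim: "DIM('a) = 2 * k + 2" and "d > 0" and w: "w \<notin> ball q (2 * d)"
  shows "dharmonic_on (ball q d) (\<lambda>p. newton k (w - p))"
    and "\<And>p. p \<in> ball q d \<Longrightarrow> \<bar>newton k (w - p)\<bar> \<le> inverse (d ^ (2 * k))"
proof -
  have far: "norm (w - p) \<ge> d" if "p \<in> ball q d" for p
    using w that dist_triangle[of q w p] by (simp add: dist_norm norm_minus_commute)
  have "newton k (w - p) = newton k (p - w)" for p
    using newton_minus[of k "w - p"] by simp
  moreover have "w \<notin> ball q d"
    using w \<open>d > 0\<close> by auto
  ultimately show "dharmonic_on (ball q d) (\<lambda>p. newton k (w - p))"
    using newton_dharmonic_shift[OF dim] by simp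
  show "\<bar>newton k (w - p)\<bar> \<le> inverse (d ^ (2 * k))" if "p \<in> ball q d" for p
    using newton_le[OF \<open>d > 0\<close> far[OF that]] newton_nonneg[of k "w - p"] by simp
qed

text \<open>For fixed z, the second difference of U in the pole is, by linearity, the value at z of
  the Dirichlet solution whose data are the second differences of the kernel. These are O(|t|)
  uniformly on the frontier, hence so is the solution at z. Joint continuity follows in the same way
  from a Lipschitz bound in the pole that is uniform in z.\<close>

lemma newton_solution_dharmonic:
  fixes D :: "'a::euclidean_space set" and U :: "'a \<Rightarrow> 'a \<Rightarrow> real"
  assumes dim: "DIM('a) = 2 * k + 2" and D: "open D" "bounded D"
    and U: "\<And>q. q \<in> D \<Longrightarrow> solves_dirichlet D (\<lambda>w. newton k (w - q)) (U q)"
  shows "dharmonic_on (D \<times> D) (\<lambda>(z, q). U q z)"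
proof -
  have fr: "w \<notin> D" if "w \<in> frontier D" for w
    using that D by (simp add: frontier_def interior_open)
  \<comment> \<open>The doubled radius keeps every frontier point at distance at least
    \<open>d\<close> from all poles in \<open>ball q d\<close>.\<close>
  have rad: "\<exists>d>0. ball q (2 * d) \<subseteq> D" if q: "q \<in> D" for q
  proof -
    obtain e where "e > 0" "ball q e \<subseteq> D"
      using openE[OF D(1) q] by blast
    then show ?thesis by (intro exI[of _ "e / 2"]) auto
  qed
  have cl: "z \<in> closure D" if "z \<in> D" for z
    using that closure_subset by blast
  have dU: "dharmonic_on D (U q)" if "q \<in> D" for q
    using U[OF that] by (simp add: solves_dirichlet_def)
  have slice: "(diff_laplacian (\<lambda>q. U q z) q \<longlongrightarrow> 0) (at 0)" if z: "z \<in> D" and q: "q \<in> D" for z q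
  proof -
    obtain d where d: "d > 0" "ball q (2 * d) \<subseteq> D"
      using rad[OF q] by blast
    define K where "K = 2 * (real DIM('a) + 1)"
    define M where "M = inverse (d ^ (2 * k))"
    \<comment> \<open>This is the constant of \<open>diff_laplacian_bound\<close> for a ball of
      radius \<open>d\<close> and functions bounded by \<open>M\<close>; it does not involve the
      frontier point.\<close>
    define C where "C = real DIM('a) * (real DIM('a) * (K * (K * (K * M / (d / 4)) / (d / 4)) / (d / 4)))"
    have "eventually (\<lambda>t::real. t \<in> ball 0 (d / 4)) (at 0)"
      using d by (intro eventually_at_in_open') auto
    then have "eventually (\<lambda>t. norm (diff_laplacian (\<lambda>q. U q z) q t) \<le> C * \<bar>t\<bar>) (at 0)"
      using eventually_neq_at_within[of 0 0 UNIV]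
    proof eventually_elim
      case (elim t)
      have inD: "q + t *\<^sub>R b \<in> D" "q - t *\<^sub>R b \<in> D" if "b \<in> Basis" for b
        using elim d that by (auto intro!: subsetD[OF d(2)] simp: dist_norm)
      define f where "f b w = newton k (w - (q + t *\<^sub>R b)) + newton k (w - (q - t *\<^sub>R b)) - 2 * newton k (w - q)" for b w
      define v where "v b z = U (q + t *\<^sub>R b) z + U (q - t *\<^sub>R b) z - 2 * U q z" for b z
      have "solves_dirichlet D (f b) (v b)" if "b \<in> Basis" for b
        unfolding f_def v_def
        by (rule solves_dirichlet_diff[OF solves_dirichlet_add[OF U[OF inD(1)[OF that]] U[OF inD(2)[OF that]]]
              solves_dirichlet_cmult[OF U[OF q]]])
      then have "solves_dirichlet D (\<lambda>w. \<Sum>b\<in>Basis. f b w) (\<lambda>z. \<Sum>b\<in>Basis. v b z)"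
        by (rule solves_dirichlet_sum[OF finite_Basis])
      note solves_dirichlet_cmult[OF this, of "1 / t\<^sup>2"]
      moreover have "\<bar>1 / t\<^sup>2 * (\<Sum>b\<in>Basis. f b w)\<bar> \<le> C * \<bar>t\<bar>" if w: "w \<in> frontier D" for w
      proof -
        have "w \<notin> ball q (2 * d)" using fr[OF w] d by auto
        note near = newton_family_near[OF dim d(1) this]
        have "\<bar>diff_laplacian (\<lambda>p. newton k (w - p)) q t\<bar> \<le> C * \<bar>t\<bar>"
          using diff_laplacian_bound[OF near d(1)] elim unfolding C_def K_def M_def
          by (simp add: mult.assoc)
        then show ?thesis
          by (simp add: diff_laplacian_def f_def)
      qed
      ultimately have "\<bar>1 / t\<^sup>2 * (\<Sum>b\<in>Basis. v b z)\<bar> \<le> C * \<bar>t\<bar>"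
        by (rule solves_dirichlet_bound[OF D _ _ cl[OF z]])
      then show ?case
        by (simp add: diff_laplacian_def v_def)
    qed
    moreover have "((\<lambda>t. C * \<bar>t\<bar>) \<longlongrightarrow> 0) (at 0)"
      by (auto intro!: tendsto_eq_intros)
    ultimately show ?thesis
      by (rule Lim_null_comparison)
  qed
  have "continuous_on (D \<times> D) (\<lambda>x. U (snd x) (fst x))"
    unfolding continuous_on_def
  proof safe
    fix z1 q1 assume z1: "z1 \<in> D" and q1: "q1 \<in> D"
    obtain d where d: "d > 0" "ball q1 (2 * d) \<subseteq> D"
      using rad[OF q1] by blast
    define L where "L = real DIM('a) * (2 * (real DIM('a) + 1) * inverse (d ^ (2 * k)) / (d / 2))"
    have sub: "ball q1 (d / 2) \<subseteq> D"
      using d by (intro order_trans[OF _ d(2)]) auto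
    have lip: "\<bar>U q z - U q1 z\<bar> \<le> L * dist q q1" if q: "q \<in> ball q1 (d / 2)" and z: "z \<in> D" for q z
    proof (rule solves_dirichlet_bound[OF D solves_dirichlet_diff[OF U U] _ cl[OF z]])
      show "q \<in> D" using q sub by blast
      fix w assume w: "w \<in> frontier D"
      have "w \<notin> ball q1 (2 * d)" using fr[OF w] d by auto
      note near = newton_family_near[OF dim d(1) this]
      show "\<bar>newton k (w - q) - newton k (w - q1)\<bar> \<le> L * dist q q1"
        unfolding L_def by (rule dharmonic_lipschitz[OF near d(1)]) (use q d in auto)
    qed (rule q1)
    have "((\<lambda>x. U (snd x) (fst x) - U q1 (fst x)) \<longlongrightarrow> 0) (at (z1, q1) within D \<times> D)"
    proof (rule Lim_null_comparison)
      have "eventually (\<lambda>x. x \<in> UNIV \<times> ball q1 (d / 2)) (at (z1, q1) within D \<times> D)"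
        using d by (auto simp: eventually_at_topological intro!: exI[of _ "UNIV \<times> ball q1 (d / 2)"] open_Times)
      moreover have "eventually (\<lambda>x. x \<in> D \<times> D) (at (z1, q1) within D \<times> D)"
        by (simp add: eventually_at_filter)
      ultimately show "eventually (\<lambda>x. norm (U (snd x) (fst x) - U q1 (fst x)) \<le> L * dist (snd x) q1) (at (z1, q1) within D \<times> D)"
        by eventually_elim (auto intro!: lip)
      show "((\<lambda>x. L * dist (snd x) q1) \<longlongrightarrow> 0) (at (z1, q1) within D \<times> D)"
        by (auto intro!: tendsto_eq_intros)
    qed
    moreover have "((\<lambda>x. U q1 (fst x)) \<longlongrightarrow> U q1 z1) (at (z1, q1) within D \<times> D)"
    proof -
      have "isCont (U q1) z1"
        using dharmonic_on_continuous[OF dU[OF q1]] D(1) z1 by (simp add: continuous_on_eq_continuous_at)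
      then show ?thesis
        by (rule isCont_tendsto_compose) (auto intro!: tendsto_eq_intros)
    qed
    ultimately show "((\<lambda>x. U (snd x) (fst x)) \<longlongrightarrow> U (snd (z1, q1)) (fst (z1, q1))) (at (z1, q1) within D \<times> D)"
      using tendsto_add by fastforce
  qed
  then show ?thesis
    using slice dU by (intro dharmonic_on_prod) (auto simp: case_prod_unfold dharmonic_on_def)
qed

section \<open>Mirror images and the half space\<close>

text \<open>The mirror image of \<open>q\<close> in the hyperplane N . z = 1, for a normal vector
  \<open>N\<close> of arbitrary nonzero length.\<close>

definition reflection :: "'a::real_inner \<Rightarrow> 'a \<Rightarrow> 'a"
  where "reflection N q = q + (2 * (1 - N \<bullet> q) / (N \<bullet> N)) *\<^sub>R N"

lemma inner_reflection: "N \<noteq> 0 \<Longrightarrow> N \<bullet> reflection N q = 2 - N \<bullet> q"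
  by (simp add: reflection_def inner_add_right)

text \<open>The exact correction term does three things: its symmetry in \<open>z\<close> and
  \<open>q\<close> turns harmonicity in one variable into harmonicity in the other, its vanishing on
  the mirror identifies the Green function, and its linear dependence on 1 - N . z measures the
  error near the mirror.\<close>

lemma reflection_dist:
  assumes "N \<noteq> 0"
  shows "(z - reflection N q) \<bullet> (z - reflection N q)
    = (z - q) \<bullet> (z - q) + 4 * ((1 - N \<bullet> q) * (1 - N \<bullet> z)) / (N \<bullet> N)"
proof -
  define s where "s = 2 * (1 - N \<bullet> q) / (N \<bullet> N)"
  have s: "s * (N \<bullet> N) = 2 * (1 - N \<bullet> q)"
    using assms by (simp add: s_def)
  have "(z - reflection N q) \<bullet> (z - reflection N q)
      = (z - q) \<bullet> (z - q) - 2 * s * (N \<bullet> z - N \<bullet> q) + s * (s * (N \<bullet> N))"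
    unfolding reflection_def s_def[symmetric]
    by (simp add: inner_add_left inner_add_right inner_diff_left inner_diff_right inner_commute algebra_simps)
  also have "\<dots> = (z - q) \<bullet> (z - q) + 2 * s * (1 - N \<bullet> z)"
    unfolding s by (simp add: algebra_simps)
  finally show ?thesis
    by (simp add: s_def)
qed

lemma newton_reflection_commute:
  assumes "N \<noteq> 0"
  shows "newton k (z - reflection N q) = newton k (q - reflection N z)"
proof -
  have "(z - q) \<bullet> (z - q) = (q - z) \<bullet> (q - z)"
    by (simp add: inner_diff_left inner_diff_right)
  then show ?thesis
    unfolding newton_def reflection_dist[OF assms] by (simp only: mult.commute[of "1 - N \<bullet> q"])
qed

lemma newton_reflection_dharmonic:
  fixes N :: "'a::euclidean_space"
  assumes dim: "DIM('a) = 2 * k + 2" and N: "N \<noteq> 0"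
  shows "dharmonic_on ({z. N \<bullet> z < 1} \<times> {z. N \<bullet> z < 1}) (\<lambda>(z, q). newton k (z - reflection N q))"
proof -
  define H where "H = {z. N \<bullet> z < 1}"
  have ne: "z \<noteq> reflection N q" if "z \<in> H" "q \<in> H" for z q
    using that inner_reflection[OF N, of q] by (auto simp: H_def)
  have s1: "dharmonic_on H (\<lambda>z. newton k (z - reflection N q))" if "q \<in> H" for q
    using ne[OF _ that] by (intro newton_dharmonic_shift[OF dim]) auto
  have "dharmonic_on H (\<lambda>q. newton k (z - reflection N q))" if "z \<in> H" for z
    using s1[OF that] newton_reflection_commute[OF N, of k z] by simp
  moreover have "continuous_on (H \<times> H) (\<lambda>x. newton k (fst x - reflection N (snd x)))"
    unfolding newton_def
  proof (intro continuous_intros)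
    show "\<forall>x\<in>H \<times> H. ((fst x - reflection N (snd x)) \<bullet> (fst x - reflection N (snd x))) ^ k \<noteq> 0"
      using ne by auto
  qed (auto simp: reflection_def N intro!: continuous_intros)
  ultimately show ?thesis
    unfolding H_def[symmetric] using s1
    by (intro dharmonic_on_prod) (auto simp: case_prod_unfold dharmonic_on_def)
qed

lemma newton_tendsto_0:
  assumes "k \<ge> 1"
  shows "((\<lambda>z. newton k (z - p)) \<longlongrightarrow> 0) at_infinity"
proof -
  have "filterlim (\<lambda>z. norm (z - p)) at_top at_infinity"
  proof (rule filterlim_at_top_mono)
    show "filterlim (\<lambda>z. - norm p + norm z) at_top at_infinity"
      by (rule filterlim_tendsto_add_at_top[OF tendsto_const filterlim_norm_at_top])
    show "eventually (\<lambda>z. - norm p + norm z \<le> norm (z - p)) at_infinity"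
      by (intro always_eventually allI) (simp add: norm_triangle_ineq2)
  qed
  then have "filterlim (\<lambda>z. norm (z - p) ^ (2 * k)) at_top at_infinity"
    using assms by (intro filterlim_pow_at_top) auto
  then have "((\<lambda>z. inverse (norm (z - p) ^ (2 * k))) \<longlongrightarrow> 0) at_infinity"
    by (rule tendsto_inverse_0_at_top)
  then show ?thesis
    by (simp add: newton_def power_mult power2_norm_eq_inner)
qed

text \<open>Method of images: the kernel with pole at the mirror image is harmonic in the half
  space, agrees with the original kernel on the hyperplane and decays at infinity.\<close>

lemma robin_halfspace:
  fixes N :: "complex ^ 'n::finite"
  assumes n: "CARD('n) > 1" and N: "N \<noteq> 0" and p: "N \<bullet> p < 1"
  shows "robin {z. N \<bullet> z < 1} p = - newton (CARD('n) - 1) (p - reflection N p)"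
proof (rule robin_eq[where u = "\<lambda>z. newton (CARD('n) - 1) (z - reflection N p)"])
  define k where "k = CARD('n) - 1"
  define H where "H = {z. N \<bullet> z < 1}"
  define u where "u z = newton k (z - reflection N p)" for z
  have k: "k \<ge> 1" using n by (simp add: k_def)
  have dim: "DIM(complex ^ 'n) = 2 * k + 2"
    using n by (simp add: k_def)
  show H: "open {z. N \<bullet> z < 1}" by (rule open_halfspace_lt)
  show "p \<in> {z. N \<bullet> z < 1}" using p by simp
  have refl: "reflection N p \<notin> H"
    using inner_reflection[OF N, of p] p by (simp add: H_def)
  have u: "dharmonic_on H u"
    unfolding u_def by (rule newton_dharmonic_shift[OF dim refl])
  have "isCont u p"
    using dharmonic_on_continuous[OF u] H p by (simp add: continuous_on_eq_continuous_at H_def)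
  then show "isCont (\<lambda>z. newton (CARD('n) - 1) (z - reflection N p)) p"
    by (simp add: u_def[abs_def] k_def)
  note pole = pole_term_eq_newton[OF n]
  have "is_green H p (\<lambda>z. newton k (z - p) - u z)"
    unfolding is_green_def pole k_def[symmetric]
  proof (intro conjI ballI impI)
    show "harmonic_on (H - {p}) (\<lambda>z. newton k (z - p) - u z)"
      using H u by (intro dharmonic_imp_harmonic_on dharmonic_on_diff newton_dharmonic_shift[OF dim])
        (auto intro: dharmonic_on_subset simp: H_def)
  next
    fix \<zeta> assume "\<zeta> \<in> frontier H"
    then have z: "N \<bullet> \<zeta> = 1"
      using N by (simp add: H_def frontier_halfspace_lt)
    then have "\<zeta> \<noteq> p" "\<zeta> \<noteq> reflection N p"
      using p inner_reflection[OF N, of p] by auto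
    then have "((\<lambda>z. newton k (z - p) - u z) \<longlongrightarrow> newton k (\<zeta> - p) - u \<zeta>) (at \<zeta> within H)"
      unfolding newton_def u_def by (intro tendsto_intros) auto
    moreover have "newton k (\<zeta> - p) = u \<zeta>"
      unfolding newton_def u_def reflection_dist[OF N] z by simp
    ultimately show "((\<lambda>z. newton k (z - p) - u z) \<longlongrightarrow> 0) (at \<zeta> within H)"
      by simp
  next
    have "((\<lambda>z. newton k (z - p) - u z) \<longlongrightarrow> 0 - 0) at_infinity"
      unfolding u_def by (intro tendsto_diff newton_tendsto_0 k)
    then show "((\<lambda>z. newton k (z - p) - u z) \<longlongrightarrow> 0) (inf at_infinity (principal H))"
      using tendsto_mono[OF inf_le1] by fastforce
  next
    obtain r where r: "r > 0" "ball p r \<subseteq> H"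
    proof (rule openE)
      show "open H" "p \<in> H" using H p by (simp_all add: H_def)
    qed
    have "harmonic_on (ball p r) (\<lambda>z. - 1 * u z)"
      using dharmonic_on_subset[OF u r(2)] by (intro dharmonic_imp_harmonic_on dharmonic_on_cmult) auto
    then show "\<exists>r>0. \<exists>h. harmonic_on (ball p r) h \<and>
        (\<forall>z\<in>ball p r - {p}. h z = newton k (z - p) - u z - newton k (z - p))"
      using r(1) by (intro exI[of _ r] conjI exI[of _ "\<lambda>z. - 1 * u z"]) auto
  qed
  then show "is_green {z. N \<bullet> z < 1} p (\<lambda>z. pole_term p z - newton (CARD('n) - 1) (z - reflection N p))"
    by (simp add: pole u_def k_def H_def)
qed

section \<open>Derivatives along the diagonal\<close>

text \<open>Wirtinger derivatives of a real function are complex valued, so the iteration has to run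
  over complex functions with harmonic real and imaginary parts.\<close>

definition cdharmonic_on :: "'a::euclidean_space set \<Rightarrow> ('a \<Rightarrow> complex) \<Rightarrow> bool"
  where "cdharmonic_on S F \<longleftrightarrow> dharmonic_on S (\<lambda>x. Re (F x)) \<and> dharmonic_on S (\<lambda>x. Im (F x))"

definition cpd :: "'a \<Rightarrow> ('a::euclidean_space \<Rightarrow> complex) \<Rightarrow> 'a \<Rightarrow> complex"
  where "cpd v F x = Complex (pd v (\<lambda>x. Re (F x)) x) (pd v (\<lambda>x. Im (F x)) x)"

lemma cdharmonic_on_subset: "cdharmonic_on S F \<Longrightarrow> T \<subseteq> S \<Longrightarrow> cdharmonic_on T F"
  unfolding cdharmonic_on_def using dharmonic_on_subset by blast

lemma cdharmonic_on_of_real: "dharmonic_on S u \<Longrightarrow> cdharmonic_on S (\<lambda>x. complex_of_real (u x))"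
  by (simp add: cdharmonic_on_def dharmonic_on_const)

lemma cdharmonic_on_add:
  "cdharmonic_on S F \<Longrightarrow> cdharmonic_on S G \<Longrightarrow> cdharmonic_on S (\<lambda>x. F x + G x)"
  by (simp add: cdharmonic_on_def dharmonic_on_add)

lemma cdharmonic_on_cmult: "cdharmonic_on S F \<Longrightarrow> cdharmonic_on S (\<lambda>x. c * F x)"
  by (auto simp: cdharmonic_on_def intro!: dharmonic_on_add dharmonic_on_diff dharmonic_on_cmult)

lemma cdharmonic_on_cpd: "cdharmonic_on S F \<Longrightarrow> open S \<Longrightarrow> cdharmonic_on S (cpd v F)"
  by (simp add: cdharmonic_on_def cpd_def dharmonic_pd)

lemma cdharmonic_has_derivative:
  assumes "cdharmonic_on S F" "open S" "x \<in> S"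
  shows "(F has_derivative (\<lambda>v. cpd v F x)) (at x)"
proof -
  have "((\<lambda>x. complex_of_real (Re (F x)) + \<i> * complex_of_real (Im (F x))) has_derivative
      (\<lambda>v. complex_of_real (pd v (\<lambda>x. Re (F x)) x) + \<i> * complex_of_real (pd v (\<lambda>x. Im (F x)) x))) (at x)"
    using assms unfolding cdharmonic_on_def
    by (intro has_derivative_add has_derivative_mult_right has_derivative_of_real has_derivative_pd)
      (auto intro: dharmonic_differentiable)
  then show ?thesis
    by (simp add: cpd_def complex_eq[symmetric] Complex_eq)
qed

lemma cpd_diff:
  assumes "cdharmonic_on S F" "cdharmonic_on S G" "open S" "x \<in> S"
  shows "cpd v F x - cpd v G x = cpd v (\<lambda>x. F x - G x) x"
proof -
  have "pd v (\<lambda>x. Re (F x) - Re (G x)) x = pd v (\<lambda>x. Re (F x)) x - pd v (\<lambda>x. Re (G x)) x"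
    "pd v (\<lambda>x. Im (F x) - Im (G x)) x = pd v (\<lambda>x. Im (F x)) x - pd v (\<lambda>x. Im (G x)) x"
    using assms unfolding cdharmonic_on_def
    by (auto intro!: pd_eq has_derivative_diff has_derivative_pd dharmonic_differentiable)
  then show ?thesis
    by (simp add: cpd_def complex_eq_iff)
qed

text \<open>The diagonal direction (b, b) is the sum of the basis vectors (b, 0) and (0, b), and
  each of these obeys the gradient estimate; hence the factor 2.\<close>

lemma pd_diag_bound:
  fixes u :: "'a::euclidean_space \<times> 'a \<Rightarrow> real"
  assumes u: "dharmonic_on (ball 0 r) u" and e: "\<And>x. x \<in> ball 0 r \<Longrightarrow> \<bar>u x\<bar> \<le> e"
    and r: "r > 0" and x: "x \<in> ball 0 (r / 2)" and b: "b \<in> Basis"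
  defines "K \<equiv> 2 * (real DIM('a \<times> 'a) + 1) / (r / 2)"
  shows "\<bar>pd (b, b) u x\<bar> \<le> 2 * (K * e)"
proof -
  have sub: "ball x (r / 2) \<subseteq> ball 0 r"
    using x by (simp add: ball_subset_ball_iff dist_commute)
  have each: "\<bar>pd c u x\<bar> \<le> K * e" if "c \<in> Basis" for c
  proof -
    have "\<bar>pd c u x\<bar> \<le> 2 * (real DIM('a \<times> 'a) + 1) * e / (r / 2)"
      by (rule dharmonic_derivative_bound'[OF dharmonic_on_subset[OF u sub] _ that]) (use sub e r in auto)
    also have "\<dots> = K * e"
      unfolding K_def by (rule times_divide_eq_left[symmetric])
    finally show ?thesis .
  qed
  have "u differentiable (at x)"
    by (rule dharmonic_differentiable[OF u open_ball]) (use x r in auto)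
  then have "pd ((b, 0) + (0, b)) u x = pd (b, 0) u x + pd (0, b) u x"
    by (intro linear_add linear_pd)
  then have "pd (b, b) u x = pd (b, 0) u x + pd (0, b) u x"
    by simp
  moreover have "\<bar>pd (b, 0) u x\<bar> \<le> K * e" "\<bar>pd (0, b) u x\<bar> \<le> K * e"
    using b by (auto intro!: each simp: Basis_prod_def)
  ultimately show ?thesis
    using abs_triangle_ineq[of "pd (b, 0) u x" "pd (0, b) u x"] by linarith
qed

text \<open>The Robin function is not harmonic, but it extends harmonically from the diagonal; this is what
  bounds the derivatives of \<open>f - g\<close> by a multiple of \<open>e\<close>.\<close>

definition diag_close ::
    "real \<Rightarrow> real \<Rightarrow> ('a::euclidean_space \<Rightarrow> complex) \<Rightarrow> ('a \<Rightarrow> complex) \<Rightarrow> bool"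
  where "diag_close r e f g \<longleftrightarrow> (\<exists>F G. cdharmonic_on (ball 0 r) F \<and> cdharmonic_on (ball 0 r) G \<and>
    (\<forall>x\<in>ball 0 r. norm (F x - G x) \<le> e) \<and>
    (\<forall>x. norm (x, x) < r \<longrightarrow> f x = F (x, x) \<and> g x = G (x, x)))"

text \<open>The relation between a function and its rescaled version, in a form that differentiation
  preserves: each derivative multiplies \<open>c\<close> by \<open>d\<close>. The extension
  \<open>F\<close> guarantees that the derivatives exist.\<close>

definition diag_scaled ::
    "real \<Rightarrow> real \<Rightarrow> real \<Rightarrow> 'a \<Rightarrow> ('a::euclidean_space \<Rightarrow> complex) \<Rightarrow> ('a \<Rightarrow> complex) \<Rightarrow> bool"
  where "diag_scaled r c d p f h \<longleftrightarrow> (\<exists>F. cdharmonic_on (ball 0 r) F \<and>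
    (\<forall>x. norm (x, x) < r \<longrightarrow> f x = F (x, x) \<and> f x = of_real c * h (p + d *\<^sub>R x)))"

lemma open_diag_ball: "open {x::'a::real_normed_vector. norm (x, x) < r}"
  by (intro open_Collect_less continuous_intros)

lemma diag_has_derivative:
  fixes F :: "'a::euclidean_space \<times> 'a \<Rightarrow> complex"
  assumes F: "cdharmonic_on (ball 0 r) F" and f: "\<And>x. norm (x, x) < r \<Longrightarrow> f x = F (x, x)"
    and x: "norm (x, x) < r"
  shows "(f has_derivative (\<lambda>v. cpd (v, v) F (x, x))) (at x)"
proof -
  have "(F has_derivative (\<lambda>v. cpd v F (x, x))) (at (x, x))"
    by (rule cdharmonic_has_derivative[OF F open_ball]) (use x in simp)
  moreover have "((\<lambda>x. (x, x)) has_derivative (\<lambda>v. (v, v))) (at x)"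
    by (intro has_derivative_Pair has_derivative_ident)
  ultimately have "((\<lambda>x. F (x, x)) has_derivative (\<lambda>v. cpd (v, v) F (x, x))) (at x)"
    by (rule has_derivative_compose[rotated])
  then show ?thesis
    by (rule has_derivative_transform_within_open[OF _ open_diag_ball[of r]]) (use x f in auto)
qed

section \<open>Wirtinger derivatives of restrictions to the diagonal\<close>

definition wirtinger :: "complex \<Rightarrow> 'n::finite \<Rightarrow> (complex ^ 'n \<Rightarrow> complex) \<Rightarrow> complex ^ 'n \<Rightarrow> complex"
  where "wirtinger s j f z = (dir_deriv (axis j 1) f z + s * dir_deriv (axis j \<i>) f z) / 2"

lemma dz_eq_wirtinger: "dz j = wirtinger (- \<i>) j" and dzbar_eq_wirtinger: "dzbar j = wirtinger \<i> j"
  by (simp_all add: fun_eq_iff dz_def dzbar_def wirtinger_def)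

text \<open>By the chain rule for x |-> (x, x), a Wirtinger derivative of a restriction to the
  diagonal is the restriction of this operator. It has constant coefficients and therefore preserves
  harmonicity.\<close>

definition lift_wirtinger ::
    "complex \<Rightarrow> 'n::finite \<Rightarrow> ((complex ^ 'n) \<times> (complex ^ 'n) \<Rightarrow> complex) \<Rightarrow> (complex ^ 'n) \<times> (complex ^ 'n) \<Rightarrow> complex"
  where "lift_wirtinger s j F x = 1 / 2 * (cpd (axis j 1, axis j 1) F x + s * cpd (axis j \<i>, axis j \<i>) F x)"

lemma cdharmonic_lift_wirtinger:
  "cdharmonic_on S F \<Longrightarrow> open S \<Longrightarrow> cdharmonic_on S (lift_wirtinger s j F)"
  unfolding lift_wirtinger_def[abs_def]
  by (intro cdharmonic_on_cmult cdharmonic_on_add cdharmonic_on_cpd)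

lemma wirtinger_diag:
  fixes F :: "(complex ^ 'n::finite) \<times> (complex ^ 'n) \<Rightarrow> complex"
  assumes "cdharmonic_on (ball 0 r) F" "\<And>x. norm (x, x) < r \<Longrightarrow> f x = F (x, x)" "norm (x, x) < r"
  shows "wirtinger s j f x = lift_wirtinger s j F (x, x)"
proof -
  have "dir_deriv v f x = cpd (v, v) F (x, x)" for v
    by (rule dir_deriv_eq) (rule diag_has_derivative[OF assms])
  then show ?thesis
    by (simp add: wirtinger_def lift_wirtinger_def)
qed

text \<open>The quantifier order is the point: the smaller radius and the constant depend on the
  operator and on \<open>r\<close>, but not on the functions, the centre or the scale, so the
  estimate is uniform as the centre approaches the boundary. The property is closed under
  composition, which reduces \<open>D_mixed\<close> to first-order operators.\<close>

definition diff_op ::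
    "nat \<Rightarrow> ((complex ^ 'n::finite \<Rightarrow> complex) \<Rightarrow> complex ^ 'n \<Rightarrow> complex) \<Rightarrow> bool"
  where "diff_op m T \<longleftrightarrow> (\<forall>r>0. \<exists>r'>0. \<exists>C.
    (\<forall>e f g. diag_close r e f g \<longrightarrow> diag_close r' (C * e) (T f) (T g)) \<and>
    (\<forall>c d p f h. c \<noteq> 0 \<longrightarrow> d \<noteq> 0 \<longrightarrow> diag_scaled r c d p f h \<longrightarrow> diag_scaled r' (c * d ^ m) d p (T f) (T h)))"

lemma diag_close_wirtinger:
  fixes f g :: "complex ^ 'n::finite \<Rightarrow> complex"
  assumes r: "r > 0" and s: "norm s = 1" and fg: "diag_close r e f g"
  defines "K \<equiv> 2 * (real DIM((complex ^ 'n) \<times> (complex ^ 'n)) + 1) / (r / 2)"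
  defines "C \<equiv> 8 * K"
  shows "diag_close (r / 2) (C * e) (wirtinger s j f) (wirtinger s j g)"
proof -
  obtain F G where F: "cdharmonic_on (ball 0 r) F" and G: "cdharmonic_on (ball 0 r) G"
    and e: "\<And>x. x \<in> ball 0 r \<Longrightarrow> norm (F x - G x) \<le> e"
    and fF: "\<And>x. norm (x, x) < r \<Longrightarrow> f x = F (x, x)" and gG: "\<And>x. norm (x, x) < r \<Longrightarrow> g x = G (x, x)"
    using fg unfolding diag_close_def by blast
  have sub: "ball 0 (r / 2) \<subseteq> ball (0 :: (complex ^ 'n) \<times> (complex ^ 'n)) r"
    using r by auto
  have H: "cdharmonic_on (ball 0 r) (\<lambda>x. F x - G x)"
    using cdharmonic_on_add[OF F cdharmonic_on_cmult[OF G, of "-1"]] by simp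
  \<comment> \<open>Real and imaginary part contribute at most 2 K e each, together 4 K e = C e /
    2.\<close>
  have bound: "norm (cpd (b, b) (\<lambda>x. F x - G x) x) \<le> C * e / 2"
    if x: "x \<in> ball 0 (r / 2)" and b: "b \<in> Basis" for x b
  proof -
    have "\<bar>Re (F y - G y)\<bar> \<le> e" "\<bar>Im (F y - G y)\<bar> \<le> e" if "y \<in> ball 0 r" for y
      using e[OF that] abs_Re_le_cmod[of "F y - G y"] abs_Im_le_cmod[of "F y - G y"] by linarith+
    note ReIm = this
    have "\<bar>pd (b, b) (\<lambda>x. Re (F x - G x)) x\<bar> \<le> 2 * (K * e)"
      unfolding K_def by (rule pd_diag_bound[OF _ ReIm(1) r x b]) (use H in \<open>simp_all add: cdharmonic_on_def\<close>)
    moreover have "\<bar>pd (b, b) (\<lambda>x. Im (F x - G x)) x\<bar> \<le> 2 * (K * e)"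
      unfolding K_def by (rule pd_diag_bound[OF _ ReIm(2) r x b]) (use H in \<open>simp_all add: cdharmonic_on_def\<close>)
    ultimately have "\<bar>pd (b, b) (\<lambda>x. Re (F x - G x)) x\<bar> + \<bar>pd (b, b) (\<lambda>x. Im (F x - G x)) x\<bar> \<le> C * e / 2"
      unfolding C_def by linarith
    then show ?thesis
      using cmod_le[of "cpd (b, b) (\<lambda>x. F x - G x) x"] unfolding cpd_def by simp
  qed
  have "norm (lift_wirtinger s j F x - lift_wirtinger s j G x) \<le> C * e" if x: "x \<in> ball 0 (r / 2)" for x
  proof -
    have xr: "x \<in> ball 0 r" using x sub by blast
    have ax: "axis j 1 \<in> (Basis :: (complex ^ 'n) set)" "axis j \<i> \<in> (Basis :: (complex ^ 'n) set)"
      by (auto simp: Basis_complex_def)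
    have "lift_wirtinger s j F x - lift_wirtinger s j G x
        = 1 / 2 * (cpd (axis j 1, axis j 1) (\<lambda>x. F x - G x) x + s * cpd (axis j \<i>, axis j \<i>) (\<lambda>x. F x - G x) x)"
      unfolding lift_wirtinger_def cpd_diff[OF F G open_ball xr, symmetric] by (simp add: algebra_simps)
    also have "norm \<dots> = 1 / 2 * norm (cpd (axis j 1, axis j 1) (\<lambda>x. F x - G x) x + s * cpd (axis j \<i>, axis j \<i>) (\<lambda>x. F x - G x) x)"
      by (simp add: norm_mult)
    also have "\<dots> \<le> 1 / 2 * (C * e / 2 + C * e / 2)"
      by (intro mult_left_mono norm_triangle_le add_mono)
        (use bound[OF x ax(1)] bound[OF x ax(2)] s in \<open>auto simp: norm_mult\<close>)
    also have "\<dots> \<le> C * e"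
      using order_trans[OF norm_ge_zero bound[OF x ax(1)]] by simp
    finally show ?thesis .
  qed
  moreover have "cdharmonic_on (ball 0 (r / 2)) (lift_wirtinger s j F)" "cdharmonic_on (ball 0 (r / 2)) (lift_wirtinger s j G)"
    using cdharmonic_on_subset[OF cdharmonic_lift_wirtinger sub] F G by auto
  moreover have "wirtinger s j f x = lift_wirtinger s j F (x, x)" "wirtinger s j g x = lift_wirtinger s j G (x, x)"
    if "norm (x, x) < r / 2" for x
    using wirtinger_diag[OF F fF] wirtinger_diag[OF G gG] that r by auto
  ultimately show ?thesis
    unfolding diag_close_def by blast
qed

text \<open>Differentiability of \<open>h\<close> is deduced rather than assumed: near p + d x it
  equals 1 / c times \<open>f\<close> composed with the inverse scaling, and \<open>f\<close> is
  differentiable through its harmonic extension.\<close>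

lemma diag_scaled_wirtinger:
  fixes f h :: "complex ^ 'n::finite \<Rightarrow> complex"
  assumes r: "r > 0" and cd: "c \<noteq> 0" "d \<noteq> 0" and fh: "diag_scaled r c d p f h"
  shows "diag_scaled (r / 2) (c * d) d p (wirtinger s j f) (wirtinger s j h)"
proof -
  obtain F where F: "cdharmonic_on (ball 0 r) F" and fF: "\<And>x. norm (x, x) < r \<Longrightarrow> f x = F (x, x)"
    and fh: "\<And>x. norm (x, x) < r \<Longrightarrow> f x = of_real c * h (p + d *\<^sub>R x)"
    using fh unfolding diag_scaled_def by blast
  have sub: "ball 0 (r / 2) \<subseteq> ball (0 :: (complex ^ 'n) \<times> (complex ^ 'n)) r"
    using r by auto
  have "wirtinger s j f x = of_real (c * d) * wirtinger s j h (p + d *\<^sub>R x)" if x: "norm (x, x) < r" for x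
  proof -
    let ?f' = "\<lambda>v. cpd (v, v) F (x, x)"
    let ?T = "\<lambda>y. (1 / d) *\<^sub>R (y - p)"
    note f' = diag_has_derivative[OF F fF x]
    have "(?T has_derivative (\<lambda>v. (1 / d) *\<^sub>R v)) (at (p + d *\<^sub>R x))"
      by (auto intro!: derivative_eq_intros)
    moreover have "(f has_derivative ?f') (at (?T (p + d *\<^sub>R x)))"
      using f' cd by simp
    ultimately have "((\<lambda>y. f (?T y)) has_derivative (\<lambda>v. ?f' ((1 / d) *\<^sub>R v))) (at (p + d *\<^sub>R x))"
      by (rule has_derivative_compose)
    then have "((\<lambda>y. of_real (1 / c) * f (?T y)) has_derivative (\<lambda>v. of_real (1 / c) * ?f' ((1 / d) *\<^sub>R v))) (at (p + d *\<^sub>R x))"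
      by (rule has_derivative_mult_right)
    then have "(h has_derivative (\<lambda>v. of_real (1 / c) * ?f' ((1 / d) *\<^sub>R v))) (at (p + d *\<^sub>R x))"
    proof (rule has_derivative_transform_within_open)
      show "open {y. norm (?T y, ?T y) < r}"
        by (intro open_Collect_less continuous_intros)
      show "p + d *\<^sub>R x \<in> {y. norm (?T y, ?T y) < r}"
        using x cd by simp
      show "of_real (1 / c) * f (?T y) = h y" if "y \<in> {y. norm (?T y, ?T y) < r}" for y
        using fh[of "?T y"] that cd by simp
    qed
    moreover have "?f' ((1 / d) *\<^sub>R v) = of_real (1 / d) * ?f' v" for v
      using linear_scale[OF has_derivative_linear[OF f'], of "1 / d" v] by (simp add: scaleR_conv_of_real)
    ultimately have dh: "dir_deriv v h (p + d *\<^sub>R x) = of_real (1 / c) * (of_real (1 / d) * ?f' v)" for v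
      by (simp add: dir_deriv_eq)
    have "dir_deriv v f x = ?f' v" for v
      by (rule dir_deriv_eq[OF f'])
    then show ?thesis
      unfolding wirtinger_def dh using cd by (simp add: field_simps)
  qed
  moreover have "cdharmonic_on (ball 0 (r / 2)) (lift_wirtinger s j F)"
    using cdharmonic_on_subset[OF cdharmonic_lift_wirtinger sub] F by auto
  moreover have "wirtinger s j f x = lift_wirtinger s j F (x, x)" if "norm (x, x) < r / 2" for x
    using wirtinger_diag[OF F fF] that r by auto
  ultimately show ?thesis
    unfolding diag_scaled_def using r by (intro exI[of _ "lift_wirtinger s j F"]) auto
qed

lemma diff_op_wirtinger:
  assumes "norm s = 1"
  shows "diff_op 1 (wirtinger s j)"
  unfolding diff_op_def
proof (intro allI impI)
  fix r :: real assume r: "r > 0"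
  show "\<exists>r'>0. \<exists>C. (\<forall>e f g. diag_close r e f g \<longrightarrow> diag_close r' (C * e) (wirtinger s j f) (wirtinger s j g)) \<and>
    (\<forall>c d p f h. c \<noteq> 0 \<longrightarrow> d \<noteq> 0 \<longrightarrow> diag_scaled r c d p f h \<longrightarrow>
      diag_scaled r' (c * d ^ 1) d p (wirtinger s j f) (wirtinger s j h))"
  proof (intro exI conjI allI impI)
    show "r / 2 > 0" using r by simp
    show "diag_close (r / 2) (8 * (2 * (real DIM((complex ^ 'a) \<times> (complex ^ 'a)) + 1) / (r / 2)) * e)
        (wirtinger s j f) (wirtinger s j g)" if "diag_close r e f g" for e f g
      by (rule diag_close_wirtinger[OF r assms that])
    show "diag_scaled (r / 2) (c * d ^ 1) d p (wirtinger s j f) (wirtinger s j h)"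
      if "c \<noteq> 0" "d \<noteq> 0" "diag_scaled r c d p f h" for c d p f h
      using diag_scaled_wirtinger[OF r that] by simp
  qed
qed

lemma diff_op_comp:
  assumes "diff_op m S" "diff_op l T"
  shows "diff_op (m + l) (\<lambda>f. T (S f))"
  unfolding diff_op_def
proof (intro allI impI)
  fix r :: real assume "r > 0"
  then obtain r1 C1 where 1: "r1 > 0" "\<And>e f g. diag_close r e f g \<Longrightarrow> diag_close r1 (C1 * e) (S f) (S g)"
    "\<And>c d p f h. c \<noteq> 0 \<Longrightarrow> d \<noteq> 0 \<Longrightarrow> diag_scaled r c d p f h \<Longrightarrow> diag_scaled r1 (c * d ^ m) d p (S f) (S h)"
    using assms(1) unfolding diff_op_def by meson
  then obtain r2 C2 where 2: "r2 > 0" "\<And>e f g. diag_close r1 e f g \<Longrightarrow> diag_close r2 (C2 * e) (T f) (T g)"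
    "\<And>c d p f h. c \<noteq> 0 \<Longrightarrow> d \<noteq> 0 \<Longrightarrow> diag_scaled r1 c d p f h \<Longrightarrow> diag_scaled r2 (c * d ^ l) d p (T f) (T h)"
    using assms(2) unfolding diff_op_def by meson
  have "diag_close r2 (C2 * C1 * e) (T (S f)) (T (S g))" if "diag_close r e f g" for e f g
    using 2(2)[OF 1(2)[OF that]] by (simp add: mult.assoc)
  moreover have "diag_scaled r2 (c * d ^ (m + l)) d p (T (S f)) (T (S h))"
    if "c \<noteq> 0" "d \<noteq> 0" "diag_scaled r c d p f h" for c d p f h
    using 2(3)[OF _ that(2) 1(3)[OF that]] that by (simp add: power_add mult.assoc)
  ultimately show "\<exists>r'>0. \<exists>C. (\<forall>e f g. diag_close r e f g \<longrightarrow> diag_close r' (C * e) (T (S f)) (T (S g))) \<and>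
    (\<forall>c d p f h. c \<noteq> 0 \<longrightarrow> d \<noteq> 0 \<longrightarrow> diag_scaled r c d p f h \<longrightarrow>
      diag_scaled r' (c * d ^ (m + l)) d p (T (S f)) (T (S h)))"
    using 2(1) by blast
qed

lemma diff_op_id: "diff_op 0 (\<lambda>f. f)"
  unfolding diff_op_def
proof (intro allI impI)
  fix r :: real assume "r > 0"
  then show "\<exists>r'>0. \<exists>C. (\<forall>e f g. diag_close r e f g \<longrightarrow> diag_close r' (C * e) f g) \<and>
    (\<forall>c d p f h. c \<noteq> 0 \<longrightarrow> d \<noteq> 0 \<longrightarrow> diag_scaled r c d p f h \<longrightarrow> diag_scaled r' (c * d ^ 0) d p f h)"
    by (intro exI[of _ r] conjI exI[of _ 1]) auto
qed

lemma diff_op_funpow: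
  assumes "diff_op 1 T"
  shows "diff_op m (T ^^ m)"
proof (induction m)
  case 0
  then show ?case using diff_op_id by (simp add: id_def)
next
  case (Suc m)
  have "diff_op (m + 1) (\<lambda>f. T ((T ^^ m) f))"
    by (rule diff_op_comp[OF Suc assms])
  then show ?case by (simp add: o_def)
qed

lemma diff_op_foldr:
  assumes "\<And>j. diff_op 1 (T j)"
  shows "diff_op (sum_list (map A js)) (\<lambda>f. foldr (\<lambda>j g. (T j ^^ A j) g) js f)"
proof (induction js)
  case Nil
  then show ?case using diff_op_id by simp
next
  case (Cons j js)
  show ?case
    using diff_op_comp[OF Cons diff_op_funpow[OF assms, of "A j" j]] by (simp add: add.commute)
qed

lemma diff_op_D_mixed:
  fixes A B :: "'n::{finite,linorder} \<Rightarrow> nat"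
  shows "diff_op (mi_abs A + mi_abs B) (D_mixed A B)"
proof -
  have mi: "sum_list (map A (sorted_list_of_set UNIV)) = mi_abs A" for A :: "'n \<Rightarrow> nat"
    by (simp add: mi_abs_def sum_list_distinct_conv_sum_set)
  have w: "diff_op 1 (dz j)" "diff_op 1 (dzbar j)" for j :: 'n
    unfolding dz_eq_wirtinger dzbar_eq_wirtinger by (rule diff_op_wirtinger, simp)+
  have "diff_op (mi_abs A) (D_holo A)"
    using diff_op_foldr[of dz A "sorted_list_of_set UNIV", OF w(1)] unfolding D_holo_def[abs_def] mi .
  moreover have "diff_op (mi_abs B) (D_anti B)"
    using diff_op_foldr[of dzbar B "sorted_list_of_set UNIV", OF w(2)] unfolding D_anti_def[abs_def] mi .
  ultimately show ?thesis
    using diff_op_comp[of "mi_abs B" "D_anti B" "mi_abs A" "D_holo A"]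
    by (simp add: D_mixed_def[abs_def] add.commute)
qed

lemma diff_op_stable:
  assumes "diff_op m T" "r > 0"
  obtains C where "\<And>e f g. diag_close r e f g \<Longrightarrow> norm (T f 0 - T g 0) \<le> C * e"
    "\<And>c d p f h. c \<noteq> 0 \<Longrightarrow> d \<noteq> 0 \<Longrightarrow> diag_scaled r c d p f h \<Longrightarrow> T f 0 = of_real (c * d ^ m) * T h p"
proof -
  obtain r' C where r': "r' > 0" "\<And>e f g. diag_close r e f g \<Longrightarrow> diag_close r' (C * e) (T f) (T g)"
    "\<And>c d p f h. c \<noteq> 0 \<Longrightarrow> d \<noteq> 0 \<Longrightarrow> diag_scaled r c d p f h \<Longrightarrow> diag_scaled r' (c * d ^ m) d p (T f) (T h)"
    using assms unfolding diff_op_def by meson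
  have z: "norm ((0, 0) :: (complex ^ 'a) \<times> (complex ^ 'a)) < r'"
    using r'(1) by (simp flip: zero_prod_def)
  show ?thesis
  proof (rule that)
    show "norm (T f 0 - T g 0) \<le> C * e" if "diag_close r e f g" for e f g
      using r'(2)[OF that] z unfolding diag_close_def by force
    show "T f 0 = of_real (c * d ^ m) * T h p" if "c \<noteq> 0" "d \<noteq> 0" "diag_scaled r c d p f h" for c d p f h
    proof -
      have "T f 0 = of_real (c * d ^ m) * T h (p + d *\<^sub>R 0)"
        using r'(3)[OF that] z unfolding diag_scaled_def by blast
      then show ?thesis by simp
    qed
  qed
qed

section \<open>Rescaling at the boundary\<close>

text \<open>\<open>N\<close> is the real gradient: twice the real part of the holomorphic
  differential is the real differential.\<close>

lemma half_space_eq: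
  fixes \<psi> :: "complex ^ 'n::finite \<Rightarrow> real"
  assumes "(\<psi> has_derivative (\<lambda>h. N \<bullet> h)) (at z0)"
  shows "half_space \<psi> z0 = {z. N \<bullet> z < 1}"
proof -
  have "((\<lambda>w. complex_of_real (\<psi> w)) has_derivative (\<lambda>h. complex_of_real (N \<bullet> h))) (at z0)"
    using assms by (rule has_derivative_of_real)
  from dir_deriv_eq[OF this]
  have dz: "dz j (\<lambda>w. complex_of_real (\<psi> w)) z0
      = (complex_of_real (N \<bullet> axis j 1) - \<i> * complex_of_real (N \<bullet> axis j \<i>)) / 2" for j
    by (simp add: dz_def)
  have "2 * Re (\<Sum>j\<in>UNIV. dz j (\<lambda>w. complex_of_real (\<psi> w)) z0 * z $ j) = N \<bullet> z" for z
  proof -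
    have "N \<bullet> axis j 1 = Re (N $ j)" "N \<bullet> axis j \<i> = Im (N $ j)" for j
      by (simp_all add: inner_axis inner_complex_def)
    then show ?thesis
      unfolding dz
      by (simp add: inner_vec_def[of N z] inner_complex_def sum_distrib_left add_divide_distrib)
  qed
  then show ?thesis
    by (simp add: half_space_def)
qed

text \<open>The estimate is needed with both points moving, since the rescaling is centred at a
  variable point p and not at \<open>z0\<close>.\<close>

lemma C2_strict_derivative:
  fixes \<psi> :: "'a::euclidean_space \<Rightarrow> real"
  assumes "C2_on U \<psi>" "open U" "z0 \<in> U" "(\<psi> has_derivative (\<lambda>h. N \<bullet> h)) (at z0)" "e > 0"
  shows "\<exists>r>0. ball z0 r \<subseteq> U \<and> (\<forall>x\<in>ball z0 r. \<forall>y\<in>ball z0 r. \<bar>\<psi> x - \<psi> y - N \<bullet> (x - y)\<bar> \<le> e * norm (x - y))"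
proof -
  obtain f' :: "'a \<Rightarrow> 'a \<Rightarrow>\<^sub>L real" and f'' :: "'a \<Rightarrow> 'a \<Rightarrow>\<^sub>L ('a \<Rightarrow>\<^sub>L real)" where
    f': "\<And>x. x \<in> U \<Longrightarrow> (\<psi> has_derivative blinfun_apply (f' x)) (at x)"
    and f'': "\<And>x. x \<in> U \<Longrightarrow> (f' has_derivative blinfun_apply (f'' x)) (at x)"
    using assms(1) unfolding C2_on_def by blast
  have N: "blinfun_apply (f' z0) = (\<lambda>h. N \<bullet> h)"
    by (rule has_derivative_unique[OF f'[OF assms(3)] assms(4)])
  have "isCont f' z0"
    using has_derivative_continuous[OF f''[OF assms(3)]] by simp
  then have "(f' \<longlongrightarrow> f' z0) (nhds z0)"
    by (simp add: isCont_def tendsto_nhds_iff)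
  then have "eventually (\<lambda>x. dist (f' x) (f' z0) < e) (nhds z0)"
    using assms(5) by (rule tendstoD)
  moreover have "eventually (\<lambda>x. x \<in> U) (nhds z0)"
    using assms by (intro eventually_nhds_in_open)
  ultimately have "eventually (\<lambda>x. x \<in> U \<and> dist (f' x) (f' z0) < e) (nhds z0)"
    by eventually_elim simp
  then obtain r where r: "r > 0" "\<And>x. x \<in> ball z0 r \<Longrightarrow> x \<in> U \<and> dist (f' x) (f' z0) < e"
    unfolding eventually_nhds_metric by (auto simp: dist_commute)
  have "norm ((\<psi> x - N \<bullet> x) - (\<psi> y - N \<bullet> y)) \<le> e * norm (x - y)" if "x \<in> ball z0 r" "y \<in> ball z0 r" for x y
  proof (rule differentiable_bound[where S = "ball z0 r" and f' = "\<lambda>x. blinfun_apply (f' x - f' z0)"])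
    fix x assume x: "x \<in> ball z0 r"
    have "((\<lambda>x. \<psi> x - N \<bullet> x) has_derivative (\<lambda>h. f' x h - N \<bullet> h)) (at x)"
      using r(2)[OF x] by (intro has_derivative_diff f' bounded_linear_imp_has_derivative bounded_linear_inner_right) auto
    moreover have "blinfun_apply (f' x - f' z0) = (\<lambda>h. f' x h - N \<bullet> h)"
      by (rule ext) (simp only: blinfun.diff_left N)
    ultimately show "((\<lambda>x. \<psi> x - N \<bullet> x) has_derivative blinfun_apply (f' x - f' z0)) (at x within ball z0 r)"
      by (simp only: has_derivative_at_withinI)
    show "onorm (blinfun_apply (f' x - f' z0)) \<le> e"
    proof -
      have "onorm (blinfun_apply (f' x - f' z0)) = dist (f' x) (f' z0)"
        unfolding dist_norm by (rule norm_blinfun.rep_eq[symmetric])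
      then show ?thesis using r(2)[OF x] by linarith
    qed
  qed (use that in simp_all)
  moreover have "(\<psi> x - N \<bullet> x) - (\<psi> y - N \<bullet> y) = \<psi> x - \<psi> y - N \<bullet> (x - y)" for x y
    by (simp add: inner_diff_right)
  ultimately have "\<forall>x\<in>ball z0 r. \<forall>y\<in>ball z0 r. \<bar>\<psi> x - \<psi> y - N \<bullet> (x - y)\<bar> \<le> e * norm (x - y)"
    by simp
  then show ?thesis
    using r by blast
qed


text \<open>With t = - \<open>\<psi>\<close> p, the rescaled function x |-> \<open>\<psi>\<close> (p
  + t x) / t has the value -1 at the origin by the choice of t, and it approaches N . x - 1
  uniformly for |x| <= R.\<close>

lemma rescaled_defining_function:
  fixes \<psi> :: "'a::euclidean_space \<Rightarrow> real"
  assumes U: "C2_on U \<psi>" "open U" "z0 \<in> U" and N: "(\<psi> has_derivative (\<lambda>h. N \<bullet> h)) (at z0)"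
    and "\<psi> z0 = 0" and D: "U \<inter> D = {z\<in>U. \<psi> z < 0}" and "R > 0" "e > 0"
  shows "eventually (\<lambda>p. \<psi> p < 0 \<and> (\<forall>x. norm x \<le> R \<longrightarrow> p + (- \<psi> p) *\<^sub>R x \<in> U \<and>
    \<bar>\<psi> (p + (- \<psi> p) *\<^sub>R x) - (- \<psi> p) * (N \<bullet> x - 1)\<bar> \<le> e * (- \<psi> p))) (at z0 within D)"
proof -
  \<comment> \<open>The displacement t x has length at most t R, so slope error e / R yields the
    error e t.\<close>
  obtain r where r: "r > 0" "ball z0 r \<subseteq> U"
    "\<And>x y. x \<in> ball z0 r \<Longrightarrow> y \<in> ball z0 r \<Longrightarrow> \<bar>\<psi> x - \<psi> y - N \<bullet> (x - y)\<bar> \<le> e / R * norm (x - y)"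
    using C2_strict_derivative[OF U N, of "e / R"] assms(7,8) by auto
  have "isCont \<psi> z0"
    using has_derivative_continuous[OF N] by simp
  then have "(\<psi> \<longlongrightarrow> 0) (at z0 within D)"
    using assms(5) by (simp add: isCont_def) (rule tendsto_within_subset, auto)
  then have "eventually (\<lambda>p. \<bar>\<psi> p\<bar> < r / (2 * R)) (at z0 within D)"
    using tendstoD[of \<psi> 0 _ "r / (2 * R)"] r(1) assms(7) by simp
  moreover have "eventually (\<lambda>p. p \<in> D \<and> dist p z0 < r / 2) (at z0 within D)"
    using r(1) by (auto simp: eventually_at intro!: exI[of _ "r / 2"])
  ultimately show ?thesis
  proof eventually_elim
    case (elim p)
    then have pr: "p \<in> ball z0 r"
      using r(1) by (simp add: dist_commute)
    then have p: "\<psi> p < 0"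
      using elim r(2) D by blast
    have "p + (- \<psi> p) *\<^sub>R x \<in> ball z0 r \<and>
        \<bar>\<psi> (p + (- \<psi> p) *\<^sub>R x) - (- \<psi> p) * (N \<bullet> x - 1)\<bar> \<le> e * (- \<psi> p)" if x: "norm x \<le> R" for x
    proof -
      let ?w = "p + (- \<psi> p) *\<^sub>R x"
      have "norm ((- \<psi> p) *\<^sub>R x) \<le> (- \<psi> p) * R"
        using p x by (simp add: mult_left_mono)
      also have "\<dots> < r / 2"
        using elim(1) p assms(7) by (simp add: field_simps)
      finally have "dist ?w p < r / 2"
        by (simp add: dist_norm)
      then have w: "?w \<in> ball z0 r"
        using elim(2) dist_triangle[of ?w z0 p] by (simp add: dist_commute)
      have "\<bar>\<psi> ?w - \<psi> p - N \<bullet> (?w - p)\<bar> \<le> e / R * norm (?w - p)"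
        by (rule r(3)[OF w pr])
      also have "\<dots> \<le> e / R * ((- \<psi> p) * R)"
        using p x assms(7,8) by (intro mult_left_mono) (auto simp: mult_left_mono)
      also have "\<dots> = e * (- \<psi> p)"
        using assms(7) by simp
      finally show ?thesis
        using w by (simp add: algebra_simps)
    qed
    then show ?case
      using p r(2) by blast
  qed
qed

section \<open>Comparing the kernel with its mirror image\<close>

text \<open>After multiplication by m the reciprocals m / a and m / b lie in the unit interval,
  where the k-th power has Lipschitz constant k.\<close>

lemma inverse_power_diff_bound:
  fixes a b m :: real
  assumes "m > 0" "a \<ge> m" "b \<ge> m"
  shows "\<bar>inverse (a ^ k) - inverse (b ^ k)\<bar> \<le> real k * inverse (m ^ Suc k) * \<bar>a - b\<bar>"
proof -
  have ab: "a > 0" "b > 0" using assms by auto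
  have "norm ((m / a) ^ k - (m / b) ^ k) \<le> real k * norm (m / a - m / b)"
    using assms ab by (intro norm_power_diff) auto
  also have "\<bar>m / a - m / b\<bar> \<le> \<bar>a - b\<bar> / m"
  proof -
    have "m / a - m / b = m * (b - a) / (a * b)"
      using ab by (simp add: field_simps)
    then have "\<bar>m / a - m / b\<bar> = m * \<bar>a - b\<bar> / (a * b)"
      using ab assms(1) by (simp add: abs_mult abs_minus_commute)
    also have "\<dots> \<le> m * \<bar>a - b\<bar> / (m * m)"
      using assms ab by (intro divide_left_mono mult_mono mult_pos_pos) auto
    finally show ?thesis using assms(1) by simp
  qed
  then have "real k * norm (m / a - m / b) \<le> real k * (\<bar>a - b\<bar> / m)"
    by (intro mult_left_mono) auto
  finally have "\<bar>(m / a) ^ k - (m / b) ^ k\<bar> \<le> real k * (\<bar>a - b\<bar> / m)"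
    by simp
  then have "inverse (m ^ k) * \<bar>(m / a) ^ k - (m / b) ^ k\<bar> \<le> inverse (m ^ k) * (real k * (\<bar>a - b\<bar> / m))"
    using assms(1) by (intro mult_left_mono) auto
  moreover have "inverse (m ^ k) * \<bar>(m / a) ^ k - (m / b) ^ k\<bar> = \<bar>inverse (a ^ k) - inverse (b ^ k)\<bar>"
  proof -
    have "inverse (a ^ k) - inverse (b ^ k) = inverse (m ^ k) * ((m / a) ^ k - (m / b) ^ k)"
      using assms(1) ab by (simp add: power_divide field_simps)
    then show ?thesis
      using assms(1) by (simp add: abs_mult)
  qed
  ultimately show ?thesis
    using assms(1) by (simp add: field_simps)
qed

text \<open>The radius 1/(2|N|) is half the distance from the origin to the mirror. Consequently N .
  q <= 1/2, while the image satisfies N . q* >= 3/2 and stays bounded.\<close>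

lemma norm_reflection_le:
  assumes N: "N \<noteq> 0" and q: "norm q \<le> 1 / (2 * norm N)"
  shows "\<bar>N \<bullet> q\<bar> \<le> 1 / 2" "norm (reflection N q) \<le> 4 / norm N"
proof -
  have "\<bar>N \<bullet> q\<bar> \<le> norm N * norm q"
    by (rule Cauchy_Schwarz_ineq2)
  also have "\<dots> \<le> norm N * (1 / (2 * norm N))"
    using q by (intro mult_left_mono) auto
  finally show a: "\<bar>N \<bullet> q\<bar> \<le> 1 / 2"
    using N by simp
  have "norm ((2 * s / (N \<bullet> N)) *\<^sub>R N) = 2 * \<bar>s\<bar> / norm N" for s
    using N by (simp add: abs_mult power2_norm_eq_inner[symmetric] power2_eq_square)
  then have "norm ((2 * (1 - N \<bullet> q) / (N \<bullet> N)) *\<^sub>R N) = 2 * \<bar>1 - N \<bullet> q\<bar> / norm N" .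
  also have "\<dots> \<le> 3 / norm N"
    using a by (intro divide_right_mono) auto
  finally have "norm (reflection N q) \<le> 1 / (2 * norm N) + 3 / norm N"
    unfolding reflection_def using q by (intro norm_triangle_le add_mono)
  also have "\<dots> \<le> 4 / norm N"
    using N by (simp add: field_simps)
  finally show "norm (reflection N q) \<le> 4 / norm N" .
qed

text \<open>Near the hyperplane the two kernels agree because it is the mirror; far away both are small.\<close>

lemma newton_reflection_close:
  fixes N :: "'a::euclidean_space"
  assumes N: "N \<noteq> 0" and k: "k \<ge> 1" and "e > 0"
  obtains R d where "R > 4 / norm N" "0 < d" "d < 1 / 4"
    "\<And>q x. norm q \<le> 1 / (2 * norm N) \<Longrightarrow> (norm x \<le> R \<Longrightarrow> \<bar>N \<bullet> x - 1\<bar> \<le> d) \<Longrightarrow>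
      \<bar>newton k (x - q) - newton k (x - reflection N q)\<bar> \<le> e"
proof -
  \<comment> \<open>Beyond radius \<open>R\<close> both poles are at distance at least
    \<open>s\<close>, and s^(-2 k) <= 1 / s <= e since s >= 1 and k >= 1.\<close>
  define s where "s = max 1 (1 / e)"
  define R where "R = 4 / norm N + s"
  \<comment> \<open>|N . y| >= 1/4 forces |y|^2 >= m by Cauchy-Schwarz; it is applied to the
    differences of x with each pole.\<close>
  define m where "m = (1 / 16) / (N \<bullet> N)"
  \<comment> \<open>The 6 is 4 times 3/2, the latter bounding |1 - N . q| in
    \<open>reflection_dist\<close>.\<close>
  define L where "L = real k * inverse (m ^ Suc k) * (6 / (N \<bullet> N))"
  \<comment> \<open>The cap 1/5 keeps d below 1/4, so that N . x stays at least 1/4 away from the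
    values N . q and N . q*; the other term gives L d <= e.\<close>
  define d where "d = min (1 / 5) (e / (L + 1))"
  have NN: "N \<bullet> N > 0" using N by simp
  have m: "m > 0" using NN by (simp add: m_def)
  have L: "L \<ge> 0" using m NN by (simp add: L_def)
  have d: "0 < d" "d < 1 / 4" "L * d \<le> e"
  proof -
    show "0 < d" "d < 1 / 4" using L \<open>e > 0\<close> by (auto simp: d_def)
    have "L * d \<le> L * (e / (L + 1))"
      using L by (intro mult_left_mono) (auto simp: d_def)
    also have "\<dots> \<le> e" using L \<open>e > 0\<close> by (simp add: field_simps)
    finally show "L * d \<le> e" .
  qed
  show ?thesis
  proof (rule that)
    show "R > 4 / norm N" by (simp add: R_def s_def)
    fix q x :: 'a assume q: "norm q \<le> 1 / (2 * norm N)" and x: "norm x \<le> R \<Longrightarrow> \<bar>N \<bullet> x - 1\<bar> \<le> d"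
    note Q = norm_reflection_le[OF N q]
    show "\<bar>newton k (x - q) - newton k (x - reflection N q)\<bar> \<le> e"
    proof (cases "norm x \<le> R")
      case False
      have far: "newton k (x - y) \<le> e" if "norm y \<le> 4 / norm N" for y
      proof -
        have "norm (x - y) \<ge> s"
          using False that norm_triangle_ineq2[of x y] by (simp add: R_def)
        then have "newton k (x - y) \<le> inverse (s ^ (2 * k))"
          by (intro newton_le) (auto simp: s_def)
        also have "\<dots> \<le> inverse s"
          using k by (intro le_imp_inverse_le self_le_power) (auto simp: s_def)
        also have "\<dots> \<le> inverse (1 / e)"
          using \<open>e > 0\<close> by (intro le_imp_inverse_le) (auto simp: s_def)
        finally show ?thesis by simp
      qed
      have "norm q \<le> 4 / norm N"
        using order_trans[OF q, of "4 / norm N"] N by (simp add: field_simps)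
      then show ?thesis
        using far[of q] far[OF Q(2)] newton_nonneg[of k "x - q"] newton_nonneg[of k "x - reflection N q"]
        by linarith
    next
      case True
      then have x: "\<bar>N \<bullet> x - 1\<bar> \<le> d" by (rule x)
      have low: "m \<le> y \<bullet> y" if "\<bar>N \<bullet> y\<bar> \<ge> 1 / 4" for y
      proof -
        have "(1 / 4)\<^sup>2 \<le> \<bar>N \<bullet> y\<bar>\<^sup>2"
          using that by (intro power_mono) auto
        then have "(1 / 4)\<^sup>2 \<le> (N \<bullet> y)\<^sup>2"
          by simp
        also have "\<dots> \<le> (N \<bullet> N) * (y \<bullet> y)"
          by (rule Cauchy_Schwarz_ineq)
        finally show ?thesis
          using NN by (simp add: m_def field_simps power2_eq_square)
      qed
      have a: "m \<le> (x - q) \<bullet> (x - q)"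
        using x Q(1) d(2) by (intro low) (auto simp: inner_diff_right)
      have b: "m \<le> (x - reflection N q) \<bullet> (x - reflection N q)"
        using x Q(1) d(2) by (intro low) (auto simp: inner_diff_right inner_reflection[OF N])
      have "\<bar>(x - q) \<bullet> (x - q) - (x - reflection N q) \<bullet> (x - reflection N q)\<bar>
          = 4 * (\<bar>1 - N \<bullet> q\<bar> * \<bar>1 - N \<bullet> x\<bar>) / (N \<bullet> N)"
        unfolding reflection_dist[OF N] using NN by (simp add: abs_mult)
      also have "\<dots> \<le> 4 * (3 / 2 * d) / (N \<bullet> N)"
        using Q(1) x NN by (intro divide_right_mono mult_left_mono mult_mono) auto
      finally have ab: "\<bar>(x - q) \<bullet> (x - q) - (x - reflection N q) \<bullet> (x - reflection N q)\<bar> \<le> 6 / (N \<bullet> N) * d"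
        by simp
      have "\<bar>newton k (x - q) - newton k (x - reflection N q)\<bar>
          \<le> real k * inverse (m ^ Suc k) * \<bar>(x - q) \<bullet> (x - q) - (x - reflection N q) \<bullet> (x - reflection N q)\<bar>"
        unfolding newton_def by (rule inverse_power_diff_bound[OF m a b])
      also have "\<dots> \<le> real k * inverse (m ^ Suc k) * (6 / (N \<bullet> N) * d)"
        using m by (intro mult_left_mono ab) auto
      also have "\<dots> = L * d"
        by (simp add: L_def)
      finally show ?thesis using d(3) by linarith
    qed
  qed (use d in auto)
qed

section \<open>The rescaled Robin function near a boundary point\<close>

text \<open>For the pole p + t q the comparison function is the kernel with pole p + t q*. That pole
  lies outside the closure of \<open>D\<close>, so the kernel solves a Dirichlet problem in
  \<open>D\<close> with its own boundary values, and the maximum principle reduces everything to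
  comparing data on the frontier.\<close>

lemma robin_scaled_close:
  fixes D :: "(complex ^ 'n::finite) set"
  assumes n: "CARD('n) > 1" and D: "regular_domain D" "bounded D"
    and U: "C2_on U \<psi>" "open U" "z0 \<in> U" and N: "(\<psi> has_derivative (\<lambda>h. N \<bullet> h)) (at z0)" "N \<noteq> 0"
    and \<psi>: "\<psi> z0 = 0" "U \<inter> D = {z\<in>U. \<psi> z < 0}" "U \<inter> frontier D = {z\<in>U. \<psi> z = 0}" and "e > 0"
  defines "k \<equiv> CARD('n) - 1" and "r \<equiv> 1 / (2 * norm N)"
  shows "eventually (\<lambda>p. p \<in> D \<and> \<psi> p < 0 \<and>
    diag_close r e (\<lambda>x. of_real ((- \<psi> p) ^ (2 * k) * robin D (p + (- \<psi> p) *\<^sub>R x)))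
      (\<lambda>x. of_real (robin {z. N \<bullet> z < 1} x)) \<and>
    diag_scaled r ((- \<psi> p) ^ (2 * k)) (- \<psi> p) p
      (\<lambda>x. of_real ((- \<psi> p) ^ (2 * k) * robin D (p + (- \<psi> p) *\<^sub>R x)))
      (\<lambda>x. of_real (robin D x))) (at z0 within D)"
proof -
  have dim: "DIM(complex ^ 'n) = 2 * k + 2"
    using n by (simp add: k_def)
  have k: "k \<ge> 1" using n by (simp add: k_def)
  have opD: "open D" using D(1) by (simp add: regular_domain_def)
  have fr: "w \<notin> D" if "w \<in> frontier D" for w
    using that opD by (simp add: frontier_def interior_open)
  have "\<exists>u. solves_dirichlet D (\<lambda>w. newton k (w - q)) u" if q: "q \<in> D" for q
  proof (rule regular_domain_solvable[OF D])
    show "continuous_on (frontier D) (\<lambda>w. newton k (w - q))"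
      unfolding newton_def using fr q by (intro continuous_intros) auto
  qed
  then obtain V where V: "\<And>q. q \<in> D \<Longrightarrow> solves_dirichlet D (\<lambda>w. newton k (w - q)) (V q)"
    by metis
  have robD: "robin D q = - V q q" if "q \<in> D" for q
    using robin_eq_dirichlet[OF n opD D(2) that] V[OF that] by (simp add: k_def)
  define H where "H = {z. N \<bullet> z < 1}"
  have robH: "robin H q = - newton k (q - reflection N q)" if "q \<in> H" for q
    using robin_halfspace[OF n N(2)] that by (simp add: k_def H_def)
  obtain R d where R: "R > 4 / norm N" and d: "0 < d" "d < 1 / 4"
    and close: "\<And>q x. norm q \<le> 1 / (2 * norm N) \<Longrightarrow> (norm x \<le> R \<Longrightarrow> \<bar>N \<bullet> x - 1\<bar> \<le> d) \<Longrightarrow>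
      \<bar>newton k (x - q) - newton k (x - reflection N q)\<bar> \<le> e"
    using newton_reflection_close[OF N(2) k \<open>e > 0\<close>] by metis
  have Npos: "norm N > 0" using N by simp
  have "R > 0" using R Npos by (smt (verit) divide_pos_pos)
  have rR: "r \<le> R"
    using R Npos by (simp add: r_def field_simps)
  have "eventually (\<lambda>p. p \<in> D) (at z0 within D)"
    by (simp add: eventually_at_filter)
  with rescaled_defining_function[OF U N(1) \<psi>(1,2) \<open>R > 0\<close> d(1)] show ?thesis
  proof eventually_elim
    case (elim p)
    define t where "t = - \<psi> p"
    have t: "t > 0" using elim by (simp add: t_def)
    have inU: "p + t *\<^sub>R x \<in> U" and flat: "\<bar>\<psi> (p + t *\<^sub>R x) - t * (N \<bullet> x - 1)\<bar> \<le> d * t" if "norm x \<le> R" for x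
      using elim that by (auto simp: t_def)
    have small: "p + t *\<^sub>R x \<in> D" "x \<in> H" if x: "norm x \<le> r" for x
    proof -
      have Nx: "\<bar>N \<bullet> x\<bar> \<le> 1 / 2"
        using norm_reflection_le(1)[OF N(2)] x by (simp add: r_def)
      then show "x \<in> H" by (auto simp: H_def)
      have xR: "norm x \<le> R" using x rR by simp
      have "t * (N \<bullet> x - 1) \<le> t * (- 1 / 2)"
        using Nx t by (intro mult_left_mono) auto
      moreover have "d * t < 1 / 4 * t"
        using d t by (intro mult_strict_right_mono) auto
      ultimately have "\<psi> (p + t *\<^sub>R x) < 0"
        using flat[OF xR] t by linarith
      then show "p + t *\<^sub>R x \<in> D"
        using \<psi>(2) inU[OF xR] by blast
    qed
    \<comment> \<open>At the image point the affine model is at least t / 2 and the error is below t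
      / 4, so \<open>\<psi>\<close> is positive there.\<close>
    have refl_out: "p + t *\<^sub>R reflection N q \<notin> closure D" if q: "norm q \<le> r" for q
    proof
      assume cl: "p + t *\<^sub>R reflection N q \<in> closure D"
      note Q = norm_reflection_le[OF N(2), of q]
      have QR: "norm (reflection N q) \<le> R"
        using Q(2) q R by (simp add: r_def)
      have "p + t *\<^sub>R reflection N q \<in> D \<or> p + t *\<^sub>R reflection N q \<in> frontier D"
        using cl opD by (auto simp: frontier_def interior_open)
      then have "\<psi> (p + t *\<^sub>R reflection N q) < 0 \<or> \<psi> (p + t *\<^sub>R reflection N q) = 0"
        using inU[OF QR] \<psi>(2,3) by blast
      moreover have "t * (N \<bullet> reflection N q - 1) \<ge> t * (1 / 2)"
        using Q(1) q t unfolding inner_reflection[OF N(2)] by (intro mult_left_mono) (auto simp: r_def)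
      moreover have "d * t < 1 / 4 * t"
        using d t by (intro mult_strict_right_mono) auto
      ultimately show False
        using flat[OF QR] t by linarith
    qed
    have main: "\<bar>t ^ (2 * k) * V (p + t *\<^sub>R q) (p + t *\<^sub>R z) - newton k (z - reflection N q)\<bar> \<le> e"
      if q: "norm q \<le> r" and z: "norm z \<le> r" for q z
    proof -
      let ?v = "\<lambda>w. newton k (w - (p + t *\<^sub>R reflection N q))"
      \<comment> \<open>Homogeneity of degree - 2 k absorbs the factor t^(2 k) and passes to
        rescaled coordinates.\<close>
      have sc: "t ^ (2 * k) * newton k (w - (p + t *\<^sub>R y)) = newton k ((1 / t) *\<^sub>R (w - p) - y)" for w y
      proof -
        have "w - (p + t *\<^sub>R y) = t *\<^sub>R ((1 / t) *\<^sub>R (w - p) - y)"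
          using t by (simp add: algebra_simps)
        then show ?thesis
          using t by (simp add: newton_scale)
      qed
      have "solves_dirichlet D ?v ?v"
        unfolding solves_dirichlet_def
      proof (intro conjI ballI refl)
        show "continuous_on (closure D) ?v"
          unfolding newton_def using refl_out[OF q] by (intro continuous_intros) auto
        show "dharmonic_on D ?v"
          by (rule newton_dharmonic_shift[OF dim]) (use refl_out[OF q] closure_subset in blast)
      qed
      from solves_dirichlet_cmult[OF solves_dirichlet_diff[OF V[OF small(1)[OF q]] this], of "t ^ (2 * k)"]
      have "\<bar>t ^ (2 * k) * (V (p + t *\<^sub>R q) (p + t *\<^sub>R z) - ?v (p + t *\<^sub>R z))\<bar> \<le> e"
      proof (rule solves_dirichlet_bound[OF opD D(2)])
        show "p + t *\<^sub>R z \<in> closure D"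
          using small(1)[OF z] closure_subset by blast
        fix w assume w: "w \<in> frontier D"
        define x where "x = (1 / t) *\<^sub>R (w - p)"
        have wx: "w = p + t *\<^sub>R x" using t by (simp add: x_def)
        have "\<bar>newton k (x - q) - newton k (x - reflection N q)\<bar> \<le> e"
        proof (rule close)
          show "norm q \<le> 1 / (2 * norm N)" using q by (simp add: r_def)
          assume xR: "norm x \<le> R"
          have "\<psi> w = 0"
            using w inU[OF xR] \<psi>(3) wx by blast
          then have "t * \<bar>N \<bullet> x - 1\<bar> \<le> t * d"
            using flat[OF xR] t wx by (simp add: abs_mult mult.commute)
          then show "\<bar>N \<bullet> x - 1\<bar> \<le> d" using t by simp
        qed
        then show "\<bar>t ^ (2 * k) * (newton k (w - (p + t *\<^sub>R q)) - ?v w)\<bar> \<le> e"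
          unfolding right_diff_distrib sc x_def .
      qed
      then show ?thesis
        unfolding right_diff_distrib sc using t by simp
    qed
    \<comment> \<open>The signs reflect that both Robin functions are the negative of the regular
      part; the centre (p, p) rescales point and pole simultaneously.\<close>
    define F where "F = (\<lambda>x. complex_of_real (- (t ^ (2 * k)) * (\<lambda>(z, q). V q z) ((p, p) + t *\<^sub>R x)))"
    define G where "G = (\<lambda>x. complex_of_real (- 1 * (\<lambda>(z, q). newton k (z - reflection N q)) x))"
    have comp: "norm (fst x) \<le> r" "norm (snd x) \<le> r" if "x \<in> ball 0 r" for x :: "(complex ^ 'n) \<times> (complex ^ 'n)"
      using that norm_fst_le[of "fst x" "snd x"] norm_snd_le[of "snd x" "fst x"] by auto
    have F: "cdharmonic_on (ball 0 r) F"
      unfolding F_def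
    proof (intro cdharmonic_on_of_real dharmonic_on_cmult)
      show "dharmonic_on (ball 0 r) (\<lambda>x. (\<lambda>(z, q). V q z) ((p, p) + t *\<^sub>R x))"
        by (rule dharmonic_on_subset[OF dharmonic_on_compose_scale[OF newton_solution_dharmonic[OF dim opD D(2) V]]])
          (use t comp small in auto)
    qed
    have G: "cdharmonic_on (ball 0 r) G"
      unfolding G_def
    proof (intro cdharmonic_on_of_real dharmonic_on_cmult)
      show "dharmonic_on (ball 0 r) (\<lambda>(z, q). newton k (z - reflection N q))"
        by (rule dharmonic_on_subset[OF newton_reflection_dharmonic[OF dim N(2)]])
          (use comp small in \<open>auto simp: H_def\<close>)
    qed
    have FG: "norm (F x - G x) \<le> e" if "x \<in> ball 0 r" for x
    proof -
      have "F x - G x = - complex_of_real (t ^ (2 * k) * V (p + t *\<^sub>R snd x) (p + t *\<^sub>R fst x)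
          - newton k (fst x - reflection N (snd x)))"
        by (simp add: F_def G_def case_prod_unfold)
      then show ?thesis
        using main[OF comp(2,1)[OF that]] by (simp only: norm_minus_cancel norm_of_real)
    qed
    have diag: "of_real (t ^ (2 * k) * robin D (p + t *\<^sub>R x)) = F (x, x)" "of_real (robin H x) = G (x, x)"
      if "norm (x, x) < r" for x
    proof -
      have "norm x \<le> r"
        using comp(1)[of "(x, x)"] that by simp
      then show "of_real (t ^ (2 * k) * robin D (p + t *\<^sub>R x)) = F (x, x)" "of_real (robin H x) = G (x, x)"
        using small[of x] by (simp_all add: F_def G_def robD robH)
    qed
    have "diag_close r e (\<lambda>x. of_real (t ^ (2 * k) * robin D (p + t *\<^sub>R x))) (\<lambda>x. of_real (robin H x))"
      unfolding diag_close_def using F G FG diag by blast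
    moreover have "diag_scaled r (t ^ (2 * k)) t p (\<lambda>x. of_real (t ^ (2 * k) * robin D (p + t *\<^sub>R x))) (\<lambda>x. of_real (robin D x))"
      unfolding diag_scaled_def using F diag(1) by (intro exI[of _ F]) simp
    ultimately show ?case
      using elim by (simp add: t_def H_def)
  qed
qed

section \<open>Convergence of all derivatives\<close>

theorem theorem1p1:
  fixes D \<Gamma> :: "(complex ^ 'n::{finite,linorder}) set"
    and z0 :: "complex ^ 'n::{finite,linorder}"
    and \<psi> :: "complex ^ 'n::{finite,linorder} \<Rightarrow> real"
    and A B :: "'n \<Rightarrow> nat"
  assumes "CARD('n) > 1"
    and "bounded D" and "regular_domain D"
    and "C2_boundary_piece D \<Gamma>" and "z0 \<in> \<Gamma>"
    and "local_defining_function D \<Gamma> z0 \<psi>"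
  shows "((\<lambda>z. (-1) ^ (mi_abs A + mi_abs B)
              * D_mixed A B (\<lambda>w. complex_of_real (robin D w)) z
              * complex_of_real (\<psi> z) ^ (2 * CARD('n) - 2 + mi_abs A + mi_abs B))
           \<longlongrightarrow> D_mixed A B (\<lambda>w. complex_of_real (robin (half_space \<psi> z0) w)) 0)
         (at z0 within D)"
proof -
  obtain U where U: "open U" "z0 \<in> U" "C2_on U \<psi>" and grad: "\<forall>z\<in>U. \<exists>g. GDERIV \<psi> z :> g \<and> g \<noteq> 0"
    and UD: "U \<inter> D = {z\<in>U. \<psi> z < 0}" "U \<inter> frontier D = U \<inter> \<Gamma>" "U \<inter> \<Gamma> = {z\<in>U. \<psi> z = 0}"
    using assms(6) unfolding local_defining_function_def by blast
  obtain N where N: "GDERIV \<psi> z0 :> N" "N \<noteq> 0"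
    using grad U(2) by blast
  then have N': "(\<psi> has_derivative (\<lambda>h. N \<bullet> h)) (at z0)"
    by (simp add: gderiv_def inner_commute)
  have \<psi>0: "\<psi> z0 = 0"
    using UD(3) U(2) assms(5) by blast
  have fr: "U \<inter> frontier D = {z\<in>U. \<psi> z = 0}"
    using UD by simp
  define k where "k = CARD('n) - 1"
  define m where "m = mi_abs A + mi_abs B"
  define r where "r = 1 / (2 * norm N)"
  have "r > 0" using N by (simp add: r_def)
  define g where "g = (\<lambda>w. complex_of_real (robin {z. N \<bullet> z < 1} w))"
  define h where "h = (\<lambda>w. complex_of_real (robin D w))"
  obtain C where C: "\<And>e f g. diag_close r e f g \<Longrightarrow> norm (D_mixed A B f 0 - D_mixed A B g 0) \<le> C * e"
    "\<And>c d p f h. c \<noteq> 0 \<Longrightarrow> d \<noteq> 0 \<Longrightarrow> diag_scaled r c d p f h \<Longrightarrow>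
      D_mixed A B f 0 = of_real (c * d ^ m) * D_mixed A B h p"
    using diff_op_stable[OF diff_op_D_mixed \<open>r > 0\<close>, of A B] unfolding m_def by metis
  have exp: "2 * CARD('n) - 2 + mi_abs A + mi_abs B = 2 * k + m"
    using assms(1) by (simp add: k_def m_def)
  have "((\<lambda>z. (-1) ^ m * D_mixed A B h z * complex_of_real (\<psi> z) ^ (2 * k + m)) \<longlongrightarrow> D_mixed A B g 0) (at z0 within D)"
  proof (rule tendstoI)
    fix e :: real assume "e > 0"
    \<comment> \<open>The constant \<open>C\<close> carries no sign information, so |C| + 1 serves
      as a positive denominator.\<close>
    define d where "d = e / (\<bar>C\<bar> + 1)"
    have d: "d > 0" "C * d < e"
    proof -
      show "d > 0" using \<open>e > 0\<close> by (simp add: d_def add_nonneg_pos)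
      have "C * d \<le> \<bar>C\<bar> * d" using \<open>d > 0\<close> by (intro mult_right_mono) auto
      also have "\<dots> < (\<bar>C\<bar> + 1) * d" using \<open>d > 0\<close> by simp
      also have "\<dots> = e" by (simp add: d_def)
      finally show "C * d < e" .
    qed
    show "eventually (\<lambda>z. dist ((-1) ^ m * D_mixed A B h z * complex_of_real (\<psi> z) ^ (2 * k + m)) (D_mixed A B g 0) < e)
        (at z0 within D)"
      using robin_scaled_close[OF assms(1,3,2) U(3,1,2) N' N(2) \<psi>0 UD(1) fr d(1),
          folded k_def r_def]
    proof eventually_elim
      case (elim p)
      let ?f = "\<lambda>x. complex_of_real ((- \<psi> p) ^ (2 * k) * robin D (p + (- \<psi> p) *\<^sub>R x))"
      have "norm (D_mixed A B ?f 0 - D_mixed A B g 0) \<le> C * d"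
        using elim by (intro C(1)) (simp add: g_def)
      moreover have "D_mixed A B ?f 0 = of_real ((- \<psi> p) ^ (2 * k) * (- \<psi> p) ^ m) * D_mixed A B h p"
        using elim by (intro C(2)) (auto simp: h_def)
      \<comment> \<open>The exponent 2 k is even, so the sign of - \<open>\<psi>\<close> p survives
        only in the \<open>m\<close> factors that come from the derivatives.\<close>
      moreover have "complex_of_real ((- \<psi> p) ^ (2 * k) * (- \<psi> p) ^ m) = (-1) ^ m * complex_of_real (\<psi> p) ^ (2 * k + m)"
        by (simp add: power_add power_minus[of "complex_of_real (\<psi> p)"] mult_ac)
      ultimately show ?case
        using d(2) by (simp add: dist_norm mult_ac)
    qed
  qed
  then show ?thesis
    unfolding exp half_space_eq[OF N'] by (simp add: m_def g_def h_def)
qed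


end
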